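(* Let $\mathbf{A}=(A_s)_{s\in T}$ and $\mathbf{B}=(B_s)_{s\in T}$ be continuous fields of strictly positive operators in $\mathscr A$ such that $0<mA_s\le B_s\le MA_s$ for all $s\in T$, for some positive real numbers $m,M$ with $m<1<M$, and such that $\int_T A_s\,d\mu(s)=\int_T B_s\,d\mu(s)=I_{\mathscr H}$. Let $f:(0,\infty)\to[0,\infty)$ be operator concave, let $p\in[0,1]$, and let $t_0$ be a fixed positive real number. Then $$f\left[\int_T (A_s\natural_{p+1}B_s)\,d\mu(s)+t_0\left(I_{\mathscr H}-\int_T A_s\natural_p B_s\,d\mu(s)\right)\right]-f(t_0)\left(I_{\mathscr H}-\int_T A_s\natural_p B_s\,d\mu(s)\right)\ \ge\ \widetilde S_p^f(\mathbf A|\mathbf B).$$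
   Context: $\mathscr H$ is a complex Hilbert space with identity operator $I_{\mathscr H}$, $\mathbb B(\mathscr H)$ is the algebra of bounded linear operators, and $\le$ is the usual (Loewner) order on self-adjoint operators. An operator is strictly positive if it is positive and invertible. $\mathscr A$ is a $C^*$-algebra of operators acting on $\mathscr H$, $T$ is a locally compact Hausdorff space and $\mu$ is a Radon measure on $T$. A family $(A_t)_{t\in T}$ in $\mathscr A$ is a continuous field of operators if $t\mapsto A_t$ is norm continuous and $t\mapsto\|A_t\|$ is $\mu$-integrable; its Bochner integral $\int_T A_t\,d\mu(t)$ is the unique element of $\mathscr A$ with $\varphi(\int_T A_t\,d\mu(t))=\int_T\varphi(A_t)\,d\mu(t)$ for all $\varphi\in\mathscr A^*$. A continuous function $f:J\to\mathbb R$ on an interval $J$ is operator concave if $\lambda f(X)+(1-\lambda)f(Y)\le f(\lambda X+(1-\lambda)Y)$ for all $\lambda\in[0,1]$ and all self-adjoint operators $X,Y$ (on any complex Hilbert space) with spectra in $J$. For strictly positive $X,Y$ and $q\in\mathbb R$: $X\natural_q Y=X^{1/2}(X^{-1/2}YX^{-1/2})^qX^{1/2}$ and $S_q^f(X|Y)=X^{1/2}(X^{-1/2}YX^{-1/2})^q f(X^{-1/2}YX^{-1/2})X^{1/2}$. The generalized relative operator entropy is $\widetilde S_q^f(\mathbf A|\mathbf B)=\int_T S_q^f(A_s|B_s)\,d\mu(s)$. *)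

theory Defs
  imports "HOL-Analysis.Analysis" "HOL-Computational_Algebra.Polynomial"
begin

section \<open>Complex Hilbert spaces\<close>

text \<open>The inner product is linear in the first argument. Completeness comes from \<^class>\<open>banach\<close>;
  positive definiteness of \<open>cinner\<close> is a consequence of \<open>norm_eq_sqrt_cinner\<close>.\<close>

class complex_hilbert_space = banach +
  fixes scaleC :: "complex \<Rightarrow> 'a \<Rightarrow> 'a"  (infixr "*\<^sub>C" 75)
    and cinner :: "'a \<Rightarrow> 'a \<Rightarrow> complex"
  assumes scaleC_add_right: "c *\<^sub>C (x + y) = c *\<^sub>C x + c *\<^sub>C y"
    and scaleC_add_left: "(c + d) *\<^sub>C x = c *\<^sub>C x + d *\<^sub>C x"
    and scaleC_scaleC: "c *\<^sub>C d *\<^sub>C x = (c * d) *\<^sub>C x"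
    and scaleR_scaleC: "scaleR r x = complex_of_real r *\<^sub>C x"
    and cinner_commute: "cinner y x = cnj (cinner x y)"
    and cinner_add_left: "cinner (x + y) z = cinner x z + cinner y z"
    and cinner_scaleC_left: "cinner (c *\<^sub>C x) y = c * cinner x y"
    and norm_eq_sqrt_cinner: "norm x = sqrt (Re (cinner x x))"

instantiation complex :: complex_hilbert_space
begin
definition scaleC_complex :: "complex \<Rightarrow> complex \<Rightarrow> complex" where "scaleC_complex c z = c * z"
definition cinner_complex :: "complex \<Rightarrow> complex \<Rightarrow> complex" where "cinner_complex z w = z * cnj w"
instance
  by intro_classes
    (simp_all add: scaleC_complex_def cinner_complex_def algebra_simps scaleR_conv_of_real
      cmod_def power2_eq_square)
end


section \<open>Bounded operators on a Hilbert space\<close>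

text \<open>Elements of \<open>'h \<Rightarrow>\<^sub>L 'h\<close> are bounded and only real-linear; the operators in the sense
  of the theory are the complex-linear ones.\<close>

definition bounded_operators :: "('h::complex_hilbert_space \<Rightarrow>\<^sub>L 'h) set" where
  "bounded_operators = {X. \<forall>c x. blinfun_apply X (c *\<^sub>C x) = c *\<^sub>C blinfun_apply X x}"

definition scaleC_op ::
    "complex \<Rightarrow> ('h::complex_hilbert_space \<Rightarrow>\<^sub>L 'h) \<Rightarrow> ('h \<Rightarrow>\<^sub>L 'h)" where
  "scaleC_op c X = Blinfun (\<lambda>x. c *\<^sub>C blinfun_apply X x)"

definition adj :: "('h::complex_hilbert_space \<Rightarrow>\<^sub>L 'h) \<Rightarrow> ('h \<Rightarrow>\<^sub>L 'h)" where
  "adj X = (THE Y. \<forall>x y. cinner (blinfun_apply X x) y = cinner x (blinfun_apply Y y))"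

definition self_adjoint :: "('h::complex_hilbert_space \<Rightarrow>\<^sub>L 'h) \<Rightarrow> bool" where
  "self_adjoint X \<longleftrightarrow> X \<in> bounded_operators \<and>
     (\<forall>x y. cinner (blinfun_apply X x) y = cinner x (blinfun_apply X y))"

definition positive_op :: "('h::complex_hilbert_space \<Rightarrow>\<^sub>L 'h) \<Rightarrow> bool" where
  "positive_op X \<longleftrightarrow> self_adjoint X \<and> (\<forall>x. 0 \<le> Re (cinner (blinfun_apply X x) x))"

definition loewner_le ::
    "('h::complex_hilbert_space \<Rightarrow>\<^sub>L 'h) \<Rightarrow> ('h \<Rightarrow>\<^sub>L 'h) \<Rightarrow> bool"  (infix "\<preceq>" 50) where
  "X \<preceq> Y \<longleftrightarrow> self_adjoint X \<and> self_adjoint Y \<and> positive_op (Y - X)"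

definition invertible_op :: "('h::complex_hilbert_space \<Rightarrow>\<^sub>L 'h) \<Rightarrow> bool" where
  "invertible_op X \<longleftrightarrow>
     (\<exists>Y\<in>bounded_operators. X o\<^sub>L Y = id_blinfun \<and> Y o\<^sub>L X = id_blinfun)"

definition strictly_positive :: "('h::complex_hilbert_space \<Rightarrow>\<^sub>L 'h) \<Rightarrow> bool" where
  "strictly_positive X \<longleftrightarrow> positive_op X \<and> invertible_op X"

definition spectrum :: "('h::complex_hilbert_space \<Rightarrow>\<^sub>L 'h) \<Rightarrow> complex set" where
  "spectrum X = {c. \<not> invertible_op (X - scaleC_op c id_blinfun)}"

text \<open>Evaluation at \<open>X\<close> by Horner's scheme, as in the definition of \<^const>\<open>poly\<close>.\<close>

definition poly_op ::
    "real poly \<Rightarrow> ('h::complex_hilbert_space \<Rightarrow>\<^sub>L 'h) \<Rightarrow> ('h \<Rightarrow>\<^sub>L 'h)" where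
  "poly_op p X = fold_coeffs (\<lambda>a Z. a *\<^sub>R id_blinfun + (X o\<^sub>L Z)) p 0"

text \<open>Continuous functional calculus \<open>f(X)\<close> of a self-adjoint \<open>X\<close>, for real functions continuous on
  the spectrum: the norm limit of \<open>p\<^sub>n(X)\<close> for real polynomials \<open>p\<^sub>n \<rightarrow> f\<close> uniformly on the spectrum.
  Such sequences exist by the Weierstrass theorem, and the limit does not depend on the sequence.\<close>

definition cfc ::
    "(real \<Rightarrow> real) \<Rightarrow> ('h::complex_hilbert_space \<Rightarrow>\<^sub>L 'h) \<Rightarrow> ('h \<Rightarrow>\<^sub>L 'h)" where
  "cfc f X = (THE Y. \<forall>p. uniform_limit {x. complex_of_real x \<in> spectrum X}
       (\<lambda>n. poly (p n)) f sequentially \<longrightarrow> (\<lambda>n. poly_op (p n) X) \<longlonglongrightarrow> Y)"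

definition op_powr :: "('h::complex_hilbert_space \<Rightarrow>\<^sub>L 'h) \<Rightarrow> real \<Rightarrow> ('h \<Rightarrow>\<^sub>L 'h)" where
  "op_powr X q = cfc (\<lambda>x. x powr q) X"

definition rel_op ::
    "('h::complex_hilbert_space \<Rightarrow>\<^sub>L 'h) \<Rightarrow> ('h \<Rightarrow>\<^sub>L 'h) \<Rightarrow> ('h \<Rightarrow>\<^sub>L 'h)" where
  "rel_op X Y = op_powr X (-1/2) o\<^sub>L Y o\<^sub>L op_powr X (-1/2)"

text \<open>\<open>natural_mean q X Y\<close> is \<open>X \<natural>\<^sub>q Y\<close>, and \<open>op_entropy f q X Y\<close> is \<open>S\<^sub>q\<^sup>f(X|Y)\<close>.\<close>

definition natural_mean ::
    "real \<Rightarrow> ('h::complex_hilbert_space \<Rightarrow>\<^sub>L 'h) \<Rightarrow> ('h \<Rightarrow>\<^sub>L 'h) \<Rightarrow> ('h \<Rightarrow>\<^sub>L 'h)" where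
  "natural_mean q X Y = op_powr X (1/2) o\<^sub>L op_powr (rel_op X Y) q o\<^sub>L op_powr X (1/2)"

definition op_entropy ::
    "(real \<Rightarrow> real) \<Rightarrow> real \<Rightarrow> ('h::complex_hilbert_space \<Rightarrow>\<^sub>L 'h) \<Rightarrow> ('h \<Rightarrow>\<^sub>L 'h) \<Rightarrow> ('h \<Rightarrow>\<^sub>L 'h)"
  where
  "op_entropy f q X Y =
     op_powr X (1/2) o\<^sub>L op_powr (rel_op X Y) q o\<^sub>L cfc f (rel_op X Y) o\<^sub>L op_powr X (1/2)"


section \<open>Operator concavity\<close>

text \<open>Operator concavity quantifies over all complex Hilbert spaces. HOL cannot quantify over
  types inside a formula, so the spaces of the quantifier are structures on arbitrary subsets
  \<open>V\<close> of a type \<open>'u\<close>. Operators are functions on \<open>'u\<close> of which only the values on \<open>V\<close> matter;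
  \<open>extensional V\<close> makes the functional calculus a well-defined function.\<close>

locale complex_inner_space =
  fixes V :: "'u set"
    and add :: "'u \<Rightarrow> 'u \<Rightarrow> 'u"  (infixl "\<oplus>" 65)
    and zero :: 'u  ("\<zero>")
    and scale :: "complex \<Rightarrow> 'u \<Rightarrow> 'u"  (infixr "\<odot>" 75)
    and ip :: "'u \<Rightarrow> 'u \<Rightarrow> complex"
  assumes zero_closed: "\<zero> \<in> V"
    and add_closed: "\<lbrakk>x \<in> V; y \<in> V\<rbrakk> \<Longrightarrow> x \<oplus> y \<in> V"
    and scale_closed: "x \<in> V \<Longrightarrow> c \<odot> x \<in> V"
    and add_assoc: "\<lbrakk>x \<in> V; y \<in> V; z \<in> V\<rbrakk> \<Longrightarrow> (x \<oplus> y) \<oplus> z = x \<oplus> (y \<oplus> z)"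
    and add_commute: "\<lbrakk>x \<in> V; y \<in> V\<rbrakk> \<Longrightarrow> x \<oplus> y = y \<oplus> x"
    and add_zero: "x \<in> V \<Longrightarrow> x \<oplus> \<zero> = x"
    and add_inverse: "x \<in> V \<Longrightarrow> x \<oplus> (-1) \<odot> x = \<zero>"
    and scale_one: "x \<in> V \<Longrightarrow> 1 \<odot> x = x"
    and scale_scale: "x \<in> V \<Longrightarrow> c \<odot> d \<odot> x = (c * d) \<odot> x"
    and scale_add_right: "\<lbrakk>x \<in> V; y \<in> V\<rbrakk> \<Longrightarrow> c \<odot> (x \<oplus> y) = c \<odot> x \<oplus> c \<odot> y"
    and scale_add_left: "x \<in> V \<Longrightarrow> (c + d) \<odot> x = c \<odot> x \<oplus> d \<odot> x"
    and ip_commute: "\<lbrakk>x \<in> V; y \<in> V\<rbrakk> \<Longrightarrow> ip y x = cnj (ip x y)"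
    and ip_add_left: "\<lbrakk>x \<in> V; y \<in> V; z \<in> V\<rbrakk> \<Longrightarrow> ip (x \<oplus> y) z = ip x z + ip y z"
    and ip_scale_left: "\<lbrakk>x \<in> V; y \<in> V\<rbrakk> \<Longrightarrow> ip (c \<odot> x) y = c * ip x y"
    and ip_positive: "\<lbrakk>x \<in> V; x \<noteq> \<zero>\<rbrakk> \<Longrightarrow> 0 < Re (ip x x)"
begin

abbreviation diff :: "'u \<Rightarrow> 'u \<Rightarrow> 'u"  (infixl "\<ominus>" 65) where
  "x \<ominus> y \<equiv> x \<oplus> (-1) \<odot> y"

definition nrm :: "'u \<Rightarrow> real" where
  "nrm x = sqrt (Re (ip x x))"

definition bounded_op_on :: "('u \<Rightarrow> 'u) \<Rightarrow> bool" where
  "bounded_op_on X \<longleftrightarrow> (\<forall>x\<in>V. X x \<in> V) \<and>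
     (\<forall>x\<in>V. \<forall>y\<in>V. X (x \<oplus> y) = X x \<oplus> X y) \<and>
     (\<forall>c. \<forall>x\<in>V. X (c \<odot> x) = c \<odot> X x) \<and>
     (\<exists>K. \<forall>x\<in>V. nrm (X x) \<le> K * nrm x)"

definition self_adjoint_on :: "('u \<Rightarrow> 'u) \<Rightarrow> bool" where
  "self_adjoint_on X \<longleftrightarrow> bounded_op_on X \<and> (\<forall>x\<in>V. \<forall>y\<in>V. ip (X x) y = ip x (X y))"

definition loewner_le_on :: "('u \<Rightarrow> 'u) \<Rightarrow> ('u \<Rightarrow> 'u) \<Rightarrow> bool" where
  "loewner_le_on X Y \<longleftrightarrow> self_adjoint_on X \<and> self_adjoint_on Y \<and>
     (\<forall>x\<in>V. Re (ip (X x) x) \<le> Re (ip (Y x) x))"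

definition spectrum_on :: "('u \<Rightarrow> 'u) \<Rightarrow> complex set" where
  "spectrum_on X = {c. \<not> (\<exists>Y. bounded_op_on Y \<and>
     (\<forall>x\<in>V. Y (X x \<ominus> c \<odot> x) = x \<and> X (Y x) \<ominus> c \<odot> Y x = x))}"

definition poly_on :: "real poly \<Rightarrow> ('u \<Rightarrow> 'u) \<Rightarrow> 'u \<Rightarrow> 'u" where
  "poly_on p X x = fold_coeffs (\<lambda>a z. complex_of_real a \<odot> x \<oplus> X z) p \<zero>"

definition cfc_on :: "(real \<Rightarrow> real) \<Rightarrow> ('u \<Rightarrow> 'u) \<Rightarrow> 'u \<Rightarrow> 'u" where
  "cfc_on f X = (THE Y. Y \<in> extensional V \<and> bounded_op_on Y \<and>
     (\<forall>p. uniform_limit {x. complex_of_real x \<in> spectrum_on X} (\<lambda>n. poly (p n)) f sequentially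
       \<longrightarrow> (\<forall>e>0. \<forall>\<^sub>F n in sequentially. \<forall>x\<in>V. nrm (poly_on (p n) X x \<ominus> Y x) \<le> e * nrm x)))"

definition convex_comb :: "real \<Rightarrow> ('u \<Rightarrow> 'u) \<Rightarrow> ('u \<Rightarrow> 'u) \<Rightarrow> 'u \<Rightarrow> 'u" where
  "convex_comb l X Y x = complex_of_real l \<odot> X x \<oplus> complex_of_real (1 - l) \<odot> Y x"

definition concave_for_operators :: "real set \<Rightarrow> (real \<Rightarrow> real) \<Rightarrow> bool" where
  "concave_for_operators J f \<longleftrightarrow>
     (\<forall>X Y l. self_adjoint_on X \<and> self_adjoint_on Y \<and>
        spectrum_on X \<subseteq> complex_of_real ` J \<and> spectrum_on Y \<subseteq> complex_of_real ` J \<and>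
        0 \<le> l \<and> l \<le> 1 \<longrightarrow>
        loewner_le_on (convex_comb l (cfc_on f X) (cfc_on f Y)) (cfc_on f (convex_comb l X Y)))"

end

locale complex_hilbert = complex_inner_space +
  assumes complete: "Metric_space.mcomplete V (\<lambda>x y. nrm (x \<ominus> y))"

lemma complex_hilbert_UNIV:
  "complex_hilbert (UNIV :: 'h::complex_hilbert_space set) (+) 0 scaleC cinner"
proof -
  have one: "1 *\<^sub>C x = x" for x :: 'h
    using scaleR_scaleC[of 1 x] by simp
  have m1: "x + (-1) *\<^sub>C y = x - y" for x y :: 'h
    using scaleR_scaleC[of "-1" y] by simp
  have pos: "0 < Re (cinner x x)" if "x \<noteq> 0" for x :: 'h
    using norm_eq_sqrt_cinner[of x] that by (metis real_sqrt_gt_0_iff zero_less_norm_iff)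
  interpret complex_inner_space "UNIV :: 'h set" "(+)" 0 scaleC cinner
    by unfold_locales
      (auto simp: one m1 pos scaleC_scaleC scaleC_add_right scaleC_add_left cinner_add_left
        cinner_scaleC_left add_ac intro: cinner_commute)
  have d: "(\<lambda>x y :: 'h. nrm (x + (-1) *\<^sub>C y)) = dist"
    by (simp add: fun_eq_iff m1 nrm_def dist_norm norm_eq_sqrt_cinner)
  show ?thesis
    by unfold_locales (use complete_UNIV in \<open>simp add: d mcomplete_iff_complete\<close>)
qed

text \<open>The type argument is the universe from which the Hilbert spaces are taken.\<close>

definition operator_concave_on :: "'u itself \<Rightarrow> real set \<Rightarrow> (real \<Rightarrow> real) \<Rightarrow> bool" where
  "operator_concave_on (_ :: 'u itself) J f \<longleftrightarrow> continuous_on J f \<and>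
     (\<forall>(V :: 'u set) add zero scale ip. complex_hilbert V add zero scale ip \<longrightarrow>
        complex_inner_space.concave_for_operators V add zero scale ip J f)"


section \<open>Fields of operators and their integrals\<close>

text \<open>Radon measures in the sense of Folland: Borel, finite on compact sets, outer regular on
  Borel sets and inner regular on open sets.\<close>

definition radon_measure :: "'t::t2_space measure \<Rightarrow> bool" where
  "radon_measure \<mu> \<longleftrightarrow> sets \<mu> = sets borel \<and>
     (\<forall>K. compact K \<longrightarrow> emeasure \<mu> K < \<infinity>) \<and>
     (\<forall>E\<in>sets borel. emeasure \<mu> E = (INF U\<in>{U. open U \<and> E \<subseteq> U}. emeasure \<mu> U)) \<and>
     (\<forall>U. open U \<longrightarrow> emeasure \<mu> U = (SUP K\<in>{K. compact K \<and> K \<subseteq> U}. emeasure \<mu> K))"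

definition cstar_algebra :: "('h::complex_hilbert_space \<Rightarrow>\<^sub>L 'h) set \<Rightarrow> bool" where
  "cstar_algebra \<A> \<longleftrightarrow> \<A> \<subseteq> bounded_operators \<and> 0 \<in> \<A> \<and> closed \<A> \<and>
     (\<forall>X\<in>\<A>. \<forall>Y\<in>\<A>. X + Y \<in> \<A> \<and> X o\<^sub>L Y \<in> \<A>) \<and>
     (\<forall>X\<in>\<A>. adj X \<in> \<A> \<and> (\<forall>c. scaleC_op c X \<in> \<A>))"

text \<open>Bounded complex-linear functionals on \<open>\<A>\<close>; their values off \<open>\<A>\<close> are irrelevant.\<close>

definition dual :: "('h::complex_hilbert_space \<Rightarrow>\<^sub>L 'h) set \<Rightarrow> (('h \<Rightarrow>\<^sub>L 'h) \<Rightarrow> complex) set" where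
  "dual \<A> = {\<phi>. (\<forall>X\<in>\<A>. \<forall>Y\<in>\<A>. \<phi> (X + Y) = \<phi> X + \<phi> Y) \<and>
     (\<forall>c. \<forall>X\<in>\<A>. \<phi> (scaleC_op c X) = c * \<phi> X) \<and>
     (\<exists>K. \<forall>X\<in>\<A>. norm (\<phi> X) \<le> K * norm X)}"

definition continuous_field ::
    "('h::complex_hilbert_space \<Rightarrow>\<^sub>L 'h) set \<Rightarrow> 't::t2_space measure \<Rightarrow> ('t \<Rightarrow> ('h \<Rightarrow>\<^sub>L 'h)) \<Rightarrow> bool"
  where
  "continuous_field \<A> \<mu> A \<longleftrightarrow> (\<forall>t. A t \<in> \<A>) \<and> continuous_on UNIV A \<and>
     integrable \<mu> (\<lambda>t. norm (A t))"

text \<open>The library's Bochner integral is restricted to second countable spaces, which excludes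
  the operators on an infinite-dimensional space; so the integral is characterised by duality.\<close>

definition op_integral ::
    "('h::complex_hilbert_space \<Rightarrow>\<^sub>L 'h) set \<Rightarrow> 't::t2_space measure \<Rightarrow> ('t \<Rightarrow> ('h \<Rightarrow>\<^sub>L 'h)) \<Rightarrow> ('h \<Rightarrow>\<^sub>L 'h)"
  where
  "op_integral \<A> \<mu> F =
     (THE X. X \<in> \<A> \<and> (\<forall>\<phi>\<in>dual \<A>. has_bochner_integral \<mu> (\<lambda>t. \<phi> (F t)) (\<phi> X)))"

definition relative_op_entropy ::
    "('h::complex_hilbert_space \<Rightarrow>\<^sub>L 'h) set \<Rightarrow> 't::t2_space measure \<Rightarrow> (real \<Rightarrow> real) \<Rightarrow> real \<Rightarrow>
     ('t \<Rightarrow> ('h \<Rightarrow>\<^sub>L 'h)) \<Rightarrow> ('t \<Rightarrow> ('h \<Rightarrow>\<^sub>L 'h)) \<Rightarrow> ('h \<Rightarrow>\<^sub>L 'h)"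
  where
  "relative_op_entropy \<A> \<mu> f q A B = op_integral \<A> \<mu> (\<lambda>s. op_entropy f q (A s) (B s))"

end

theory Submission
  imports Defs "HOL-Computational_Algebra.Fundamental_Theorem_Algebra"
begin

text \<open>Write \<open>X\<^sub>s = A\<^sub>s\<^bsup>-1/2\<^esup> B\<^sub>s A\<^sub>s\<^bsup>-1/2\<^esup>\<close>, so that \<open>m I \<le> X\<^sub>s \<le> M I\<close>, and
  \<open>C\<^sub>s = X\<^sub>s\<^bsup>p/2\<^esup> A\<^sub>s\<^bsup>1/2\<^esup>\<close>. Then
  \<open>A\<^sub>s \<natural>\<^sub>p B\<^sub>s = C\<^sub>s\<^sup>* C\<^sub>s\<close>, \<open>A\<^sub>s \<natural>\<^bsub>p+1\<^esub> B\<^sub>s = C\<^sub>s\<^sup>* X\<^sub>s C\<^sub>s\<close> and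
  \<open>S\<^sub>p\<^sup>f(A\<^sub>s|B\<^sub>s) = C\<^sub>s\<^sup>* f(X\<^sub>s) C\<^sub>s\<close>. With \<open>Q = I - \<integral> C\<^sub>s\<^sup>* C\<^sub>s\<close> the claim becomes
  \<open>\<integral> C\<^sub>s\<^sup>* f(X\<^sub>s) C\<^sub>s + f(t\<^sub>0) Q \<le> f(\<integral> C\<^sub>s\<^sup>* X\<^sub>s C\<^sub>s + t\<^sub>0 Q)\<close>.
  This is Jensen's operator inequality for weights \<open>C\<^sub>s\<^sup>* C\<^sub>s\<close> that are completed to the identity by
  the weight \<open>Q\<close> at the scalar point \<open>t\<^sub>0\<close>. The weight \<open>Q\<close> is positive because
  \<open>x\<^sup>p \<le> 1 - p + p x\<close> gives \<open>A\<^sub>s \<natural>\<^sub>p B\<^sub>s \<le> (1 - p) A\<^sub>s + p B\<^sub>s\<close>, whose right-hand side integrates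
  to the identity (\<open>natural_mean_le\<close>).

  Jensen's inequality for two summands (\<open>jensen_two\<close>) is proved on the direct sum of two copies of
  the space: the operator there is averaged with its conjugate by the reflection in the range of an
  isometry. The concavity hypothesis speaks of subspaces of a universe of vectors and is first
  carried over to the direct sum (\<open>operator_concave_on_type\<close>). Finitely many summands follow by
  induction (\<open>jensen_finite\<close>), where invertible weights have invertible square roots. For the integral,
  all three fields are approximated in norm by finite sums with the same points and weights
  (\<open>op_integral_approximation_triple\<close>). The approximating sums of the weights need not stay below the
  identity, so they are completed to a multiple \<open>c I\<close> with \<open>c\<close> slightly larger than \<open>1\<close>,
  which also makes the completing weight invertible (\<open>jensen_completed\<close>). As \<open>c \<rightarrow> 1\<close>, the norm
  continuity of \<open>f\<close> on operators between two fixed scalars (\<open>tendsto_cfc\<close>) gives the claim.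

  The functional calculus is defined through polynomials converging uniformly on the spectrum. It is
  controlled by \<open>\<parallel>q(X)\<parallel> \<le> sup \<bar>q\<bar>\<close> over the spectrum of \<open>X\<close> (\<open>norm_poly_op_le\<close>); all its
  other properties pass from polynomials to the limit.\<close>

section \<open>The inner product\<close>

lemma scaleC_of_real: "complex_of_real r *\<^sub>C x = r *\<^sub>R x"
  by (simp add: scaleR_scaleC)

lemma scaleC_one [simp]: "1 *\<^sub>C x = x"
  using scaleC_of_real[of 1 x] by simp

lemma scaleC_zero_left [simp]: "0 *\<^sub>C x = 0"
  using scaleC_of_real[of 0 x] by simp

lemma scaleC_minus_left: "(- c) *\<^sub>C x = - (c *\<^sub>C x)"
  using scaleC_add_left[of c "-c" x] by (simp add: eq_neg_iff_add_eq_0 add.commute)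

lemma scaleC_zero_right [simp]: "c *\<^sub>C 0 = (0::'h::complex_hilbert_space)"
  using scaleC_add_right[of c 0 "0::'h"] by simp

lemma scaleC_diff_right: "c *\<^sub>C (x - y) = c *\<^sub>C x - c *\<^sub>C y"
  using scaleC_add_right[of c "x - y" y] by (simp add: algebra_simps)

lemma scaleC_scaleR: "c *\<^sub>C (r *\<^sub>R x) = r *\<^sub>R (c *\<^sub>C x)"
  by (simp add: scaleR_scaleC scaleC_scaleC mult.commute)

lemma cinner_scaleC_right: "cinner x (c *\<^sub>C y) = cnj c * cinner x y"
  by (metis cinner_commute cinner_scaleC_left complex_cnj_mult)

lemma cinner_add_right: "cinner x (y + z) = cinner x y + cinner x z"
  by (metis cinner_add_left cinner_commute complex_cnj_add)

lemma cinner_scaleR_left: "cinner (r *\<^sub>R x) y = r *\<^sub>R cinner x y"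
  by (simp only: scaleR_scaleC[of r x] cinner_scaleC_left scaleR_conv_of_real)

lemma cinner_scaleR_right: "cinner x (r *\<^sub>R y) = r *\<^sub>R cinner x y"
  by (simp only: scaleR_scaleC[of r y] cinner_scaleC_right scaleR_conv_of_real complex_cnj_complex_of_real)

lemma cinner_zero_left [simp]: "cinner 0 y = 0"
  using cinner_scaleR_left[of 0 0 y] by simp

lemma cinner_zero_right [simp]: "cinner y 0 = 0"
  using cinner_scaleR_right[of y 0 0] by simp

lemma cinner_minus_left: "cinner (- x) y = - cinner x y"
  using cinner_scaleR_left[of "-1" x y] by simp

lemma cinner_minus_right: "cinner x (- y) = - cinner x y"
  using cinner_scaleR_right[of x "-1" y] by simp

lemma cinner_diff_left: "cinner (x - y) z = cinner x z - cinner y z"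
  using cinner_add_left[of x "-y" z] by (simp add: cinner_minus_left)

lemma cinner_diff_right: "cinner z (x - y) = cinner z x - cinner z y"
  using cinner_add_right[of z x "-y"] by (simp add: cinner_minus_right)

lemma Re_cinner_self_nonneg: "0 \<le> Re (cinner x x)"
  using norm_eq_sqrt_cinner[of x] by (metis norm_ge_zero real_sqrt_ge_0_iff)

lemma Re_cinner_self: "Re (cinner x x) = (norm x)\<^sup>2"
  by (simp add: norm_eq_sqrt_cinner Re_cinner_self_nonneg)

lemma cinner_self: "cinner x x = complex_of_real ((norm x)\<^sup>2)"
proof -
  have "Im (cinner x x) = 0"
    using cinner_commute[of x x] by (metis Reals_cnj_iff complex_is_Real_iff)
  then show ?thesis
    by (simp add: complex_eq_iff Re_cinner_self)
qed

lemma norm_scaleC: "norm (c *\<^sub>C x) = cmod c * norm x"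
proof -
  have "(norm (c *\<^sub>C x))\<^sup>2 = Re (c * cnj c * cinner x x)"
    by (simp only: Re_cinner_self[symmetric] cinner_scaleC_left cinner_scaleC_right mult.assoc
        mult.left_commute)
  also have "\<dots> = (cmod c * norm x)\<^sup>2"
    by (simp only: complex_norm_square[symmetric] cinner_self of_real_mult[symmetric] Re_complex_of_real
        power_mult_distrib)
  finally show ?thesis
    by simp
qed

lemma norm_diff_squared:
  "(norm (x - y))\<^sup>2 = (norm x)\<^sup>2 - 2 * Re (cinner x y) + (norm y)\<^sup>2"
proof -
  have "Re (cinner y x) = Re (cinner x y)"
    by (subst cinner_commute) simp
  then show ?thesis
    by (simp add: Re_cinner_self[symmetric] cinner_diff_left cinner_diff_right)
qed

lemma exists_unit_rotation: "\<exists>u. cmod u = 1 \<and> u * z = complex_of_real (cmod z)"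
proof (cases "z = 0")
  case False
  then have "cnj z / of_real (cmod z) * z = of_real (cmod z)"
    using complex_norm_square[of z] by (simp add: field_simps power2_eq_square)
  moreover have "cmod (cnj z / of_real (cmod z)) = 1"
    using False by (simp add: norm_divide)
  ultimately show ?thesis by blast
qed (auto intro: exI[of _ 1])

lemma cinner_Cauchy_Schwarz: "cmod (cinner x y) \<le> norm x * norm y"
proof (cases "y = 0")
  case False
  obtain u where u: "cmod u = 1" "u * cinner x y = of_real (cmod (cinner x y))"
    using exists_unit_rotation by blast
  define t where "t = cmod (cinner x y) / (norm y)\<^sup>2"
  have "0 \<le> (norm (u *\<^sub>C x - t *\<^sub>R y))\<^sup>2" by simp
  also have "\<dots> = (norm x)\<^sup>2 - 2 * t * cmod (cinner x y) + t\<^sup>2 * (norm y)\<^sup>2"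
    by (simp add: norm_diff_squared norm_scaleC u cinner_scaleC_left cinner_scaleR_right
        power_mult_distrib)
  also have "\<dots> = (norm x)\<^sup>2 - (cmod (cinner x y))\<^sup>2 / (norm y)\<^sup>2"
    using False by (simp add: t_def field_simps power2_eq_square)
  finally have "(cmod (cinner x y))\<^sup>2 \<le> (norm x * norm y)\<^sup>2"
    using False by (simp add: field_simps power_mult_distrib)
  then show ?thesis
    by (simp add: power2_le_iff_abs_le)
qed simp

lemma bounded_bilinear_cinner: "bounded_bilinear cinner"
  by unfold_locales
    (auto simp: cinner_add_left cinner_add_right cinner_scaleR_left cinner_scaleR_right
      intro!: exI[of _ 1] cinner_Cauchy_Schwarz)

lemmas tendsto_cinner [tendsto_intros] = bounded_bilinear.tendsto[OF bounded_bilinear_cinner]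

lemma cinner_sum_left: "cinner (sum g I) y = (\<Sum>i\<in>I. cinner (g i) y)"
  by (induction I rule: infinite_finite_induct) (auto simp: cinner_add_left)

lemma cinner_ext:
  assumes "\<And>y. cinner x y = cinner z y"
  shows "x = z"
proof -
  have "cinner (x - z) (x - z) = 0"
    using assms[of "x - z"] by (simp add: cinner_diff_left)
  then show ?thesis
    by (simp add: cinner_self)
qed


section \<open>Adjoint pairs and self-adjoint operators\<close>

text \<open>An operator given together with its adjoint. The two spaces may differ, as for the isometry into a
  direct sum in the proof of Jensen's inequality.\<close>

definition adjoint_pair ::
    "('a::complex_hilbert_space \<Rightarrow>\<^sub>L 'b::complex_hilbert_space) \<Rightarrow> ('b \<Rightarrow>\<^sub>L 'a) \<Rightarrow> bool" where
  "adjoint_pair C D \<longleftrightarrow> (\<forall>x y. cinner (C x) y = cinner x (D y))"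

lemma adjoint_pairD: "adjoint_pair C D \<Longrightarrow> cinner (C x) y = cinner x (D y)"
  by (simp add: adjoint_pair_def)

lemma adjoint_pair_sym: "adjoint_pair C D \<Longrightarrow> adjoint_pair D C"
  unfolding adjoint_pair_def by (metis cinner_commute)

lemma adjoint_pair_clinear:
  assumes "adjoint_pair C D"
  shows "C (c *\<^sub>C x) = c *\<^sub>C C x"
  by (rule cinner_ext) (simp add: adjoint_pairD[OF assms] cinner_scaleC_left)

lemma self_adjoint_iff: "self_adjoint X \<longleftrightarrow> adjoint_pair X X"
  using adjoint_pair_clinear
  by (auto simp: self_adjoint_def adjoint_pair_def bounded_operators_def)

lemma adjoint_pair_compose:
  "adjoint_pair C C' \<Longrightarrow> adjoint_pair D D' \<Longrightarrow> adjoint_pair (C o\<^sub>L D) (D' o\<^sub>L C')"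
  by (simp add: adjoint_pair_def)

lemma adjoint_pair_add:
  "adjoint_pair C C' \<Longrightarrow> adjoint_pair D D' \<Longrightarrow> adjoint_pair (C + D) (C' + D')"
  by (simp add: adjoint_pair_def plus_blinfun.rep_eq cinner_add_left cinner_add_right)

lemma adjoint_pair_diff:
  "adjoint_pair C C' \<Longrightarrow> adjoint_pair D D' \<Longrightarrow> adjoint_pair (C - D) (C' - D')"
  by (simp add: adjoint_pair_def minus_blinfun.rep_eq cinner_diff_left cinner_diff_right)

lemma adjoint_pair_scaleR: "adjoint_pair C C' \<Longrightarrow> adjoint_pair (r *\<^sub>R C) (r *\<^sub>R C')"
  by (simp add: adjoint_pair_def scaleR_blinfun.rep_eq cinner_scaleR_left cinner_scaleR_right)

lemma adjoint_pair_id: "adjoint_pair id_blinfun id_blinfun"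
  by (simp add: adjoint_pair_def)

lemma adjoint_pair_zero: "adjoint_pair 0 0"
  by (simp add: adjoint_pair_def)

lemma adjoint_pair_sum:
  "(\<And>i. i \<in> I \<Longrightarrow> adjoint_pair (C i) (C' i)) \<Longrightarrow> adjoint_pair (sum C I) (sum C' I)"
  by (induction I rule: infinite_finite_induct) (auto intro: adjoint_pair_add adjoint_pair_zero)

lemma self_adjoint_adjoint_pair: "self_adjoint X \<Longrightarrow> adjoint_pair X X"
  by (simp add: self_adjoint_iff)

lemma self_adjoint_add: "self_adjoint X \<Longrightarrow> self_adjoint Y \<Longrightarrow> self_adjoint (X + Y)"
  by (simp add: self_adjoint_iff adjoint_pair_add)

lemma self_adjoint_diff: "self_adjoint X \<Longrightarrow> self_adjoint Y \<Longrightarrow> self_adjoint (X - Y)"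
  by (simp add: self_adjoint_iff adjoint_pair_diff)

lemma self_adjoint_scaleR: "self_adjoint X \<Longrightarrow> self_adjoint (r *\<^sub>R X)"
  by (simp add: self_adjoint_iff adjoint_pair_scaleR)

lemma self_adjoint_id: "self_adjoint id_blinfun"
  by (simp add: self_adjoint_iff adjoint_pair_id)

lemma self_adjoint_sandwich:
  "adjoint_pair C C' \<Longrightarrow> self_adjoint X \<Longrightarrow> self_adjoint (C' o\<^sub>L X o\<^sub>L C)"
  by (simp add: self_adjoint_iff adjoint_pair_def) (metis cinner_commute)

lemma bounded_operators_if_adjoint_pair: "adjoint_pair C C' \<Longrightarrow> C \<in> bounded_operators"
  by (simp add: bounded_operators_def adjoint_pair_clinear)

lemma self_adjoint_bounded: "self_adjoint X \<Longrightarrow> X \<in> bounded_operators"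
  by (simp add: self_adjoint_def)

lemma cinner_self_adjoint_real:
  assumes "self_adjoint X"
  shows "Im (cinner (X x) x) = 0"
proof -
  have "cinner (X x) x = cnj (cinner (X x) x)"
    using assms unfolding self_adjoint_def by (metis cinner_commute)
  then show ?thesis
    by (metis Reals_cnj_iff complex_is_Real_iff)
qed

lemma closed_self_adjoint: "closed {X :: 'h::complex_hilbert_space \<Rightarrow>\<^sub>L 'h. self_adjoint X}"
proof -
  have "{X :: 'h \<Rightarrow>\<^sub>L 'h. self_adjoint X} = (\<Inter>x y. {X. cinner (blinfun_apply X x) y = cinner x (blinfun_apply X y)})"
    by (auto simp: self_adjoint_iff adjoint_pair_def)
  moreover have "closed {X :: 'h \<Rightarrow>\<^sub>L 'h. cinner (X x) y = cinner x (X y)}" for x y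
    by (intro closed_Collect_eq bounded_bilinear.continuous_on[OF bounded_bilinear_cinner] continuous_intros)
  ultimately show ?thesis
    by (simp add: closed_INT)
qed

lemma self_adjoint_tendsto:
  assumes "(X \<longlongrightarrow> Y) F" "F \<noteq> bot" "\<forall>\<^sub>F n in F. self_adjoint (X n)"
  shows "self_adjoint Y"
  using Lim_in_closed_set[OF closed_self_adjoint _ assms(2,1)] assms(3) by simp

section \<open>Invertibility\<close>

lemma blinfun_eq_iff: "X = Y \<longleftrightarrow> (\<forall>x. blinfun_apply X x = blinfun_apply Y x)"
  by (metis blinfun_eqI)

lemma blinfun_compose_simps:
  "(X + Y) o\<^sub>L Z = (X o\<^sub>L Z) + (Y o\<^sub>L Z)" "Z' o\<^sub>L (X + Y) = (Z' o\<^sub>L X) + (Z' o\<^sub>L Y)"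
  "(X - Y) o\<^sub>L Z = (X o\<^sub>L Z) - (Y o\<^sub>L Z)" "Z' o\<^sub>L (X - Y) = (Z' o\<^sub>L X) - (Z' o\<^sub>L Y)"
  "(r *\<^sub>R X) o\<^sub>L Z = r *\<^sub>R (X o\<^sub>L Z)" "Z' o\<^sub>L (r *\<^sub>R X) = r *\<^sub>R (Z' o\<^sub>L X)"
  "0 o\<^sub>L Z = 0" "Z' o\<^sub>L 0 = 0"
  by (auto intro!: blinfun_eqI simp: plus_blinfun.rep_eq minus_blinfun.rep_eq scaleR_blinfun.rep_eq
      blinfun.add_right blinfun.diff_right blinfun.scaleR_right)

lemma blinfun_compose_id [simp]: "id_blinfun o\<^sub>L X = X" "X o\<^sub>L id_blinfun = X"
  by (auto intro!: blinfun_eqI)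

lemma blinfun_compose_assoc: "(X o\<^sub>L Y) o\<^sub>L Z = X o\<^sub>L (Y o\<^sub>L Z)"
  by (rule blinfun_eqI) simp

lemma sum_blinfun_apply: "blinfun_apply (\<Sum>i\<in>I. X i) x = (\<Sum>i\<in>I. blinfun_apply (X i) x)"
  by (induction I rule: infinite_finite_induct) (auto simp: plus_blinfun.rep_eq)

lemma bounded_operators_compose:
  "X \<in> bounded_operators \<Longrightarrow> Y \<in> bounded_operators \<Longrightarrow> X o\<^sub>L Y \<in> bounded_operators"
  by (simp add: bounded_operators_def)

lemma bounded_operators_diff:
  "X \<in> bounded_operators \<Longrightarrow> Y \<in> bounded_operators \<Longrightarrow> X - Y \<in> bounded_operators"
  by (simp add: bounded_operators_def minus_blinfun.rep_eq scaleC_diff_right)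

lemma bounded_operators_scaleR: "X \<in> bounded_operators \<Longrightarrow> r *\<^sub>R X \<in> bounded_operators"
  by (simp add: bounded_operators_def scaleR_blinfun.rep_eq scaleC_scaleR)

lemma bounded_operators_id: "id_blinfun \<in> bounded_operators"
  by (simp add: bounded_operators_def)

lemma bounded_linear_scaleC: "bounded_linear (scaleC c)"
  by (rule bounded_linear_intro[of _ "cmod c"])
    (auto simp: scaleC_add_right scaleC_scaleR norm_scaleC mult.commute)

lemma scaleC_op_apply [simp]: "scaleC_op c X x = c *\<^sub>C X x"
  unfolding scaleC_op_def
  by (subst bounded_linear_Blinfun_apply)
    (auto intro!: bounded_linear_compose[OF bounded_linear_scaleC] blinfun.bounded_linear_right)

lemma scaleC_op_of_real: "scaleC_op (complex_of_real r) X = r *\<^sub>R X"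
  by (rule blinfun_eqI) (simp add: scaleC_of_real scaleR_blinfun.rep_eq)

lemma scaleC_op_bounded: "X \<in> bounded_operators \<Longrightarrow> scaleC_op c X \<in> bounded_operators"
  by (simp add: bounded_operators_def scaleC_scaleC mult.commute)

lemma invertible_op_compose:
  assumes "invertible_op X" "invertible_op Y"
  shows "invertible_op (X o\<^sub>L Y)"
proof -
  obtain X' Y' where X': "X' \<in> bounded_operators" "X o\<^sub>L X' = id_blinfun" "X' o\<^sub>L X = id_blinfun"
    and Y': "Y' \<in> bounded_operators" "Y o\<^sub>L Y' = id_blinfun" "Y' o\<^sub>L Y = id_blinfun"
    using assms by (auto simp: invertible_op_def)
  have "(X o\<^sub>L Y) o\<^sub>L (Y' o\<^sub>L X') = X o\<^sub>L (Y o\<^sub>L Y') o\<^sub>L X'"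
    "(Y' o\<^sub>L X') o\<^sub>L (X o\<^sub>L Y) = Y' o\<^sub>L (X' o\<^sub>L X) o\<^sub>L Y"
    by (auto intro!: blinfun_eqI)
  then show ?thesis
    using X' Y' bounded_operators_compose unfolding invertible_op_def
    by (intro bexI[of _ "Y' o\<^sub>L X'"]) auto
qed

lemma invertible_op_bounded_below:
  assumes "invertible_op X"
  obtains k where "0 < k" "\<And>x. k * norm x \<le> norm (X x)"
proof -
  obtain Z where Z: "Z o\<^sub>L X = id_blinfun"
    using assms by (auto simp: invertible_op_def)
  show thesis
  proof
    show "0 < inverse (norm Z + 1)"
      by (simp add: add_nonneg_pos)
    fix x
    have "norm x = norm (Z (X x))"
      using Z by (metis blinfun_apply_blinfun_compose blinfun_apply_id_blinfun id_apply)
    also have "\<dots> \<le> (norm Z + 1) * norm (X x)"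
      by (rule order_trans[OF norm_blinfun]) (simp add: algebra_simps)
    finally show "inverse (norm Z + 1) * norm x \<le> norm (X x)"
      using add_nonneg_pos[of "norm Z" 1]
      by (simp add: pos_divide_le_eq mult.commute inverse_eq_divide)
  qed
qed

lemma invertible_op_if_bounded_below_surj:
  assumes X: "X \<in> bounded_operators" and k: "0 < k" "\<And>x. k * norm x \<le> norm (X x)"
    and surj: "\<And>y. \<exists>x. X x = y"
  shows "invertible_op X"
proof -
  obtain g where g: "\<And>y. X (g y) = y"
    using surj by metis
  have inj: "x = y" if "X x = X y" for x y
    using k(2)[of "x - y"] that k(1) by (simp add: blinfun.diff_right mult_le_0_iff)
  have gX: "g (X x) = x" for x
    by (simp add: g inj)
  have bl: "bounded_linear g"
  proof (rule bounded_linear_intro)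
    show "g (x + y) = g x + g y" for x y
      by (rule inj) (simp add: g blinfun.add_right)
    show "g (r *\<^sub>R x) = r *\<^sub>R g x" for r x
      by (rule inj) (simp add: g blinfun.scaleR_right)
    show "norm (g x) \<le> norm x * (1 / k)" for x
      using k(2)[of "g x"] k(1) by (simp add: g field_simps)
  qed
  have "g (c *\<^sub>C x) = c *\<^sub>C g x" for c x
    by (rule inj) (use X in \<open>simp add: g bounded_operators_def\<close>)
  then show ?thesis
    unfolding invertible_op_def using bl
    by (intro bexI[of _ "Blinfun g"])
      (auto intro!: blinfun_eqI simp: bounded_linear_Blinfun_apply g gX bounded_operators_def)
qed

text \<open>This is the Lax--Milgram theorem: solving \<open>X x = y\<close> means finding a fixed point of
  \<open>x \<mapsto> x - t w (X x - y)\<close>, which is a contraction for small \<open>t > 0\<close>. The unit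
  scalar \<open>w\<close> lets one statement cover positive operators and \<open>X - c\<close> with \<open>c\<close> not real.\<close>

lemma invertible_op_if_coercive:
  fixes X :: "'h::complex_hilbert_space \<Rightarrow>\<^sub>L 'h"
  assumes X: "X \<in> bounded_operators" and w: "cmod w = 1" and a: "0 < a"
    and coercive: "\<And>x. a * (norm x)\<^sup>2 \<le> Re (w * cinner (X x) x)"
  shows "invertible_op X"
proof (rule invertible_op_if_bounded_below_surj[OF X a])
  have *: "a * (norm x)\<^sup>2 \<le> norm (X x) * norm x" for x
    using coercive[of x] cinner_Cauchy_Schwarz[of "X x" x]
      complex_Re_le_cmod[of "w * cinner (X x) x"]
    by (simp add: norm_mult w)
  show below: "a * norm x \<le> norm (X x)" for x
    using *[of x] by (cases "x = 0") (auto simp: power2_eq_square)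
  fix y
  define b where "b = norm X + a"
  have b: "a \<le> b" "0 < b" "norm X \<le> b"
    using a by (auto simp: b_def add_nonneg_pos)
  define t where "t = a / b\<^sup>2"
  define g where "g x = x - t *\<^sub>R (w *\<^sub>C (X x - y))" for x
  define q where "q = sqrt (1 - (a / b)\<^sup>2)"
  have "(a / b)\<^sup>2 \<le> 1" "0 < (a / b)\<^sup>2"
    using a b by (auto simp: power_le_one)
  then have q: "0 \<le> q" "q < 1" "q\<^sup>2 = 1 - (a / b)\<^sup>2"
    by (auto simp: q_def)
  have contr: "dist (g x) (g x') \<le> q * dist x x'" for x x'
  proof -
    define d where "d = x - x'"
    have "g x - g x' = d - t *\<^sub>R (w *\<^sub>C X d)"
      by (simp add: g_def d_def blinfun.diff_right scaleC_diff_right algebra_simps)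
    then have "(dist (g x) (g x'))\<^sup>2 = (norm (d - t *\<^sub>R (w *\<^sub>C X d)))\<^sup>2"
      by (simp add: dist_norm)
    also have "\<dots> = (norm d)\<^sup>2 - 2 * t * Re (cinner d (w *\<^sub>C X d)) + t\<^sup>2 * (norm (X d))\<^sup>2"
      by (simp add: norm_diff_squared cinner_scaleR_right norm_scaleC w power_mult_distrib)
    also have "Re (cinner d (w *\<^sub>C X d)) = Re (w * cinner (X d) d)"
      by (subst cinner_commute) (simp add: cinner_scaleC_left)
    also have "(norm d)\<^sup>2 - 2 * t * Re (w * cinner (X d) d) + t\<^sup>2 * (norm (X d))\<^sup>2
      \<le> (norm d)\<^sup>2 - 2 * t * (a * (norm d)\<^sup>2) + t\<^sup>2 * (b * norm d)\<^sup>2"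
    proof (intro add_mono diff_mono mult_left_mono power_mono)
      show "norm (X d) \<le> b * norm d"
        using b norm_blinfun[of X d] mult_right_mono[of "norm X" b "norm d"] by simp
      show "a * (norm d)\<^sup>2 \<le> Re (w * cinner (X d) d)" by (rule coercive)
    qed (use a b in \<open>auto simp: t_def\<close>)
    also have "\<dots> = (q * dist x x')\<^sup>2"
    proof -
      have "2 * t * a = 2 * (a / b)\<^sup>2" "t\<^sup>2 * b\<^sup>2 = (a / b)\<^sup>2"
        using b by (simp_all add: t_def field_simps power2_eq_square)
      then show ?thesis
        by (simp add: power_mult_distrib q dist_norm d_def[symmetric] mult.assoc[symmetric])
          (simp add: algebra_simps)
    qed
    finally show ?thesis
      using q by (simp add: power2_le_iff_abs_le)
  qed
  have "\<exists>!x. g x = x"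
    by (rule banach_fix_type[of q]) (use q contr in auto)
  then obtain x where "g x = x" by blast
  then have "t *\<^sub>R (w *\<^sub>C (X x - y)) = 0"
    by (simp add: g_def)
  moreover have "t \<noteq> 0" using a b by (simp add: t_def)
  ultimately have "norm (w *\<^sub>C (X x - y)) = 0"
    by simp
  then have "X x = y"
    by (simp add: norm_scaleC w)
  then show "\<exists>x. X x = y" by blast
qed


section \<open>Operators between two scalars\<close>

text \<open>\<open>op_in a b X\<close> says \<open>a I \<le> X \<le> b I\<close>. It implies that the spectrum lies in \<open>[a, b]\<close>, and unlike
  a condition on the spectrum it is visibly stable under compressions, direct sums and limits.\<close>

definition op_in :: "real \<Rightarrow> real \<Rightarrow> ('h::complex_hilbert_space \<Rightarrow>\<^sub>L 'h) \<Rightarrow> bool" where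
  "op_in a b X \<longleftrightarrow> self_adjoint X \<and>
     (\<forall>x. a * (norm x)\<^sup>2 \<le> Re (cinner (X x) x) \<and> Re (cinner (X x) x) \<le> b * (norm x)\<^sup>2)"

lemma op_in_self_adjoint: "op_in a b X \<Longrightarrow> self_adjoint X"
  by (simp add: op_in_def)

lemma op_in_lower: "op_in a b X \<Longrightarrow> a * (norm x)\<^sup>2 \<le> Re (cinner (X x) x)"
  by (simp add: op_in_def)

lemma op_in_upper: "op_in a b X \<Longrightarrow> Re (cinner (X x) x) \<le> b * (norm x)\<^sup>2"
  by (simp add: op_in_def)

lemma op_in_mono: "op_in a b X \<Longrightarrow> a' \<le> a \<Longrightarrow> b \<le> b' \<Longrightarrow> op_in a' b' X"
  unfolding op_in_def by (meson mult_right_mono order_trans zero_le_power2)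

lemma spectrum_op_in:
  assumes X: "op_in a b X" and c: "c \<in> spectrum X"
  shows "c \<in> complex_of_real ` {a..b}"
proof -
  let ?Y = "X - scaleC_op c id_blinfun"
  have sa: "self_adjoint X" using X by (simp add: op_in_def)
  have Y: "?Y \<in> bounded_operators"
    using sa by (intro bounded_operators_diff scaleC_op_bounded bounded_operators_id
        self_adjoint_bounded)
  have ip: "cinner (?Y x) x = complex_of_real (Re (cinner (X x) x)) - c * complex_of_real ((norm x)\<^sup>2)" for x
    by (simp add: minus_blinfun.rep_eq cinner_diff_left cinner_scaleC_left cinner_self
        complex_eq_iff cinner_self_adjoint_real[OF sa])
  have ninv: "\<not> invertible_op ?Y" using c by (simp add: spectrum_def)
  have "\<not> (0 < e \<and> cmod w = 1 \<and> (\<forall>x. e * (norm x)\<^sup>2 \<le> Re (w * cinner (?Y x) x)))" for e w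
    using invertible_op_if_coercive[OF Y, of w e] ninv by blast
  note no = this[unfolded ip]
  have "Im c = 0"
  proof (rule ccontr)
    assume "Im c \<noteq> 0"
    then consider "0 < Im c" | "Im c < 0" by linarith
    then show False
    proof cases
      case 1 with no[of "Im c" \<i>] show False by simp
    next
      case 2 with no[of "- Im c" "-\<i>"] show False by simp
    qed
  qed
  moreover have "a \<le> Re c"
  proof (rule ccontr)
    assume "\<not> a \<le> Re c"
    with no[of "a - Re c" 1] op_in_lower[OF X] show False by (simp add: algebra_simps)
  qed
  moreover have "Re c \<le> b"
  proof (rule ccontr)
    assume "\<not> Re c \<le> b"
    with no[of "Re c - b" "-1"] op_in_upper[OF X] show False by (simp add: algebra_simps)
  qed
  ultimately have "c = complex_of_real (Re c)" "Re c \<in> {a..b}"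
    by (auto simp: complex_eq_iff)
  then show ?thesis by (metis imageI)
qed

lemma self_adjoint_op_in_norm:
  assumes "self_adjoint X"
  shows "op_in (- norm X) (norm X) X"
proof -
  have "\<bar>Re (cinner (X x) x)\<bar> \<le> norm X * (norm x)\<^sup>2" for x
  proof -
    have "\<bar>Re (cinner (X x) x)\<bar> \<le> norm (X x) * norm x"
      using abs_Re_le_cmod cinner_Cauchy_Schwarz order_trans by blast
    also have "\<dots> \<le> norm X * norm x * norm x"
      by (intro mult_right_mono norm_blinfun norm_ge_zero)
    finally show ?thesis by (simp add: power2_eq_square mult.assoc)
  qed
  then show ?thesis
    using assms by (auto simp: op_in_def abs_le_iff minus_le_iff)
qed

text \<open>Expand the positive quantity \<open>\<langle>X y, y\<rangle>\<close> at \<open>y = x - X x / b\<close>.\<close>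

lemma positive_norm_squared_le:
  assumes X: "op_in 0 b X" and b: "0 < b" "norm X \<le> b"
  shows "(norm (X x))\<^sup>2 \<le> b * Re (cinner (X x) x)"
proof -
  define t where "t = 1 / b"
  define y where "y = x - t *\<^sub>R X x"
  have sa: "cinner (X u) v = cinner u (X v)" for u v
    using X by (simp add: op_in_def self_adjoint_def)
  have "0 \<le> Re (cinner (X y) y)"
    using op_in_lower[OF X, of y] by simp
  also have "Re (cinner (X y) y) = Re (cinner (X x) x) - 2 * t * (norm (X x))\<^sup>2 + t\<^sup>2 * Re (cinner (X (X x)) (X x))"
    by (simp add: y_def blinfun.diff_right blinfun.scaleR_right cinner_diff_left cinner_diff_right
        cinner_scaleR_left cinner_scaleR_right sa[of "X x" x] Re_cinner_self algebra_simps
        power2_eq_square[of t])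
  also have "Re (cinner (X (X x)) (X x)) \<le> b * (norm (X x))\<^sup>2"
    by (rule op_in_upper[OF X])
  finally have "0 \<le> Re (cinner (X x) x) - 2 * t * (norm (X x))\<^sup>2 + t\<^sup>2 * (b * (norm (X x))\<^sup>2)"
    by (simp add: mult_left_mono)
  then show ?thesis
    using b by (simp add: t_def field_simps power2_eq_square)
qed

text \<open>An inverse bounds \<open>\<parallel>X x\<parallel>\<close> from below, and the previous estimate turns this into a bound for the
  quadratic form.\<close>

lemma strictly_positive_op_in:
  assumes "strictly_positive X"
  obtains a where "0 < a" "\<And>b. norm X \<le> b \<Longrightarrow> op_in a b X"
proof -
  have sa: "self_adjoint X" and pos: "0 \<le> Re (cinner (X x) x)" for x
    using assms by (auto simp: strictly_positive_def positive_op_def)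
  obtain k where k: "0 < k" "\<And>x. k * norm x \<le> norm (X x)"
    using assms invertible_op_bounded_below by (auto simp: strictly_positive_def)
  define b where "b = norm X + 1"
  have b: "0 < b" "norm X \<le> b" by (auto simp: b_def add_nonneg_pos)
  have up: "Re (cinner (X x) x) \<le> norm X * (norm x)\<^sup>2" for x
    using op_in_upper[OF self_adjoint_op_in_norm[OF sa]] .
  have up_b: "Re (cinner (X x) x) \<le> b' * (norm x)\<^sup>2" if "norm X \<le> b'" for x b'
    using up[of x] that by (meson mult_right_mono order_trans zero_le_power2)
  have "op_in 0 b X"
    using sa pos up_b[OF b(2)] by (auto simp: op_in_def)
  from positive_norm_squared_le[OF this b]
  have "(k * norm x)\<^sup>2 \<le> b * Re (cinner (X x) x)" for x
    using power_mono[OF k(2), of x 2] k(1) order_trans by (metis less_eq_real_def mult_nonneg_nonneg norm_ge_zero)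
  then have low: "k\<^sup>2 / b * (norm x)\<^sup>2 \<le> Re (cinner (X x) x)" for x
    using b by (simp add: field_simps power_mult_distrib)
  show thesis
  proof
    show "0 < k\<^sup>2 / b" using k b by simp
    show "op_in (k\<^sup>2 / b) b' X" if "norm X \<le> b'" for b'
      using sa low up_b[OF that] by (simp add: op_in_def)
  qed
qed

section \<open>Polynomials of an operator and the spectrum\<close>

lemma poly_op_0 [simp]: "poly_op 0 X = 0"
  by (simp add: poly_op_def)

lemma poly_op_pCons [simp]: "poly_op (pCons a p) X = a *\<^sub>R id_blinfun + (X o\<^sub>L poly_op p X)"
  by (cases "p = 0 \<and> a = 0") (auto simp: poly_op_def fold_coeffs_pCons_not_0_0_eq blinfun_compose_simps)

lemma poly_op_add: "poly_op (p + q) X = poly_op p X + poly_op q X"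
  by (induction p q rule: poly_induct2) (auto simp: blinfun_compose_simps algebra_simps)

lemma poly_op_smult: "poly_op (smult c p) X = c *\<^sub>R poly_op p X"
  by (induction p) (auto simp: blinfun_compose_simps algebra_simps)

lemma poly_op_diff: "poly_op (p - q) X = poly_op p X - poly_op q X"
  using poly_op_add[of "p - q" q X] by simp

lemma poly_op_mult: "poly_op (p * q) X = poly_op p X o\<^sub>L poly_op q X"
  by (induction p) (auto simp: blinfun_compose_simps poly_op_add poly_op_smult blinfun_compose_assoc)

lemma poly_op_const: "poly_op [:c:] X = c *\<^sub>R id_blinfun"
  by (simp add: blinfun_compose_simps)

lemma poly_op_intertwine:
  assumes "W o\<^sub>L X = Y o\<^sub>L W"
  shows "W o\<^sub>L poly_op p X = poly_op p Y o\<^sub>L W"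
proof (induction p)
  case (pCons a p)
  have "W o\<^sub>L (X o\<^sub>L poly_op p X) = (W o\<^sub>L X) o\<^sub>L poly_op p X"
    by (simp add: blinfun_compose_assoc)
  also have "\<dots> = Y o\<^sub>L (W o\<^sub>L poly_op p X)"
    by (simp add: assms blinfun_compose_assoc)
  also have "\<dots> = (Y o\<^sub>L poly_op p Y) o\<^sub>L W"
    by (simp add: pCons blinfun_compose_assoc)
  finally show ?case
    by (simp add: blinfun_compose_simps)
qed (simp add: blinfun_compose_simps)

lemma poly_op_commute: "X o\<^sub>L poly_op p X = poly_op p X o\<^sub>L X"
  by (rule poly_op_intertwine) simp

lemma poly_op_self_adjoint:
  assumes "self_adjoint X"
  shows "self_adjoint (poly_op p X)"
proof (induction p)
  case (pCons a p)
  have "adjoint_pair (X o\<^sub>L poly_op p X) (poly_op p X o\<^sub>L X)"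
    using assms pCons by (intro adjoint_pair_compose) (auto simp: self_adjoint_iff)
  then have "self_adjoint (X o\<^sub>L poly_op p X)"
    by (simp add: self_adjoint_iff poly_op_commute)
  then show ?case
    by (simp add: self_adjoint_add self_adjoint_scaleR self_adjoint_id)
qed (simp add: self_adjoint_iff adjoint_pair_zero)

lemma tendsto_poly_op:
  assumes "(X \<longlongrightarrow> Y) F"
  shows "((\<lambda>n. poly_op p (X n)) \<longlongrightarrow> poly_op p Y) F"
  by (induction p)
    (auto intro!: tendsto_intros assms bounded_bilinear.tendsto[OF bounded_bilinear_blinfun_compose])

abbreviation real_spectrum :: "('h::complex_hilbert_space \<Rightarrow>\<^sub>L 'h) \<Rightarrow> real set" where
  "real_spectrum X \<equiv> {x. complex_of_real x \<in> spectrum X}"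

lemma real_spectrum_op_in: "op_in a b X \<Longrightarrow> real_spectrum X \<subseteq> {a..b}"
  using spectrum_op_in by fastforce

lemma invertible_op_scaleR_id: "c \<noteq> 0 \<Longrightarrow> invertible_op (c *\<^sub>R id_blinfun)"
  unfolding invertible_op_def
  by (rule bexI[of _ "inverse c *\<^sub>R id_blinfun"])
    (auto simp: blinfun_compose_simps intro: bounded_operators_scaleR bounded_operators_id)

text \<open>Factor a polynomial over the reals: the linear factors are invertible at \<open>X\<close> by hypothesis, the
  quadratic ones \<open>(x - r)\<^sup>2 + s\<^sup>2\<close> because their value at \<open>X\<close> is at least \<open>s\<^sup>2\<close>.\<close>

lemma invertible_poly_op:
  assumes X: "self_adjoint X" and "q \<noteq> 0" and "\<And>x. x \<in> real_spectrum X \<Longrightarrow> poly q x \<noteq> 0"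
  shows "invertible_op (poly_op q X)"
  using assms(2,3)
proof (induction "degree q" arbitrary: q rule: less_induct)
  case less
  show ?case
  proof (cases "degree q = 0")
    case True
    then obtain c where "q = [:c:]" by (rule degree_eq_zeroE)
    with less.prems show ?thesis
      using invertible_op_scaleR_id[of c] by (simp add: poly_op_const blinfun_compose_simps)
  next
    case False
    have factor: "invertible_op (poly_op q X)"
      if "q = d * k" "0 < degree d" "invertible_op (poly_op d X)" for d k
    proof -
      have "k \<noteq> 0" "d \<noteq> 0" using that less.prems by auto
      then have "degree k < degree q" using that by (simp add: degree_mult_eq)
      then have "invertible_op (poly_op k X)"
        using less.hyps[of k] \<open>k \<noteq> 0\<close> less.prems that by auto
      then show ?thesis
        using that by (simp add: poly_op_mult invertible_op_compose)
    qed
    define e where "e p z = poly (map_poly complex_of_real p) z" for p z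
    have e0: "e 0 z = 0" for z by (simp add: e_def)
    have e_pCons: "e (pCons a p) z = of_real a + z * e p z" for a p z
      by (simp add: e_def map_poly_pCons)
    have e_add: "e (p + p') z = e p z + e p' z" for p p' z
      by (induction p p' rule: poly_induct2) (auto simp: e0 e_pCons algebra_simps)
    have e_smult: "e (smult c p) z = of_real c * e p z" for c p z
      by (induction p) (auto simp: e0 e_pCons algebra_simps)
    have e_mult: "e (p * p') z = e p z * e p' z" for p p' z
      by (induction p) (auto simp: e0 e_pCons e_add e_smult algebra_simps)
    have "degree (map_poly complex_of_real q) = degree q"
      by (rule degree_map_poly) simp
    then have "\<not> constant (poly (map_poly complex_of_real q))"
      using False by (simp add: constant_degree)
    then obtain z where z: "e q z = 0"
      unfolding e_def using fundamental_theorem_of_algebra by blast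
    show ?thesis
    proof (cases "Im z = 0")
      case True
      have "e p (of_real r) = of_real (poly p r)" for p r
        by (induction p) (auto simp: e0 e_pCons)
      then have "poly q (Re z) = 0"
        using z True by (metis complex_is_Real_iff of_real_Re of_real_eq_0_iff)
      then obtain k where k: "q = [:- Re z, 1:] * k"
        by (metis poly_eq_0_iff_dvd dvdE)
      have "Re z \<notin> real_spectrum X"
        using \<open>poly q (Re z) = 0\<close> less.prems by blast
      then have "invertible_op (X - Re z *\<^sub>R id_blinfun)"
        by (simp add: spectrum_def scaleC_op_of_real)
      then show ?thesis
        using factor[OF k] by (simp add: blinfun_compose_simps)
    next
      case False
      define d :: "real poly" where "d = [:(cmod z)\<^sup>2, - 2 * Re z, 1:]"
      have ed: "e d z = 0"
        unfolding d_def using complex_norm_square[of z]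
        by (simp add: e0 e_pCons complex_eq_iff power2_eq_square cmod_def algebra_simps)
      have "d \<noteq> 0" "degree d = 2" by (simp_all add: d_def)
      define r where "r = q mod d"
      have "e r z = 0"
        using z ed e_add[of "q div d * d" r z] by (simp add: r_def e_mult)
      have "degree r < 2"
        using degree_mod_less'[OF \<open>d \<noteq> 0\<close>, of q] \<open>degree d = 2\<close> by (cases "r = 0") (auto simp: r_def)
      then have "r = [:coeff r 0, coeff r 1:]"
        by (intro poly_eqI) (auto simp: coeff_pCons coeff_eq_0 split: nat.splits)
      then obtain u v where r: "r = [:u, v:]" by blast
      with \<open>e r z = 0\<close> False have "v = 0" "u = 0"
        by (auto simp: e0 e_pCons complex_eq_iff)
      with r have "q = d * (q div d)"
        using div_mult_mod_eq[of q d] by (simp add: r_def mult.commute)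
      moreover have "0 < degree d" using \<open>degree d = 2\<close> by simp
      moreover have "invertible_op (poly_op d X)"
      proof (rule invertible_op_if_coercive[where w = 1 and a = "(Im z)\<^sup>2"])
        show "poly_op d X \<in> bounded_operators"
          by (rule self_adjoint_bounded[OF poly_op_self_adjoint[OF X]])
        fix x
        have sa: "cinner (X u) v = cinner u (X v)" for u v
          using X by (simp add: self_adjoint_def)
        have dX: "poly_op d X x = ((Re z)\<^sup>2 + (Im z)\<^sup>2) *\<^sub>R x - (2 * Re z) *\<^sub>R X x + X (X x)"
          by (simp add: d_def plus_blinfun.rep_eq minus_blinfun.rep_eq scaleR_blinfun.rep_eq blinfun.add_right
              blinfun.scaleR_right cmod_power2 blinfun_compose_simps blinfun.minus_right algebra_simps)
        have "Re (cinner (poly_op d X x) x) =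
            (Im z)\<^sup>2 * (norm x)\<^sup>2 + (norm (X x - Re z *\<^sub>R x))\<^sup>2"
          by (simp add: dX cinner_add_left cinner_diff_left cinner_scaleR_left Re_cinner_self
              sa[of "X x" x] norm_diff_squared cinner_scaleR_right power_mult_distrib algebra_simps)
        then show "(Im z)\<^sup>2 * (norm x)\<^sup>2 \<le> Re (1 * cinner (poly_op d X x) x)"
          by simp
      qed (use False in auto)
      ultimately show ?thesis
        by (rule factor)
    qed
  qed
qed

text \<open>On a nonzero space, a self-adjoint \<open>Y\<close> has unit vectors \<open>x\<close> with \<open>Y\<^sup>2 x\<close> arbitrarily close to \<open>\<parallel>Y\<parallel>\<^sup>2 x\<close>: take those
  with \<open>\<parallel>Y x\<parallel>\<close> close to \<open>\<parallel>Y\<parallel>\<close>. So \<open>Y\<^sup>2 - \<parallel>Y\<parallel>\<^sup>2\<close> is invertible on the zero space only.\<close>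

lemma invertible_square_minus_norm:
  fixes Y :: "'h::complex_hilbert_space \<Rightarrow>\<^sub>L 'h"
  assumes Y: "self_adjoint Y" and inv: "invertible_op ((Y o\<^sub>L Y) - (norm Y)\<^sup>2 *\<^sub>R id_blinfun)"
  shows "x = (0::'h)"
proof -
  define r where "r = norm Y"
  obtain k where k: "0 < k" "\<And>x. k * norm x \<le> norm (((Y o\<^sub>L Y) - (norm Y)\<^sup>2 *\<^sub>R id_blinfun) x)"
    using invertible_op_bounded_below[OF inv] by blast
  have sa: "cinner (Y u) v = cinner u (Y v)" for u v
    using Y by (simp add: self_adjoint_def)
  have *: "(k * norm x)\<^sup>2 \<le> r\<^sup>2 * (r\<^sup>2 * (norm x)\<^sup>2 - (norm (Y x))\<^sup>2)" for x
  proof -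
    have "(k * norm x)\<^sup>2 \<le> (norm (Y (Y x) - r\<^sup>2 *\<^sub>R x))\<^sup>2"
      using k(2)[of x] k(1)
      by (intro power_mono) (auto simp: minus_blinfun.rep_eq scaleR_blinfun.rep_eq r_def)
    also have "\<dots> = (norm (Y (Y x)))\<^sup>2 - 2 * r\<^sup>2 * (norm (Y x))\<^sup>2 + r\<^sup>2 * r\<^sup>2 * (norm x)\<^sup>2"
      by (simp add: norm_diff_squared cinner_scaleR_right sa[of "Y x"] Re_cinner_self
          power_mult_distrib power2_eq_square[of "r\<^sup>2"])
    also have "(norm (Y (Y x)))\<^sup>2 \<le> (r * norm (Y x))\<^sup>2"
      unfolding r_def by (intro power_mono norm_blinfun norm_ge_zero)
    finally show ?thesis
      by (simp add: algebra_simps power_mult_distrib)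
  qed
  show ?thesis
  proof (cases "r = 0")
    case True
    with *[of x] k(1) show ?thesis by simp
  next
    case False
    then have r: "0 < r" by (simp add: r_def)
    \<comment> \<open>Unless \<open>x = 0\<close>, the estimate makes the norm of \<open>Y\<close> strictly smaller than \<open>r\<close>.\<close>
    define q where "q = max 0 (r\<^sup>2 - (k / r)\<^sup>2)"
    have "(norm (Y x))\<^sup>2 \<le> q * (norm x)\<^sup>2" for x
    proof -
      have "(k / r)\<^sup>2 * (norm x)\<^sup>2 \<le> r\<^sup>2 * (norm x)\<^sup>2 - (norm (Y x))\<^sup>2"
        using *[of x] r by (simp add: field_simps power_mult_distrib)
      then have "(norm (Y x))\<^sup>2 \<le> (r\<^sup>2 - (k / r)\<^sup>2) * (norm x)\<^sup>2"
        by (simp add: algebra_simps)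
      also have "\<dots> \<le> q * (norm x)\<^sup>2"
        by (intro mult_right_mono) (auto simp: q_def)
      finally show ?thesis .
    qed
    then have "norm (Y x) \<le> sqrt q * norm x" for x
      using real_sqrt_le_mono[of "(norm (Y x))\<^sup>2" "q * (norm x)\<^sup>2"] by (simp add: real_sqrt_mult)
    then have "r \<le> sqrt q"
      unfolding r_def by (intro norm_blinfun_bound) (auto simp: q_def)
    moreover have "sqrt q < r"
      using r k(1) by (intro real_less_lsqrt) (auto simp: q_def)
    ultimately show ?thesis by simp
  qed
qed

text \<open>Otherwise \<open>p\<^sup>2 - \<parallel>p(X)\<parallel>\<^sup>2\<close> would have no zero on the spectrum, and
  \<open>p(X)\<^sup>2 - \<parallel>p(X)\<parallel>\<^sup>2\<close> would be invertible.\<close>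

lemma norm_poly_op_le:
  fixes X :: "'h::complex_hilbert_space \<Rightarrow>\<^sub>L 'h"
  assumes X: "self_adjoint X" and s: "0 \<le> s" "\<And>x. x \<in> real_spectrum X \<Longrightarrow> \<bar>poly p x\<bar> \<le> s"
  shows "norm (poly_op p X) \<le> s"
proof (rule ccontr)
  assume r: "\<not> norm (poly_op p X) \<le> s"
  define r where "r = norm (poly_op p X)"
  have trivial: False if "\<And>x::'h. x = 0"
  proof -
    have "poly_op p X = 0" using that by (intro blinfun_eqI) metis
    with r s show False by simp
  qed
  define q where "q = p * p - [:r\<^sup>2:]"
  have qX: "poly_op q X = (poly_op p X o\<^sub>L poly_op p X) - r\<^sup>2 *\<^sub>R id_blinfun"
    by (simp add: q_def poly_op_diff poly_op_mult blinfun_compose_simps)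
  have "poly q x \<noteq> 0" if x: "x \<in> real_spectrum X" for x
  proof -
    have "\<bar>poly p x\<bar> < r" using s(2)[OF x] r by (simp add: r_def)
    then have "(poly p x)\<^sup>2 < r\<^sup>2" using power_strict_mono[of "\<bar>poly p x\<bar>" r 2] by simp
    then show ?thesis by (simp add: q_def power2_eq_square)
  qed
  note nz = this
  show False
  proof (cases "q = 0")
    case False
    then have "invertible_op (poly_op q X)"
      using invertible_poly_op[OF X] nz by blast
    then show False
      using trivial invertible_square_minus_norm[OF poly_op_self_adjoint[OF X], of p]
      unfolding qX r_def by blast
  next
    case True
    \<comment> \<open>Here the spectrum is empty, which happens on the zero space only.\<close>
    then have "real_spectrum X = {}" using nz by auto
    then have "invertible_op (poly_op [:- (norm X)\<^sup>2, 0, 1:] X)"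
      by (intro invertible_poly_op[OF X]) auto
    then show False
      using trivial invertible_square_minus_norm[OF X]
      by (auto simp: blinfun_compose_simps)
  qed
qed


section \<open>The continuous functional calculus\<close>

lemma poly_approximation:
  fixes f :: "real \<Rightarrow> real"
  assumes "continuous_on {a..b} f"
  obtains p where "uniform_limit {a..b} (\<lambda>n. poly (p n)) f sequentially"
proof -
  obtain g where g: "uniform_limit {a..b} g f sequentially" "\<And>n. polynomial_function (g n)"
    using Stone_Weierstrass_uniform_limit[OF compact_Icc assms] by blast
  have "\<exists>p. g n = poly p" for n
  proof -
    have "real_polynomial_function (g n)"
      using g(2) by (simp add: real_polynomial_function_eq)
    then obtain c k where "g n = (\<lambda>x. \<Sum>i\<le>k. c i * x ^ i)"
      by (auto simp: real_polynomial_function_iff_sum)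
    then have "g n = poly (\<Sum>i\<le>k. monom (c i) i)"
      by (simp add: fun_eq_iff poly_sum poly_monom)
    then show ?thesis ..
  qed
  then obtain p where "\<And>n. g n = poly (p n)" by metis
  then have "g = (\<lambda>n. poly (p n))" by (simp add: fun_eq_iff)
  with g(1) that show thesis by blast
qed

lemma uniform_limit_eventually_le:
  fixes g :: "nat \<Rightarrow> real \<Rightarrow> real"
  assumes "uniform_limit S g f sequentially" "0 < e"
  shows "\<forall>\<^sub>F n in sequentially. \<forall>x\<in>S. \<bar>g n x - f x\<bar> \<le> e"
  using uniform_limitD[OF assms] by eventually_elim (auto simp: dist_real_def intro: less_imp_le)

text \<open>By the norm estimate for polynomials, the values at \<open>X\<close> of polynomials that converge on the spectrum
  form a Cauchy sequence, and any two sequences with the same limit function have the same limit at \<open>X\<close>.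
  So the description that defines the functional calculus has exactly one solution, provided
  that at least one approximating sequence exists.\<close>

lemma poly_op_tendsto_cfc_real_spectrum:
  fixes X :: "'h::complex_hilbert_space \<Rightarrow>\<^sub>L 'h"
  assumes X: "self_adjoint X"
    and p: "uniform_limit (real_spectrum X) (\<lambda>n. poly (p n)) f sequentially"
  shows "(\<lambda>n. poly_op (p n) X) \<longlonglongrightarrow> cfc f X"
proof -
  have close: "\<exists>N. \<forall>n\<ge>N. norm (poly_op (p n) X - poly_op (q n) X) \<le> e"
    if e: "0 < e" and q: "uniform_limit (real_spectrum X) (\<lambda>n. poly (q n)) f sequentially" for q e
  proof -
    have "\<forall>\<^sub>F n in sequentially. norm (poly_op (p n) X - poly_op (q n) X) \<le> e"
      using uniform_limit_eventually_le[OF p half_gt_zero[OF e]]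
        uniform_limit_eventually_le[OF q half_gt_zero[OF e]]
    proof eventually_elim
      case (elim n)
      have "norm (poly_op (p n - q n) X) \<le> e"
      proof (rule norm_poly_op_le[OF X])
        fix x assume x: "x \<in> real_spectrum X"
        show "\<bar>poly (p n - q n) x\<bar> \<le> e"
          unfolding poly_diff using elim(1)[rule_format, OF x] elim(2)[rule_format, OF x] by linarith
      qed (use e in simp)
      then show ?case by (simp add: poly_op_diff)
    qed
    then show ?thesis by (simp add: eventually_sequentially)
  qed
  have "Cauchy (\<lambda>n. poly_op (p n) X)"
  proof (rule CauchyI)
    fix e :: real assume e: "0 < e"
    obtain N where N: "\<And>n. n \<ge> N \<Longrightarrow> \<forall>x\<in>real_spectrum X. \<bar>poly (p n) x - f x\<bar> \<le> e / 4"
      using uniform_limit_eventually_le[OF p, of "e / 4"] e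
      by (auto simp: eventually_sequentially)
    have "norm (poly_op (p m - p n) X) \<le> e / 2" if "m \<ge> N" "n \<ge> N" for m n
    proof (rule norm_poly_op_le[OF X])
      fix x assume x: "x \<in> real_spectrum X"
      show "\<bar>poly (p m - p n) x\<bar> \<le> e / 2"
        unfolding poly_diff
        using N[OF that(1), rule_format, OF x] N[OF that(2), rule_format, OF x] by linarith
    qed (use e in simp)
    then have "norm (poly_op (p m) X - poly_op (p n) X) < e" if "m \<ge> N" "n \<ge> N" for m n
      using that e by (force simp: poly_op_diff)
    then show "\<exists>N. \<forall>m\<ge>N. \<forall>n\<ge>N. norm (poly_op (p m) X - poly_op (p n) X) < e" by blast
  qed
  then obtain Y where Y: "(\<lambda>n. poly_op (p n) X) \<longlonglongrightarrow> Y"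
    using Cauchy_convergent convergent_def by blast
  have all: "(\<lambda>n. poly_op (q n) X) \<longlonglongrightarrow> Y"
    if q: "uniform_limit (real_spectrum X) (\<lambda>n. poly (q n)) f sequentially" for q
  proof -
    have "(\<lambda>n. poly_op (p n) X - poly_op (q n) X) \<longlonglongrightarrow> 0"
    proof (rule LIMSEQ_I)
      fix e :: real assume "0 < e"
      with close[OF half_gt_zero q, of e]
      show "\<exists>N. \<forall>n\<ge>N. norm (poly_op (p n) X - poly_op (q n) X - 0) < e" by fastforce
    qed
    from tendsto_diff[OF Y this] show ?thesis by simp
  qed
  have "cfc f X = Y"
    unfolding cfc_def
  proof (rule the_equality)
    fix Z assume "\<forall>p. uniform_limit (real_spectrum X) (\<lambda>n. poly (p n)) f sequentially \<longrightarrow>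
      (\<lambda>n. poly_op (p n) X) \<longlonglongrightarrow> Z"
    with p Y show "Z = Y" using LIMSEQ_unique by blast
  qed (use all in blast)
  with Y show ?thesis by simp
qed

lemma poly_op_tendsto_cfc:
  assumes "op_in a b X" "uniform_limit {a..b} (\<lambda>n. poly (p n)) f sequentially"
  shows "(\<lambda>n. poly_op (p n) X) \<longlonglongrightarrow> cfc f X"
  using poly_op_tendsto_cfc_real_spectrum[OF op_in_self_adjoint[OF assms(1)]]
    uniform_limit_on_subset[OF assms(2) real_spectrum_op_in[OF assms(1)]] by blast

lemma cfc_poly:
  assumes "op_in a b X"
  shows "cfc (poly q) X = poly_op q X"
  using LIMSEQ_unique[OF poly_op_tendsto_cfc[OF assms uniform_limit_const] tendsto_const] .

lemma cfc_cong:
  assumes "op_in a b X" "\<And>x. x \<in> {a..b} \<Longrightarrow> f x = g x"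
  shows "cfc f X = cfc g X"
proof -
  have "uniform_limit (real_spectrum X) (\<lambda>n. poly (p n)) f sequentially \<longleftrightarrow>
      uniform_limit (real_spectrum X) (\<lambda>n. poly (p n)) g sequentially" for p :: "nat \<Rightarrow> real poly"
    using assms(2) real_spectrum_op_in[OF assms(1)] by (intro uniform_limit_cong') auto
  then show ?thesis by (simp add: cfc_def)
qed

lemma cfc_mult:
  assumes X: "op_in a b X" and f: "continuous_on {a..b} f" and g: "continuous_on {a..b} g"
  shows "cfc f X o\<^sub>L cfc g X = cfc (\<lambda>x. f x * g x) X"
proof -
  obtain p q where p: "uniform_limit {a..b} (\<lambda>n. poly (p n)) f sequentially"
    and q: "uniform_limit {a..b} (\<lambda>n. poly (q n)) g sequentially"
    using poly_approximation f g by metis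
  have "uniform_limit {a..b} (\<lambda>n x. poly (p n) x * poly (q n) x) (\<lambda>x. f x * g x) sequentially"
    by (intro uniform_lim_mult p q compact_imp_bounded compact_continuous_image f g compact_Icc)
  then have "uniform_limit {a..b} (\<lambda>n. poly (p n * q n)) (\<lambda>x. f x * g x) sequentially"
    by (rule uniform_limit_cong'[THEN iffD1, rotated -1]) auto
  from poly_op_tendsto_cfc[OF X this]
  have "(\<lambda>n. poly_op (p n) X o\<^sub>L poly_op (q n) X) \<longlonglongrightarrow> cfc (\<lambda>x. f x * g x) X"
    by (simp add: poly_op_mult)
  moreover have "(\<lambda>n. poly_op (p n) X o\<^sub>L poly_op (q n) X) \<longlonglongrightarrow> (cfc f X o\<^sub>L cfc g X)"
    by (intro bounded_bilinear.tendsto[OF bounded_bilinear_blinfun_compose]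
        poly_op_tendsto_cfc[OF X] p q)
  ultimately show ?thesis using LIMSEQ_unique by blast
qed

lemma cfc_diff:
  assumes X: "op_in a b X" and f: "continuous_on {a..b} f" and g: "continuous_on {a..b} g"
  shows "cfc f X - cfc g X = cfc (\<lambda>x. f x - g x) X"
proof -
  obtain p q where p: "uniform_limit {a..b} (\<lambda>n. poly (p n)) f sequentially"
    and q: "uniform_limit {a..b} (\<lambda>n. poly (q n)) g sequentially"
    using poly_approximation f g by metis
  have "uniform_limit {a..b} (\<lambda>n x. poly (p n) x - poly (q n) x) (\<lambda>x. f x - g x) sequentially"
    by (intro uniform_limit_minus p q)
  then have "uniform_limit {a..b} (\<lambda>n. poly (p n - q n)) (\<lambda>x. f x - g x) sequentially"
    by (rule uniform_limit_cong'[THEN iffD1, rotated -1]) auto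
  from poly_op_tendsto_cfc[OF X this]
  have "(\<lambda>n. poly_op (p n) X - poly_op (q n) X) \<longlonglongrightarrow> cfc (\<lambda>x. f x - g x) X"
    by (simp add: poly_op_diff)
  moreover have "(\<lambda>n. poly_op (p n) X - poly_op (q n) X) \<longlonglongrightarrow> cfc f X - cfc g X"
    by (intro tendsto_diff poly_op_tendsto_cfc[OF X] p q)
  ultimately show ?thesis using LIMSEQ_unique by blast
qed

lemma cfc_in_closed:
  assumes X: "op_in a b X" and f: "continuous_on {a..b} f"
    and S: "closed S" "\<And>p. poly_op p X \<in> S"
  shows "cfc f X \<in> S"
proof -
  obtain p where p: "uniform_limit {a..b} (\<lambda>n. poly (p n)) f sequentially"
    using poly_approximation f by metis
  show ?thesis
    using Lim_in_closed_set[OF S(1) _ _ poly_op_tendsto_cfc[OF X p]] S(2) by simp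
qed

lemma cfc_self_adjoint: "op_in a b X \<Longrightarrow> continuous_on {a..b} f \<Longrightarrow> self_adjoint (cfc f X)"
  using cfc_in_closed[of a b X f, OF _ _ closed_self_adjoint]
  by (simp add: poly_op_self_adjoint op_in_self_adjoint)

lemma norm_cfc_le:
  assumes X: "op_in a b X" and f: "continuous_on {a..b} f"
    and s: "0 \<le> s" "\<And>x. x \<in> {a..b} \<Longrightarrow> \<bar>f x\<bar> \<le> s"
  shows "norm (cfc f X) \<le> s"
proof (rule field_le_epsilon)
  fix e :: real assume e: "0 < e"
  obtain p where p: "uniform_limit {a..b} (\<lambda>n. poly (p n)) f sequentially"
    using poly_approximation f by metis
  have "\<forall>\<^sub>F n in sequentially. norm (poly_op (p n) X) \<le> s + e"
    using uniform_limit_eventually_le[OF p e]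
  proof eventually_elim
    case (elim n)
    show ?case
    proof (rule norm_poly_op_le[OF op_in_self_adjoint[OF X]])
      fix x assume "x \<in> real_spectrum X"
      then have "x \<in> {a..b}" using real_spectrum_op_in[OF X] by blast
      with elim s(2) show "\<bar>poly (p n) x\<bar> \<le> s + e" by fastforce
    qed (use s e in simp)
  qed
  then show "norm (cfc f X) \<le> s + e"
    using tendsto_upperbound[OF tendsto_norm[OF poly_op_tendsto_cfc[OF X p]]] by simp
qed

text \<open>This single rule yields the behaviour of the functional calculus under unitary conjugation, on
  direct sums and on compressions to reducing subspaces: \<open>W\<close> may map between different spaces.\<close>

lemma cfc_intertwine:
  assumes X: "op_in a b X" and Y: "op_in a b Y" and f: "continuous_on {a..b} f"
    and W: "W o\<^sub>L X = Y o\<^sub>L W"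
  shows "W o\<^sub>L cfc f X = cfc f Y o\<^sub>L W"
proof -
  obtain p where p: "uniform_limit {a..b} (\<lambda>n. poly (p n)) f sequentially"
    using poly_approximation f by metis
  have "(\<lambda>n. W o\<^sub>L poly_op (p n) X) \<longlonglongrightarrow> (W o\<^sub>L cfc f X)"
    "(\<lambda>n. poly_op (p n) Y o\<^sub>L W) \<longlonglongrightarrow> (cfc f Y o\<^sub>L W)"
    by (intro bounded_bilinear.tendsto[OF bounded_bilinear_blinfun_compose] tendsto_const
        poly_op_tendsto_cfc[OF X p] poly_op_tendsto_cfc[OF Y p])+
  then show ?thesis
    using LIMSEQ_unique unfolding poly_op_intertwine[OF W] by blast
qed

text \<open>Up to a uniformly small error \<open>f\<close> is a polynomial on \<open>[a, b]\<close>, and polynomials of operators are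
  continuous.\<close>

lemma tendsto_cfc:
  assumes lim: "(X \<longlongrightarrow> Y) F" and X: "\<forall>\<^sub>F n in F. op_in a b (X n)" and Y: "op_in a b Y"
    and f: "continuous_on {a..b} f"
  shows "((\<lambda>n. cfc f (X n)) \<longlongrightarrow> cfc f Y) F"
proof (rule tendstoI)
  fix e :: real assume e: "0 < e"
  obtain p where p: "uniform_limit {a..b} (\<lambda>n. poly (p n)) f sequentially"
    using poly_approximation f by metis
  obtain q where q: "\<And>x. x \<in> {a..b} \<Longrightarrow> \<bar>poly q x - f x\<bar> \<le> e / 4"
    using uniform_limit_eventually_le[OF p, of "e / 4"] e
    unfolding eventually_sequentially by (meson divide_pos_pos order_refl zero_less_numeral)
  have near: "norm (cfc f Z - poly_op q Z) \<le> e / 4" if Z: "op_in a b Z" for Z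
  proof -
    have "norm (cfc (\<lambda>x. f x - poly q x) Z) \<le> e / 4"
      by (rule norm_cfc_le[OF Z]) (use e q f in \<open>auto intro!: continuous_intros simp: abs_minus_commute\<close>)
    then show ?thesis
      by (simp add: cfc_poly[OF Z, symmetric] cfc_diff[OF Z] f continuous_on_poly)
  qed
  have "\<forall>\<^sub>F n in F. dist (poly_op q (X n)) (poly_op q Y) < e / 4"
    by (rule tendstoD[OF tendsto_poly_op[OF lim]]) (use e in simp)
  then show "\<forall>\<^sub>F n in F. dist (cfc f (X n)) (cfc f Y) < e"
    using X
  proof eventually_elim
    case (elim n)
    have "norm (cfc f (X n) - cfc f Y) \<le>
        norm (cfc f (X n) - poly_op q (X n)) + norm (poly_op q (X n) - poly_op q Y)
        + norm (cfc f Y - poly_op q Y)"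
      using dist_triangle[of "cfc f (X n)" "cfc f Y" "poly_op q (X n)"]
        dist_triangle2[of "poly_op q (X n)" "cfc f Y" "poly_op q Y"]
      unfolding dist_norm by linarith
    also have "\<dots> < e"
      using near[OF elim(2)] near[OF Y] elim(1) e by (simp add: dist_norm)
    finally show ?case by (simp add: dist_norm)
  qed
qed

text \<open>A nonnegative function is the square of its root, so its value at \<open>X\<close> is a square.\<close>

lemma cfc_nonneg:
  assumes X: "op_in a b X" and f: "continuous_on {a..b} f" "\<And>x. x \<in> {a..b} \<Longrightarrow> 0 \<le> f x"
  shows "0 \<le> Re (cinner (cfc f X x) x)"
proof -
  let ?g = "\<lambda>x. sqrt (f x)"
  have g: "continuous_on {a..b} ?g" by (intro continuous_intros f)
  have "cfc f X = cfc ?g X o\<^sub>L cfc ?g X"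
    unfolding cfc_mult[OF X g g] by (rule cfc_cong[OF X]) (simp add: f)
  moreover have "cinner (cfc ?g X (cfc ?g X x)) x = cinner (cfc ?g X x) (cfc ?g X x)"
    using cfc_self_adjoint[OF X g] by (simp add: self_adjoint_def)
  ultimately show ?thesis
    by (simp add: Re_cinner_self)
qed

lemma op_in_scaleR_id: "op_in c c (c *\<^sub>R id_blinfun)"
  by (simp add: op_in_def self_adjoint_scaleR self_adjoint_id scaleR_blinfun.rep_eq
      cinner_scaleR_left Re_cinner_self)

lemma cfc_scaleR_id: "cfc f (c *\<^sub>R id_blinfun) = f c *\<^sub>R id_blinfun"
proof -
  have "cfc f (c *\<^sub>R id_blinfun) = cfc (poly [:f c:]) (c *\<^sub>R id_blinfun)"
    by (rule cfc_cong[OF op_in_scaleR_id]) simp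
  also have "\<dots> = f c *\<^sub>R id_blinfun"
    by (subst cfc_poly[OF op_in_scaleR_id]) (rule poly_op_const)
  finally show ?thesis .
qed

section \<open>Operator concavity on a Hilbert space given as a type\<close>

text \<open>Operator concavity is stated for Hilbert spaces carried by subsets of a universe. Any type that
  injects into the universe is isometric to such a space; the locale transports the inner
  product, the operators and their functional calculus along the injection.\<close>

locale hilbert_copy =
  fixes \<iota> :: "'k::complex_hilbert_space \<Rightarrow> 'u"
  assumes inj: "inj \<iota>"
begin

definition j :: "'u \<Rightarrow> 'k" where "j = inv \<iota>"
definition carrier :: "'u set" where "carrier = range \<iota>"
definition add :: "'u \<Rightarrow> 'u \<Rightarrow> 'u" where "add u v = \<iota> (j u + j v)"
definition zero :: 'u where "zero = \<iota> 0"
definition scale :: "complex \<Rightarrow> 'u \<Rightarrow> 'u" where "scale c u = \<iota> (c *\<^sub>C j u)"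
definition ip :: "'u \<Rightarrow> 'u \<Rightarrow> complex" where "ip u v = cinner (j u) (j v)"

lemma j_\<iota> [simp]: "j (\<iota> x) = x"
  by (simp add: j_def inj)

lemma \<iota>_j [simp]: "u \<in> carrier \<Longrightarrow> \<iota> (j u) = u"
  by (auto simp: carrier_def)

lemma \<iota>_in [simp]: "\<iota> x \<in> carrier"
  by (simp add: carrier_def)

lemma \<iota>_eq_iff [simp]: "\<iota> x = \<iota> y \<longleftrightarrow> x = y"
  by (metis j_\<iota>)

lemma ball_carrier: "(\<forall>u\<in>carrier. P u) \<longleftrightarrow> (\<forall>x. P (\<iota> x))"
  by (auto simp: carrier_def)

lemma minus_one_scaleC: "(- 1) *\<^sub>C x = - x"
  by (simp add: scaleC_minus_left)

lemma copy_inner_space: "complex_inner_space carrier add zero scale ip"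
proof
  fix x y :: 'u
  show "ip y x = cnj (ip x y)" by (simp add: ip_def cinner_commute[of "j y"])
  show "0 < Re (ip x x)" if "x \<in> carrier" "x \<noteq> zero"
  proof -
    have "j x \<noteq> 0" using that \<iota>_j[of x] unfolding zero_def by metis
    then show ?thesis by (simp add: ip_def Re_cinner_self)
  qed
qed (auto simp: add_def zero_def scale_def ip_def scaleC_scaleC scaleC_add_right scaleC_add_left
    cinner_add_left cinner_scaleC_left add_ac minus_one_scaleC)

sublocale copy: complex_inner_space carrier add zero scale ip
  by (rule copy_inner_space)

lemma nrm_copy: "copy.nrm u = norm (j u)"
  by (simp add: copy.nrm_def ip_def norm_eq_sqrt_cinner)

lemma diff_copy: "copy.diff u v = \<iota> (j u - j v)"
  by (simp add: add_def scale_def minus_one_scaleC)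

lemma copy_hilbert: "complex_hilbert carrier add zero scale ip"
proof -
  let ?d = "\<lambda>u v. copy.nrm (copy.diff u v)"
  have d: "?d = (\<lambda>u v. dist (j u) (j v))"
    by (simp add: fun_eq_iff diff_copy nrm_copy dist_norm)
  interpret M: Metric_space carrier "\<lambda>u v. dist (j u) (j v)"
  proof
    show "dist (j u) (j v) = 0 \<longleftrightarrow> u = v" if "u \<in> carrier" "v \<in> carrier" for u v
      using that \<iota>_j by (metis dist_eq_0_iff)
  qed (auto simp: dist_commute dist_triangle)
  have "M.mcomplete"
    unfolding M.mcomplete_def
  proof (intro allI impI)
    fix \<sigma> assume \<sigma>: "M.MCauchy \<sigma>"
    then have in_carrier: "\<sigma> n \<in> carrier" for n
      by (auto simp: M.MCauchy_def)
    have "Cauchy (\<lambda>n. j (\<sigma> n))"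
      using \<sigma> unfolding M.MCauchy_def Cauchy_def by meson
    then obtain x where x: "(\<lambda>n. j (\<sigma> n)) \<longlonglongrightarrow> x"
      using Cauchy_convergent convergent_def by blast
    have "limitin M.mtopology \<sigma> (\<iota> x) sequentially"
      unfolding M.limitin_metric
    proof (intro conjI allI impI)
      fix e :: real assume "0 < e"
      from tendstoD[OF x this]
      show "\<forall>\<^sub>F n in sequentially. \<sigma> n \<in> carrier \<and> dist (j (\<sigma> n)) (j (\<iota> x)) < e"
        by eventually_elim (simp add: in_carrier)
    qed simp
    then show "\<exists>x. limitin M.mtopology \<sigma> x sequentially" ..
  qed
  then show ?thesis
    by unfold_locales (simp only: d)
qed

definition lift :: "('k \<Rightarrow>\<^sub>L 'k) \<Rightarrow> 'u \<Rightarrow> 'u" where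
  "lift X u = \<iota> (X (j u))"

lemma bounded_op_on_lift:
  assumes "X \<in> bounded_operators"
  shows "copy.bounded_op_on (lift X)"
  using assms unfolding copy.bounded_op_on_def
  by (auto simp: lift_def add_def scale_def nrm_copy blinfun.add_right bounded_operators_def
      intro!: exI[of _ "norm X"] norm_blinfun)

lemma bounded_op_on_is_lift:
  assumes Y: "copy.bounded_op_on Y"
  obtains Z where "Z \<in> bounded_operators" "\<And>u. u \<in> carrier \<Longrightarrow> Y u = lift Z u"
proof -
  define g where "g x = j (Y (\<iota> x))" for x
  have closed: "Y (\<iota> x) \<in> carrier" for x
    using Y by (simp add: copy.bounded_op_on_def)
  obtain K where K: "\<And>x. norm (g x) \<le> K * norm x"
    using Y unfolding copy.bounded_op_on_def ball_carrier nrm_copy g_def by auto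
  have g_add: "g (x + y) = g x + g y" for x y
  proof -
    have "Y (add (\<iota> x) (\<iota> y)) = add (Y (\<iota> x)) (Y (\<iota> y))"
      using Y by (simp add: copy.bounded_op_on_def)
    then show ?thesis by (simp add: add_def g_def)
  qed
  have g_scale: "g (c *\<^sub>C x) = c *\<^sub>C g x" for c x
  proof -
    have "Y (scale c (\<iota> x)) = scale c (Y (\<iota> x))"
      using Y by (simp add: copy.bounded_op_on_def)
    then show ?thesis by (simp add: scale_def g_def)
  qed
  have "bounded_linear g"
    by (rule bounded_linear_intro[of _ K])
      (use K g_add g_scale[of "complex_of_real _"] in \<open>auto simp: scaleC_of_real mult.commute\<close>)
  note apply_g = bounded_linear_Blinfun_apply[OF this]
  show thesis
  proof
    show "Blinfun g \<in> bounded_operators"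
      by (simp add: bounded_operators_def apply_g g_scale)
    show "Y u = lift (Blinfun g) u" if "u \<in> carrier" for u
      using that closed[of "j u"] by (simp add: lift_def apply_g g_def)
  qed
qed

lemma self_adjoint_on_lift: "self_adjoint X \<Longrightarrow> copy.self_adjoint_on (lift X)"
  by (simp add: copy.self_adjoint_on_def bounded_op_on_lift self_adjoint_def lift_def ip_def)

lemma spectrum_on_lift: "copy.spectrum_on (lift X) = spectrum X"
proof -
  have eq: "(\<forall>u\<in>carrier. lift Z (copy.diff (lift X u) (scale c u)) = u \<and>
        copy.diff (lift X (lift Z u)) (scale c (lift Z u)) = u) \<longleftrightarrow>
      (X - scaleC_op c id_blinfun) o\<^sub>L Z = id_blinfun \<and>
      Z o\<^sub>L (X - scaleC_op c id_blinfun) = id_blinfun" for Z c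
    unfolding ball_carrier diff_copy
    by (auto simp: lift_def scale_def blinfun_eq_iff minus_blinfun.rep_eq)
  have "(\<exists>Y. copy.bounded_op_on Y \<and> (\<forall>u\<in>carrier. Y (copy.diff (lift X u) (scale c u)) = u \<and>
        copy.diff (lift X (Y u)) (scale c (Y u)) = u)) \<longleftrightarrow> invertible_op (X - scaleC_op c id_blinfun)"
    (is "?L \<longleftrightarrow> ?R") for c
  proof
    assume ?L
    then obtain Y where Y: "copy.bounded_op_on Y"
      and inv: "\<forall>u\<in>carrier. Y (copy.diff (lift X u) (scale c u)) = u \<and>
        copy.diff (lift X (Y u)) (scale c (Y u)) = u" by blast
    obtain Z where Z: "Z \<in> bounded_operators" "\<And>u. u \<in> carrier \<Longrightarrow> Y u = lift Z u"
      using bounded_op_on_is_lift[OF Y] by blast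
    have "\<forall>u\<in>carrier. lift Z (copy.diff (lift X u) (scale c u)) = u \<and>
        copy.diff (lift X (lift Z u)) (scale c (lift Z u)) = u"
      using inv Z(2) by (simp add: diff_copy)
    then show ?R
      using Z(1) unfolding eq invertible_op_def by blast
  next
    assume ?R
    then show ?L
      unfolding invertible_op_def using eq bounded_op_on_lift by blast
  qed
  then show ?thesis
    by (simp add: copy.spectrum_on_def spectrum_def)
qed

lemma poly_on_lift: "copy.poly_on p (lift X) u = \<iota> (poly_op p X (j u))"
proof (induction p)
  case 0
  then show ?case by (simp add: copy.poly_on_def zero_def[symmetric])
next
  case (pCons a p)
  show ?case
  proof (cases "p = 0 \<and> a = 0")
    case True
    then show ?thesis using pCons.IH by simp
  next
    case False
    then have "copy.poly_on (pCons a p) (lift X) u =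
        add (scale (complex_of_real a) u) (lift X (copy.poly_on p (lift X) u))"
      by (cases "p = 0") (simp_all add: copy.poly_on_def fold_coeffs_pCons_not_0_0_eq)
    then show ?thesis
      by (simp add: pCons.IH) (simp add: add_def scale_def lift_def
        scaleC_of_real plus_blinfun.rep_eq scaleR_blinfun.rep_eq)
  qed
qed

lemma cfc_on_lift:
  assumes X: "op_in a b X" and f: "continuous_on {a..b} f"
  shows "copy.cfc_on f (lift X) = restrict (lift (cfc f X)) carrier"
  unfolding copy.cfc_on_def spectrum_on_lift
proof (rule the_equality)
  let ?Y = "restrict (lift (cfc f X)) carrier"
  have "copy.bounded_op_on (lift (cfc f X))"
    by (intro bounded_op_on_lift self_adjoint_bounded cfc_self_adjoint[OF X f])
  then have bounded: "copy.bounded_op_on ?Y"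
    by (simp add: copy.bounded_op_on_def copy.add_closed copy.scale_closed cong: ball_cong)
  have lim: "\<forall>\<^sub>F n in sequentially.
      \<forall>u\<in>carrier. copy.nrm (copy.diff (copy.poly_on (p n) (lift X) u) (?Y u)) \<le> e * copy.nrm u"
    if p: "uniform_limit (real_spectrum X) (\<lambda>n. poly (p n)) f sequentially" and e: "0 < e" for p e
    using tendstoD[OF poly_op_tendsto_cfc_real_spectrum[OF op_in_self_adjoint[OF X] p] e]
  proof eventually_elim
    case (elim n)
    have "norm (poly_op (p n) X x - cfc f X x) \<le> e * norm x" for x
    proof -
      have "norm ((poly_op (p n) X - cfc f X) x) \<le> norm (poly_op (p n) X - cfc f X) * norm x"
        by (rule norm_blinfun)
      also have "\<dots> \<le> e * norm x"
        using elim by (intro mult_right_mono) (auto simp: dist_norm)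
      finally show ?thesis by (simp add: minus_blinfun.rep_eq)
    qed
    then show ?case
      unfolding ball_carrier diff_copy nrm_copy by (simp add: poly_on_lift lift_def)
  qed
  show "?Y \<in> extensional carrier \<and> copy.bounded_op_on ?Y \<and>
      (\<forall>p. uniform_limit (real_spectrum X) (\<lambda>n. poly (p n)) f sequentially \<longrightarrow>
        (\<forall>e>0. \<forall>\<^sub>F n in sequentially.
          \<forall>u\<in>carrier. copy.nrm (copy.diff (copy.poly_on (p n) (lift X) u) (?Y u)) \<le> e * copy.nrm u))"
    using bounded lim by simp
  fix Z
  assume Z: "Z \<in> extensional carrier \<and> copy.bounded_op_on Z \<and>
      (\<forall>p. uniform_limit (real_spectrum X) (\<lambda>n. poly (p n)) f sequentially \<longrightarrow>
        (\<forall>e>0. \<forall>\<^sub>F n in sequentially.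
          \<forall>u\<in>carrier. copy.nrm (copy.diff (copy.poly_on (p n) (lift X) u) (Z u)) \<le> e * copy.nrm u))"
  obtain p where p: "uniform_limit {a..b} (\<lambda>n. poly (p n)) f sequentially"
    using poly_approximation f by metis
  then have p': "uniform_limit (real_spectrum X) (\<lambda>n. poly (p n)) f sequentially"
    using uniform_limit_on_subset real_spectrum_op_in[OF X] by blast
  show "Z = ?Y"
  proof (rule extensionalityI)
    show "Z \<in> extensional carrier" "?Y \<in> extensional carrier" using Z by auto
    fix u assume u: "u \<in> carrier"
    have "(\<lambda>n. poly_op (p n) X (j u)) \<longlonglongrightarrow> j (Z u)"
    proof (rule tendstoI)
      fix e :: real assume e: "0 < e"
      define e' where "e' = e / (norm (j u) + 1)"
      have n: "0 < norm (j u) + 1" by (simp add: add_nonneg_pos)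
      have "0 < e'" using e n by (simp add: e'_def)
      then have "\<forall>\<^sub>F n in sequentially.
          \<forall>u\<in>carrier. copy.nrm (copy.diff (copy.poly_on (p n) (lift X) u) (Z u)) \<le> e' * copy.nrm u"
        using Z p' by blast
      then show "\<forall>\<^sub>F n in sequentially. dist (poly_op (p n) X (j u)) (j (Z u)) < e"
      proof eventually_elim
        case (elim n)
        have "dist (poly_op (p n) X (j u)) (j (Z u)) \<le> e' * norm (j u)"
          using elim[rule_format, OF u] by (simp add: diff_copy nrm_copy poly_on_lift dist_norm)
        also have "\<dots> < e' * (norm (j u) + 1)"
          using \<open>0 < e'\<close> by (intro mult_strict_left_mono) auto
        also have "\<dots> = e" using n by (simp add: e'_def)
        finally show ?case .
      qed
    qed
    moreover have "(\<lambda>n. poly_op (p n) X (j u)) \<longlonglongrightarrow> cfc f X (j u)"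
      by (intro bounded_bilinear.tendsto[OF bounded_bilinear_blinfun_apply] tendsto_const
          poly_op_tendsto_cfc[OF X p])
    ultimately have "j (Z u) = cfc f X (j u)"
      using LIMSEQ_unique by blast
    moreover have "Z u \<in> carrier"
      using Z u by (simp add: copy.bounded_op_on_def)
    ultimately show "Z u = ?Y u"
      using u \<iota>_j[of "Z u"] by (simp add: lift_def)
  qed
qed

lemma convex_comb_lift:
  "copy.convex_comb l (lift X) (lift Y) = lift (l *\<^sub>R X + (1 - l) *\<^sub>R Y)"
  unfolding fun_eq_iff copy.convex_comb_def lift_def add_def scale_def
  by (simp only: j_\<iota> scaleC_of_real plus_blinfun.rep_eq scaleR_blinfun.rep_eq) simp

end

lemma op_in_convex_comb:
  assumes "op_in a b X" "op_in a b Y" "0 \<le> l" "l \<le> 1"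
  shows "op_in a b (l *\<^sub>R X + (1 - l) *\<^sub>R Y)"
proof -
  have "Re (cinner ((l *\<^sub>R X + (1 - l) *\<^sub>R Y) x) x) =
      l * Re (cinner (X x) x) + (1 - l) * Re (cinner (Y x) x)" for x
    by (simp only: plus_blinfun.rep_eq scaleR_blinfun.rep_eq cinner_add_left cinner_scaleR_left)
      simp
  moreover have "l * (a * (norm x)\<^sup>2) + (1 - l) * (a * (norm x)\<^sup>2)
      \<le> l * Re (cinner (X x) x) + (1 - l) * Re (cinner (Y x) x)"
    "l * Re (cinner (X x) x) + (1 - l) * Re (cinner (Y x) x)
      \<le> l * (b * (norm x)\<^sup>2) + (1 - l) * (b * (norm x)\<^sup>2)" for x
    using assms by (intro add_mono mult_left_mono op_in_lower op_in_upper; simp)+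
  moreover have "self_adjoint (l *\<^sub>R X + (1 - l) *\<^sub>R Y)"
    using assms by (intro self_adjoint_add self_adjoint_scaleR op_in_self_adjoint)
  ultimately show ?thesis
    unfolding op_in_def by (simp add: left_diff_distrib)
qed

lemma operator_concave_on_type:
  fixes \<iota> :: "'k::complex_hilbert_space \<Rightarrow> 'u" and X Y :: "'k \<Rightarrow>\<^sub>L 'k"
  assumes "inj \<iota>" and f: "operator_concave_on TYPE('u) J f" and J: "{a..b} \<subseteq> J"
    and X: "op_in a b X" and Y: "op_in a b Y" and l: "0 \<le> l" "l \<le> 1"
  shows "l * Re (cinner (cfc f X x) x) + (1 - l) * Re (cinner (cfc f Y x) x)
    \<le> Re (cinner (cfc f (l *\<^sub>R X + (1 - l) *\<^sub>R Y) x) x)"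
proof -
  interpret hilbert_copy \<iota> by unfold_locales (rule assms(1))
  have cont: "continuous_on {a..b} f"
    using f J by (auto simp: operator_concave_on_def intro: continuous_on_subset)
  have "copy.concave_for_operators J f"
    using f copy_hilbert by (auto simp: operator_concave_on_def)
  moreover have "copy.spectrum_on (lift Z) \<subseteq> complex_of_real ` J" if "op_in a b Z" for Z
    using spectrum_op_in[OF that] J by (auto simp: spectrum_on_lift)
  ultimately have "copy.loewner_le_on
      (copy.convex_comb l (copy.cfc_on f (lift X)) (copy.cfc_on f (lift Y)))
      (copy.cfc_on f (copy.convex_comb l (lift X) (lift Y)))"
    using X Y l unfolding copy.concave_for_operators_def
    by (simp add: self_adjoint_on_lift op_in_self_adjoint)
  then have "Re (ip (copy.convex_comb l (copy.cfc_on f (lift X)) (copy.cfc_on f (lift Y)) (\<iota> x)) (\<iota> x))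
      \<le> Re (ip (copy.cfc_on f (copy.convex_comb l (lift X) (lift Y)) (\<iota> x)) (\<iota> x))"
    unfolding copy.loewner_le_on_def by (elim conjE) (erule bspec, simp)
  then show ?thesis
    unfolding convex_comb_lift cfc_on_lift[OF X cont] cfc_on_lift[OF Y cont]
      cfc_on_lift[OF op_in_convex_comb[OF X Y l] cont] copy.convex_comb_def
    by (simp add: lift_def add_def scale_def ip_def cinner_add_left cinner_scaleC_left)
qed

section \<open>Real powers\<close>

lemma continuous_on_powr_Icc: "0 < a \<Longrightarrow> continuous_on {a..b} (\<lambda>x. x powr r)" for a b r :: real
  by (intro continuous_intros) auto

lemma op_powr_self_adjoint: "op_in a b X \<Longrightarrow> 0 < a \<Longrightarrow> self_adjoint (op_powr X r)"
  unfolding op_powr_def by (erule cfc_self_adjoint) (rule continuous_on_powr_Icc)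

lemma op_powr_add:
  assumes X: "op_in a b X" and a: "0 < a"
  shows "op_powr X r o\<^sub>L op_powr X s = op_powr X (r + s)"
  unfolding op_powr_def cfc_mult[OF X continuous_on_powr_Icc[OF a] continuous_on_powr_Icc[OF a]]
  by (rule cfc_cong[OF X]) (simp add: powr_add)

lemma op_powr_0:
  assumes X: "op_in a b X" and a: "0 < a"
  shows "op_powr X 0 = id_blinfun"
proof -
  have "cfc (\<lambda>x. x powr 0) X = cfc (poly [:1:]) X"
    by (rule cfc_cong[OF X]) (use a in auto)
  also have "\<dots> = id_blinfun"
    by (subst cfc_poly[OF X]) (simp add: blinfun_compose_simps)
  finally show ?thesis by (simp add: op_powr_def)
qed

lemma op_powr_1:
  assumes X: "op_in a b X" and a: "0 < a"
  shows "op_powr X 1 = X"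
proof -
  have "cfc (\<lambda>x. x powr 1) X = cfc (poly [:0, 1:]) X"
    by (rule cfc_cong[OF X]) (use a in auto)
  also have "\<dots> = X"
    by (subst cfc_poly[OF X]) (simp add: blinfun_compose_simps)
  finally show ?thesis by (simp add: op_powr_def)
qed

lemma op_powr_inverse:
  assumes "op_in a b X" "0 < a"
  shows "op_powr X r o\<^sub>L op_powr X (- r) = id_blinfun" "op_powr X (- r) o\<^sub>L op_powr X r = id_blinfun"
  using op_powr_add[OF assms] op_powr_0[OF assms] by simp_all

lemma op_powr_half:
  assumes "op_in a b X" "0 < a"
  shows "op_powr X (1/2) o\<^sub>L op_powr X (1/2) = X"
  using op_powr_add[OF assms, of "1/2" "1/2"] op_powr_1[OF assms] by simp

section \<open>Direct sums\<close>

instantiation prod :: (complex_hilbert_space, complex_hilbert_space) complex_hilbert_space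
begin
definition scaleC_prod :: "complex \<Rightarrow> 'a \<times> 'b \<Rightarrow> 'a \<times> 'b" where
  "scaleC_prod c z = (c *\<^sub>C fst z, c *\<^sub>C snd z)"
definition cinner_prod :: "'a \<times> 'b \<Rightarrow> 'a \<times> 'b \<Rightarrow> complex" where
  "cinner_prod z w = cinner (fst z) (fst w) + cinner (snd z) (snd w)"
instance
proof
  fix x y :: "'a \<times> 'b"
  show "cinner y x = cnj (cinner x y)"
    by (simp add: cinner_prod_def cinner_commute[of "fst y"] cinner_commute[of "snd y"])
  show "norm x = sqrt (Re (cinner x x))"
    by (simp add: cinner_prod_def norm_prod_def Re_cinner_self)
qed (auto simp: scaleC_prod_def cinner_prod_def scaleC_add_right scaleC_add_left scaleC_scaleC
    scaleC_of_real cinner_add_left cinner_scaleC_left algebra_simps prod_eq_iff)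
end

definition pair_op ::
    "('a::real_normed_vector \<Rightarrow>\<^sub>L 'b::real_normed_vector) \<Rightarrow> ('a \<Rightarrow>\<^sub>L 'c::real_normed_vector) \<Rightarrow> 'a \<Rightarrow>\<^sub>L ('b \<times> 'c)"
  where "pair_op C D = Blinfun (\<lambda>x. (C x, D x))"

lemma pair_op_apply [simp]: "pair_op C D x = (C x, D x)"
  unfolding pair_op_def
  by (simp add: bounded_linear_Blinfun_apply bounded_linear_Pair blinfun.bounded_linear_right)

lemma adjoint_pair_pair_op:
  assumes "adjoint_pair C C'" "adjoint_pair D D'"
  shows "adjoint_pair (pair_op C D) ((C' o\<^sub>L fst_blinfun) + (D' o\<^sub>L snd_blinfun))"
  using assms by (simp add: adjoint_pair_def cinner_prod_def plus_blinfun.rep_eq cinner_add_right)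

definition diag_op ::
    "('a::real_normed_vector \<Rightarrow>\<^sub>L 'a) \<Rightarrow> ('b::real_normed_vector \<Rightarrow>\<^sub>L 'b) \<Rightarrow> ('a \<times> 'b) \<Rightarrow>\<^sub>L ('a \<times> 'b)"
  where "diag_op X Y = pair_op (X o\<^sub>L fst_blinfun) (Y o\<^sub>L snd_blinfun)"

lemma op_in_diag_op:
  assumes X: "op_in a b X" and Y: "op_in a b Y"
  shows "op_in a b (diag_op X Y)"
proof -
  have "self_adjoint (diag_op X Y)"
    using X Y by (simp add: self_adjoint_iff adjoint_pair_def op_in_def diag_op_def cinner_prod_def)
  moreover have "a * (norm z)\<^sup>2 \<le> Re (cinner (diag_op X Y z) z)" for z
    using op_in_lower[OF X, of "fst z"] op_in_lower[OF Y, of "snd z"]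
    by (simp add: diag_op_def cinner_prod_def norm_prod_def algebra_simps)
  moreover have "Re (cinner (diag_op X Y z) z) \<le> b * (norm z)\<^sup>2" for z
    using op_in_upper[OF X, of "fst z"] op_in_upper[OF Y, of "snd z"]
    by (simp add: diag_op_def cinner_prod_def norm_prod_def algebra_simps)
  ultimately show ?thesis by (simp add: op_in_def)
qed

lemma cfc_diag_op:
  assumes X: "op_in a b X" and Y: "op_in a b Y" and f: "continuous_on {a..b} f"
  shows "cfc f (diag_op X Y) (x, y) = (cfc f X x, cfc f Y y)"
proof -
  note XY = op_in_diag_op[OF X Y]
  have "pair_op id_blinfun 0 o\<^sub>L cfc f X = cfc f (diag_op X Y) o\<^sub>L pair_op id_blinfun 0"
    by (rule cfc_intertwine[OF X XY f]) (auto intro!: blinfun_eqI simp: diag_op_def)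
  moreover have "pair_op 0 id_blinfun o\<^sub>L cfc f Y = cfc f (diag_op X Y) o\<^sub>L pair_op 0 id_blinfun"
    by (rule cfc_intertwine[OF Y XY f]) (auto intro!: blinfun_eqI simp: diag_op_def)
  ultimately have "cfc f (diag_op X Y) (x, 0) = (cfc f X x, 0)"
    "cfc f (diag_op X Y) (0, y) = (0, cfc f Y y)"
    by (simp_all add: blinfun_eq_iff)
  then show ?thesis
    using blinfun.add_right[of "cfc f (diag_op X Y)" "(x, 0)" "(0, y)"] by simp
qed


section \<open>Jensen's operator inequality\<close>

lemma norm_isometry:
  assumes "adjoint_pair W W'" "W' o\<^sub>L W = id_blinfun"
  shows "(norm (W x))\<^sup>2 = (norm x)\<^sup>2"
proof -
  have "W' (W x) = x" using assms(2) by (simp add: blinfun_eq_iff)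
  then have "cinner (W x) (W x) = cinner x x" by (simp add: adjoint_pairD[OF assms(1)])
  then show ?thesis by (metis Re_cinner_self)
qed

lemma op_in_isometry:
  assumes W: "adjoint_pair W W'" "W' o\<^sub>L W = id_blinfun" and X: "op_in a b X"
  shows "op_in a b (W' o\<^sub>L X o\<^sub>L W)"
proof -
  have "cinner ((W' o\<^sub>L X o\<^sub>L W) x) x = cinner (X (W x)) (W x)" for x
    by (simp add: adjoint_pairD[OF adjoint_pair_sym[OF W(1)]])
  moreover have "self_adjoint (W' o\<^sub>L X o\<^sub>L W)"
    using W X by (intro self_adjoint_sandwich op_in_self_adjoint)
  ultimately show ?thesis
    using op_in_lower[OF X] op_in_upper[OF X] norm_isometry[OF W] unfolding op_in_def by metis
qed

text \<open>Let \<open>W\<close> be the isometry \<open>x \<mapsto> (C x, D x)\<close> into the direct sum, \<open>U = 2 W W\<^sup>* - I\<close> the reflection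
  in its range, and \<open>X = X\<^sub>1 \<oplus> X\<^sub>2\<close>. The mean \<open>Z\<close> of \<open>X\<close> and \<open>U X U\<close> satisfies \<open>Z W = W (W\<^sup>* X W)\<close>,
  so \<open>f(W\<^sup>* X W)\<close> is the compression of \<open>f(Z)\<close>. Concavity bounds \<open>f(Z)\<close> below by the mean of
  \<open>f(X)\<close> and \<open>U f(X) U\<close>, both of which have the compression
  \<open>W\<^sup>* f(X) W = C\<^sup>* f(X\<^sub>1) C + D\<^sup>* f(X\<^sub>2) D\<close>.\<close>

lemma jensen_two:
  fixes C D :: "'h::complex_hilbert_space \<Rightarrow>\<^sub>L 'h"
  assumes f: "operator_concave_on TYPE(nat \<Rightarrow> 'h \<times> complex) J f" and J: "{a..b} \<subseteq> J"
    and C: "adjoint_pair C C'" and D: "adjoint_pair D D'"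
    and unit: "(C' o\<^sub>L C) + (D' o\<^sub>L D) = id_blinfun"
    and X\<^sub>1: "op_in a b X\<^sub>1" and X\<^sub>2: "op_in a b X\<^sub>2"
  defines "Y \<equiv> (C' o\<^sub>L X\<^sub>1 o\<^sub>L C) + (D' o\<^sub>L X\<^sub>2 o\<^sub>L D)"
  shows "op_in a b Y"
    and "Re (cinner (cfc f X\<^sub>1 (C x)) (C x)) + Re (cinner (cfc f X\<^sub>2 (D x)) (D x))
      \<le> Re (cinner (cfc f Y x) x)"
proof -
  have cont: "continuous_on {a..b} f"
    using f J by (auto simp: operator_concave_on_def intro: continuous_on_subset)
  define X where "X = diag_op X\<^sub>1 X\<^sub>2"
  define W where "W = pair_op C D"
  define W' where "W' = (C' o\<^sub>L fst_blinfun) + (D' o\<^sub>L snd_blinfun)"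
  have X: "op_in a b X"
    unfolding X_def by (rule op_in_diag_op[OF X\<^sub>1 X\<^sub>2])
  have W: "adjoint_pair W W'"
    unfolding W_def W'_def by (rule adjoint_pair_pair_op[OF C D])
  have W'W: "W' o\<^sub>L W = id_blinfun"
    unfolding unit[symmetric] by (rule blinfun_eqI) (simp add: W_def W'_def plus_blinfun.rep_eq)
  have Y: "Y = W' o\<^sub>L X o\<^sub>L W"
    by (rule blinfun_eqI) (simp add: Y_def W_def W'_def X_def diag_op_def plus_blinfun.rep_eq)
  show Y_in: "op_in a b Y"
    unfolding Y by (rule op_in_isometry[OF W W'W X])
  have W'W_app: "W' (W v) = v" for v
    using W'W by (simp add: blinfun_eq_iff)
  define U where "U = 2 *\<^sub>R (W o\<^sub>L W') - id_blinfun"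
  have U_app: "U v = 2 *\<^sub>R W (W' v) - v" for v
    by (simp add: U_def minus_blinfun.rep_eq scaleR_blinfun.rep_eq)
  have U: "adjoint_pair U U"
    unfolding U_def by (intro adjoint_pair_diff adjoint_pair_scaleR adjoint_pair_id
        adjoint_pair_compose W adjoint_pair_sym[OF W])
  have UU: "U o\<^sub>L U = id_blinfun"
    by (rule blinfun_eqI)
      (simp add: U_app blinfun.diff_right blinfun.add_right blinfun.scaleR_right W'W_app scaleR_2 algebra_simps)
  have UU_app: "U (U v) = v" for v
    using UU by (simp add: blinfun_eq_iff del: split_paired_All)
  have UW: "U (W v) = W v" for v
    by (simp add: U_app W'W_app scaleR_2)
  have UXU: "op_in a b (U o\<^sub>L X o\<^sub>L U)"
    by (rule op_in_isometry[OF U UU X])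
  define Z where "Z = (1/2) *\<^sub>R X + (1 - 1/2) *\<^sub>R (U o\<^sub>L X o\<^sub>L U)"
  have Z: "op_in a b Z"
    unfolding Z_def by (rule op_in_convex_comb[OF X UXU]) auto
  have "W o\<^sub>L Y = Z o\<^sub>L W"
  proof (rule blinfun_eqI)
    fix v
    have "Z (W v) = (1/2) *\<^sub>R (X (W v) + U (X (W v)))"
      by (simp add: Z_def plus_blinfun.rep_eq scaleR_blinfun.rep_eq UW scaleR_add_right)
    also have "\<dots> = W (W' (X (W v)))"
      by (simp add: U_app)
    finally show "(W o\<^sub>L Y) v = (Z o\<^sub>L W) v"
      by (simp add: Y)
  qed
  from cfc_intertwine[OF Y_in Z cont this]
  have fZ: "W (cfc f Y x) = cfc f Z (W x)"
    by (metis blinfun_apply_blinfun_compose)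
  have "U o\<^sub>L X = (U o\<^sub>L X o\<^sub>L U) o\<^sub>L U"
    by (rule blinfun_eqI) (simp add: UU_app)
  from cfc_intertwine[OF X UXU cont this]
  have "cfc f (U o\<^sub>L X o\<^sub>L U) (U (W x)) = U (cfc f X (W x))"
    by (metis blinfun_apply_blinfun_compose)
  then have fUXU: "cfc f (U o\<^sub>L X o\<^sub>L U) (W x) = U (cfc f X (W x))"
    unfolding UW .
  \<comment> \<open>The direct sum fits into the universe: its elements become sequences, with second components \<open>0\<close>.\<close>
  have "inj (\<lambda>(z :: 'h \<times> 'h) (n::nat). (if n = 0 then fst z else snd z, 0 :: complex))"
    (is "inj ?\<iota>")
  proof (rule injI)
    fix z w assume "?\<iota> z = ?\<iota> w"
    from fun_cong[OF this, of 0] fun_cong[OF this, of 1] show "z = w"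
      by (simp add: prod_eq_iff)
  qed
  from operator_concave_on_type[OF this f J X UXU, of "1/2" "W x"]
  have "1/2 * Re (cinner (cfc f X (W x)) (W x)) + 1/2 * Re (cinner (cfc f (U o\<^sub>L X o\<^sub>L U) (W x)) (W x))
      \<le> Re (cinner (cfc f Z (W x)) (W x))"
    by (simp add: Z_def)
  moreover have "cinner (cfc f (U o\<^sub>L X o\<^sub>L U) (W x)) (W x) = cinner (cfc f X (W x)) (W x)"
    by (simp add: fUXU adjoint_pairD[OF U] UW)
  moreover have "cinner (cfc f Z (W x)) (W x) = cinner (cfc f Y x) x"
    by (simp add: fZ[symmetric] adjoint_pairD[OF W] W'W_app)
  moreover have "cinner (cfc f X (W x)) (W x) =
      cinner (cfc f X\<^sub>1 (C x)) (C x) + cinner (cfc f X\<^sub>2 (D x)) (D x)"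
    by (simp add: X_def W_def cfc_diag_op[OF X\<^sub>1 X\<^sub>2 cont] cinner_prod_def)
  ultimately show "Re (cinner (cfc f X\<^sub>1 (C x)) (C x)) + Re (cinner (cfc f X\<^sub>2 (D x)) (D x))
      \<le> Re (cinner (cfc f Y x) x)"
    by simp
qed

lemma op_in_sum_squares:
  assumes "finite I" "i \<in> I" "\<And>i. i \<in> I \<Longrightarrow> adjoint_pair (C i) (C' i)" "invertible_op (C i)"
  obtains a b where "0 < a" "op_in a b (\<Sum>i\<in>I. C' i o\<^sub>L C i)"
proof -
  let ?L = "\<Sum>i\<in>I. C' i o\<^sub>L C i"
  have sa: "self_adjoint ?L"
    unfolding self_adjoint_iff
    by (intro adjoint_pair_sum adjoint_pair_compose assms(3) adjoint_pair_sym[OF assms(3)])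
  obtain k where k: "0 < k" "\<And>x. k * norm x \<le> norm (C i x)"
    using invertible_op_bounded_below[OF assms(4)] by blast
  have "k\<^sup>2 * (norm x)\<^sup>2 \<le> Re (cinner (?L x) x)" for x
  proof -
    have "k\<^sup>2 * (norm x)\<^sup>2 \<le> (norm (C i x))\<^sup>2"
      using power_mono[OF k(2)[of x], of 2] k(1) by (simp add: power_mult_distrib)
    also have "\<dots> \<le> (\<Sum>i\<in>I. (norm (C i x))\<^sup>2)"
      by (rule member_le_sum) (use assms in auto)
    also have "\<dots> = Re (cinner (?L x) x)"
      unfolding sum_blinfun_apply cinner_sum_left Re_sum
      by (intro sum.cong refl)
        (simp add: adjoint_pairD[OF adjoint_pair_sym[OF assms(3)]] Re_cinner_self)
    finally show ?thesis .
  qed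
  then have "op_in (k\<^sup>2) (norm ?L) ?L"
    using sa op_in_upper[OF self_adjoint_op_in_norm[OF sa]] by (simp add: op_in_def)
  with k(1) that[of "k\<^sup>2"] show thesis by simp
qed

text \<open>The general case follows from two summands: all summands but one are replaced by \<open>E\<^sup>* V E\<close>, where
  \<open>E\<close> is the square root of their total weight. Allowing an invertible \<open>D\<close> in place of
  the identity is what makes the induction go through.\<close>

lemma jensen_finite:
  fixes C :: "'i \<Rightarrow> 'h::complex_hilbert_space \<Rightarrow>\<^sub>L 'h" and D H :: "'h \<Rightarrow>\<^sub>L 'h"
  assumes f: "operator_concave_on TYPE(nat \<Rightarrow> 'h \<times> complex) J f" and J: "{a..b} \<subseteq> J"
    and I: "finite I" "I \<noteq> {}"
    and C: "\<And>i. i \<in> I \<Longrightarrow> adjoint_pair (C i) (C' i)" "\<And>i. i \<in> I \<Longrightarrow> invertible_op (C i)"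
    and X: "\<And>i. i \<in> I \<Longrightarrow> op_in a b (X i)"
    and D: "adjoint_pair D D'" "D o\<^sub>L H = id_blinfun" "H o\<^sub>L D = id_blinfun" "adjoint_pair H H'"
    and unit: "D' o\<^sub>L D = (\<Sum>i\<in>I. C' i o\<^sub>L C i)"
  defines "Y \<equiv> H' o\<^sub>L (\<Sum>i\<in>I. C' i o\<^sub>L X i o\<^sub>L C i) o\<^sub>L H"
  shows "op_in a b Y \<and> (\<forall>x. (\<Sum>i\<in>I. Re (cinner (cfc f (X i) (C i x)) (C i x)))
    \<le> Re (cinner (cfc f Y (D x)) (D x)))"
  using I C X D unit unfolding Y_def
proof (induction I arbitrary: D D' H H' rule: finite_ne_induct)
  case (singleton i)
  have HD: "H (D x) = x" for x
    using singleton.prems(6) by (simp add: blinfun_eq_iff)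
  have DH: "D (H x) = x" for x
    using singleton.prems(5) by (simp add: blinfun_eq_iff)
  have H'D': "H' (D' x) = x" for x
    by (rule cinner_ext)
      (metis DH adjoint_pairD adjoint_pair_sym singleton.prems(4,7))
  have CH: "adjoint_pair (C i o\<^sub>L H) (H' o\<^sub>L C' i)"
    using singleton.prems by (intro adjoint_pair_compose) auto
  have "((H' o\<^sub>L C' i) o\<^sub>L (C i o\<^sub>L H)) + (0 o\<^sub>L (0 :: 'h \<Rightarrow>\<^sub>L 'h)) = H' o\<^sub>L (C' i o\<^sub>L C i) o\<^sub>L H"
    by (simp add: blinfun_compose_assoc)
  also have "\<dots> = H' o\<^sub>L (D' o\<^sub>L D) o\<^sub>L H"
    using singleton.prems(8) by simp
  also have "\<dots> = id_blinfun"
    by (rule blinfun_eqI) (simp add: H'D' DH)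
  finally have u: "((H' o\<^sub>L C' i) o\<^sub>L (C i o\<^sub>L H)) + (0 o\<^sub>L (0 :: 'h \<Rightarrow>\<^sub>L 'h)) = id_blinfun" .
  \<comment> \<open>The second summand has weight \<open>0\<close>; any operator between the same bounds serves there.\<close>
  note Xi = singleton.prems(3)[of i, simplified]
  note jensen = jensen_two[OF f J CH adjoint_pair_zero u Xi Xi]
  have eq: "(H' o\<^sub>L C' i o\<^sub>L X i o\<^sub>L (C i o\<^sub>L H)) + (0 o\<^sub>L X i o\<^sub>L (0 :: 'h \<Rightarrow>\<^sub>L 'h)) =
      H' o\<^sub>L (\<Sum>i\<in>{i}. C' i o\<^sub>L X i o\<^sub>L C i) o\<^sub>L H"
    by (simp add: blinfun_compose_assoc blinfun_compose_simps)
  show ?case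
    using jensen(1) jensen(2)[of "D _"] unfolding eq by (simp add: HD)
next
  case (insert i I)
  have HD: "H (D x) = x" for x
    using insert.prems(6) by (simp add: blinfun_eq_iff)
  have DH: "D (H x) = x" for x
    using insert.prems(5) by (simp add: blinfun_eq_iff)
  have H'D': "H' (D' x) = x" for x
    by (rule cinner_ext)
      (metis DH adjoint_pairD adjoint_pair_sym insert.prems(4,7))
  let ?L = "\<Sum>i\<in>I. C' i o\<^sub>L C i" and ?R = "\<Sum>i\<in>I. C' i o\<^sub>L X i o\<^sub>L C i"
  obtain k where "k \<in> I" using insert.hyps by blast
  then obtain \<alpha> \<beta> where \<alpha>: "0 < \<alpha>" and L: "op_in \<alpha> \<beta> ?L"
    using op_in_sum_squares[of I k C C'] insert.prems(1,2) insert.hyps by blast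
  define E where "E = op_powr ?L (1/2)"
  define G where "G = op_powr ?L (-1/2)"
  have E: "adjoint_pair E E" and G: "adjoint_pair G G"
    unfolding E_def G_def using op_powr_self_adjoint[OF L \<alpha>] by (auto simp: self_adjoint_iff)
  have EG: "E o\<^sub>L G = id_blinfun" and GE: "G o\<^sub>L E = id_blinfun"
    unfolding E_def G_def using op_powr_inverse[OF L \<alpha>, of "1/2"] by auto
  have EE: "E o\<^sub>L E = ?L"
    unfolding E_def by (rule op_powr_half[OF L \<alpha>])
  define V where "V = G o\<^sub>L ?R o\<^sub>L G"
  have IH: "op_in a b V" "(\<Sum>i\<in>I. Re (cinner (cfc f (X i) (C i x)) (C i x)))
      \<le> Re (cinner (cfc f V (E x)) (E x))" for x
    using insert.IH[OF _ _ _ E EG GE G EE] insert.prems(1,2,3) unfolding V_def by auto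
  have EVE: "E o\<^sub>L V o\<^sub>L E = ?R"
  proof (rule blinfun_eqI)
    fix x
    have "E (G v) = v" "G (E v) = v" for v
      using EG GE by (simp_all add: blinfun_eq_iff)
    then show "(E o\<^sub>L V o\<^sub>L E) x = ?R x" by (simp add: V_def)
  qed
  have CH: "adjoint_pair (C i o\<^sub>L H) (H' o\<^sub>L C' i)" and EH: "adjoint_pair (E o\<^sub>L H) (H' o\<^sub>L E)"
    using insert.prems E by (auto intro: adjoint_pair_compose)
  have "((H' o\<^sub>L C' i) o\<^sub>L (C i o\<^sub>L H)) + ((H' o\<^sub>L E) o\<^sub>L (E o\<^sub>L H)) =
      H' o\<^sub>L ((C' i o\<^sub>L C i) + (E o\<^sub>L E)) o\<^sub>L H"
    by (simp add: blinfun_compose_assoc blinfun_compose_simps)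
  also have "\<dots> = H' o\<^sub>L (D' o\<^sub>L D) o\<^sub>L H"
    using insert.prems(8) insert.hyps by (simp add: EE)
  also have "\<dots> = id_blinfun"
    by (rule blinfun_eqI) (simp add: H'D' DH)
  finally have u: "((H' o\<^sub>L C' i) o\<^sub>L (C i o\<^sub>L H)) + ((H' o\<^sub>L E) o\<^sub>L (E o\<^sub>L H)) = id_blinfun" .
  have Xi: "op_in a b (X i)"
    using insert.prems(3) by simp
  note jensen = jensen_two[OF f J CH EH u Xi IH(1)]
  have "(H' o\<^sub>L C' i o\<^sub>L X i o\<^sub>L (C i o\<^sub>L H)) + (H' o\<^sub>L E o\<^sub>L V o\<^sub>L (E o\<^sub>L H)) =
      H' o\<^sub>L ((C' i o\<^sub>L X i o\<^sub>L C i) + (E o\<^sub>L V o\<^sub>L E)) o\<^sub>L H"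
    by (simp add: blinfun_compose_assoc blinfun_compose_simps)
  also have "\<dots> = H' o\<^sub>L (\<Sum>i\<in>insert i I. C' i o\<^sub>L X i o\<^sub>L C i) o\<^sub>L H"
    using insert.hyps by (simp add: EVE)
  finally have eq: "(H' o\<^sub>L C' i o\<^sub>L X i o\<^sub>L (C i o\<^sub>L H)) + (H' o\<^sub>L E o\<^sub>L V o\<^sub>L (E o\<^sub>L H)) =
      H' o\<^sub>L (\<Sum>i\<in>insert i I. C' i o\<^sub>L X i o\<^sub>L C i) o\<^sub>L H" .
  show ?case
  proof (intro conjI allI)
    show "op_in a b (H' o\<^sub>L (\<Sum>i\<in>insert i I. C' i o\<^sub>L X i o\<^sub>L C i) o\<^sub>L H)"
      using jensen(1) unfolding eq .
    fix x
    show "(\<Sum>i\<in>insert i I. Re (cinner (cfc f (X i) (C i x)) (C i x)))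
        \<le> Re (cinner (cfc f (H' o\<^sub>L (\<Sum>i\<in>insert i I. C' i o\<^sub>L X i o\<^sub>L C i) o\<^sub>L H) (D x)) (D x))"
      using jensen(2)[of "D x"] IH(2)[of x] insert.hyps unfolding eq by (simp add: HD)
  qed
qed

section \<open>Integrals of continuous fields\<close>

text \<open>A continuous field with integrable norm is approximated by finitely many of its values, with the
  same points and weights for all functionals. Up to small mass for the norm of the field, it
  lives on a compact set, where it is close to a function with finitely many values. A functional
  enters only through the composite \<open>\<psi>\<close>, whose size and oscillation are bounded by those of the
  field; this covers functionals that are linear on a subalgebra only.\<close>

lemma radon_finite_approximation:
  fixes \<mu> :: "'t::t2_space measure" and F :: "'t \<Rightarrow> 'e::real_normed_vector"
  assumes \<mu>: "radon_measure \<mu>" and F: "continuous_on UNIV F" "integrable \<mu> (\<lambda>t. norm (F t))"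
    and \<epsilon>: "0 < \<epsilon>"
  obtains I :: "nat set" and w :: "nat \<Rightarrow> real" and s :: "nat \<Rightarrow> 't"
  where "finite I" "\<And>i. i \<in> I \<Longrightarrow> 0 < w i"
    "\<And>K \<psi> :: 't \<Rightarrow> complex. \<lbrakk>0 \<le> K; \<And>t. cmod (\<psi> t) \<le> K * norm (F t);
        \<And>t u. cmod (\<psi> t - \<psi> u) \<le> K * norm (F t - F u)\<rbrakk>
      \<Longrightarrow> integrable \<mu> \<psi> \<and> cmod ((\<Sum>i\<in>I. w i *\<^sub>R \<psi> (s i)) - (\<integral>t. \<psi> t \<partial>\<mu>)) \<le> K * \<epsilon>"
proof -
  have sets: "sets \<mu> = sets borel" using \<mu> by (simp add: radon_measure_def)
  then have space: "space \<mu> = UNIV" using sets_eq_imp_space_eq by fastforce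
  have meas: "h \<in> borel_measurable \<mu>" if "continuous_on UNIV h" for h :: "'t \<Rightarrow> 'b::topological_space"
    using borel_measurable_continuous_onI[OF that] measurable_cong_sets[OF sets refl] by blast
  define g where "g t = norm (F t)" for t
  have g: "continuous_on UNIV g" "integrable \<mu> g" "\<And>t. 0 \<le> g t"
    using F by (auto simp: g_def[abs_def] intro: continuous_intros)
  note gm [measurable] = meas[OF g(1)]
  \<comment> \<open>The lower bound gives \<open>U n\<close> finite measure; the upper bound makes small sets carry small mass.\<close>
  define U where "U n = {t. 1 / real (Suc n) < g t \<and> g t < real (Suc n)}" for n
  have Uopen: "open (U n)" for n
    unfolding U_def using g(1)
    by (intro open_Collect_conj open_Collect_less continuous_intros) auto
  then have Usets [measurable]: "U n \<in> sets \<mu>" for n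
    by (simp add: sets)
  have "(\<lambda>n. \<integral>t. g t * indicator (- U n) t \<partial>\<mu>) \<longlonglongrightarrow> (\<integral>t. 0 \<partial>\<mu>)"
  proof (rule integral_dominated_convergence[where w = g])
    show "AE t in \<mu>. (\<lambda>n. g t * indicator (- U n) t) \<longlonglongrightarrow> 0"
    proof (rule AE_I2)
      fix t
      show "(\<lambda>n. g t * indicator (- U n) t) \<longlonglongrightarrow> 0"
      proof (cases "g t = 0")
        case False
        then have "0 < g t" using g(3)[of t] by simp
        obtain N where N: "g t < real N" "1 / g t < real N"
          using reals_Archimedean2[of "max (g t) (1 / g t)"] by auto
        have "t \<in> U n" if "N \<le> n" for n
        proof -
          have "real N < real (Suc n)" using that by simp
          then have "g t < real (Suc n)" "1 / g t < real (Suc n)" using N by linarith+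
          then show ?thesis
            using \<open>0 < g t\<close> by (simp add: U_def field_simps del: of_nat_Suc)
        qed
        then have "\<forall>\<^sub>F n in sequentially. g t * indicator (- U n) t = 0"
          unfolding eventually_sequentially by (intro exI[of _ N]) auto
        then show ?thesis by (rule tendsto_eventually)
      qed simp
    qed
    show "AE t in \<mu>. norm (g t * indicator (- U n) t) \<le> g t" for n
      using g(3) by (auto simp: indicator_def)
  qed (use g in auto)
  then have "\<forall>\<^sub>F n in sequentially. (\<integral>t. g t * indicator (- U n) t \<partial>\<mu>) < \<epsilon> / 3"
    using \<epsilon> by (intro order_tendstoD(2)) auto
  then obtain n where n: "(\<integral>t. g t * indicator (- U n) t \<partial>\<mu>) < \<epsilon> / 3"
    unfolding eventually_sequentially by blast
  define c where "c = real (Suc n)"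
  have c: "0 < c" by (simp add: c_def)
  have Uc: "1 / c < g t" "g t < c" if "t \<in> U n" for t
    using that by (auto simp: U_def c_def)
  have "integrable \<mu> (indicator (U n) :: 't \<Rightarrow> real)"
  proof (rule Bochner_Integration.integrable_bound[where f = "\<lambda>t. c * g t"])
    show "AE t in \<mu>. norm (indicator (U n) t :: real) \<le> norm (c * g t)"
    proof (rule AE_I2)
      fix t
      show "norm (indicator (U n) t :: real) \<le> norm (c * g t)"
        using Uc(1)[of t] c g(3)[of t] by (auto simp: indicator_def field_simps)
    qed
  qed (use g in auto)
  then have Ufin: "emeasure \<mu> (U n) < \<infinity>"
    by (simp add: integrable_indicator_iff space)
  have Umeas: "emeasure \<mu> (U n) = ennreal (measure \<mu> (U n))"
    using Ufin by (simp add: emeasure_eq_ennreal_measure)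
  have "\<exists>C. compact C \<and> C \<subseteq> U n \<and> measure \<mu> (U n) - \<epsilon> / (3 * c) < measure \<mu> C"
  proof (rule ccontr)
    assume no: "\<not> ?thesis"
    have "emeasure \<mu> C \<le> ennreal (measure \<mu> (U n) - \<epsilon> / (3 * c))" if "compact C" "C \<subseteq> U n" for C
    proof -
      have "emeasure \<mu> C = ennreal (measure \<mu> C)"
        using emeasure_mono[OF that(2) Usets] Ufin
        by (intro emeasure_eq_ennreal_measure) (auto simp: top_unique)
      then show ?thesis using no that by (auto intro!: ennreal_leI)
    qed
    then have "(SUP C\<in>{C. compact C \<and> C \<subseteq> U n}. emeasure \<mu> C)
        \<le> ennreal (measure \<mu> (U n) - \<epsilon> / (3 * c))"
      by (intro SUP_least) auto
    moreover have "emeasure \<mu> (U n) = (SUP C\<in>{C. compact C \<and> C \<subseteq> U n}. emeasure \<mu> C)"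
      using \<mu> Uopen[of n] unfolding radon_measure_def by blast
    ultimately have "ennreal (measure \<mu> (U n)) \<le> ennreal (measure \<mu> (U n) - \<epsilon> / (3 * c))"
      using Umeas by simp
    moreover have "0 \<le> measure \<mu> (U n) - \<epsilon> / (3 * c)"
    proof -
      have "\<not> measure \<mu> (U n) - \<epsilon> / (3 * c) < measure \<mu> {}"
        using no compact_empty by blast
      then show ?thesis by simp
    qed
    ultimately have "measure \<mu> (U n) \<le> measure \<mu> (U n) - \<epsilon> / (3 * c)"
      by (simp add: ennreal_le_iff)
    moreover have "0 < \<epsilon> / (3 * c)" using \<epsilon> c by simp
    ultimately show False by linarith
  qed
  then obtain C where C: "compact C" "C \<subseteq> U n" "measure \<mu> (U n) - \<epsilon> / (3 * c) < measure \<mu> C"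
    by blast
  have Csets [measurable]: "C \<in> sets \<mu>"
    using C(1) by (simp add: sets borel_closed compact_imp_closed)
  have Cfin: "emeasure \<mu> C < \<infinity>"
    using emeasure_mono[OF C(2) Usets] Ufin by (simp add: order_le_less_trans)
  have UC: "measure \<mu> (U n - C) \<le> \<epsilon> / (3 * c)"
    using measure_Diff[of \<mu> "U n" C] Ufin C by simp
  define \<eta> where "\<eta> = (\<epsilon> / 3) / (measure \<mu> C + 1)"
  have k: "0 < measure \<mu> C + 1" by (simp add: add_nonneg_pos)
  then have \<eta>: "0 < \<eta>" using \<epsilon> by (simp add: \<eta>_def)
  have "\<eta> * measure \<mu> C \<le> \<eta> * (measure \<mu> C + 1)"
    using \<eta> by (intro mult_left_mono) auto
  also have "\<dots> = \<epsilon> / 3"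
    using k unfolding \<eta>_def by (metis less_irrefl nonzero_eq_divide_eq)
  finally have \<eta>C: "\<eta> * measure \<mu> C \<le> \<epsilon> / 3" .
  define N where "N u = {t. norm (F t - F u) < \<eta>}" for u
  have Nopen: "open (N u)" for u
    unfolding N_def using F(1) by (intro open_Collect_less continuous_intros) auto
  have "C \<subseteq> (\<Union>u\<in>C. N u)"
    using \<eta> by (auto simp: N_def)
  then obtain T where T: "T \<subseteq> C" "finite T" "C \<subseteq> (\<Union>u\<in>T. N u)"
    using compactE_image[OF C(1), of C N] Nopen by blast
  obtain s where s: "bij_betw s {0..<card T} T"
    using ex_bij_betw_nat_finite[OF T(2)] by blast
  define m where "m = card T"
  define A where "A i = C \<inter> N (s i)" for i :: nat
  define E where "E = disjointed A"
  have Asets: "A i \<in> sets \<mu>" for i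
    unfolding A_def using Nopen[of "s i"] Csets by (auto simp: sets)
  have Esets [measurable]: "E i \<in> sets \<mu>" for i
    using sets.range_disjointed_sets[of A \<mu>] Asets by (auto simp: E_def)
  have "T = s ` {0..<m}"
    using s by (simp add: bij_betw_def m_def)
  then have "(\<Union>i\<in>{0..<m}. A i) = C \<inter> (\<Union>u\<in>T. N u)"
    by (simp add: A_def)
  also have "\<dots> = C"
    using T(3) by (rule inf.absorb1)
  finally have "(\<Union>i\<in>{0..<m}. A i) = C" .
  then have Eun: "(\<Union>i\<in>{0..<m}. E i) = C"
    unfolding E_def by (simp add: finite_UN_disjointed_eq)
  have Edisj: "i = k" if "t \<in> E i" "t \<in> E k" for i k t
    using disjoint_family_disjointed[of A] that unfolding disjoint_family_on_def E_def by blast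
  have EN: "E i \<subseteq> N (s i)" for i
    using disjointed_subset[of A i] by (auto simp: E_def A_def)
  have Efin: "emeasure \<mu> (E i) < \<infinity>" for i
  proof -
    have "E i \<subseteq> C" using disjointed_subset[of A i] by (auto simp: E_def A_def)
    from emeasure_mono[OF this Csets] Cfin show ?thesis by (simp add: order_le_less_trans)
  qed
  define w where "w i = measure \<mu> (E i)" for i
  define I where "I = {i. i < m \<and> 0 < w i}"
  show thesis
  proof (rule that)
    show "finite I" "\<And>i. i \<in> I \<Longrightarrow> 0 < w i" by (auto simp: I_def)
    fix K :: real and \<psi> :: "'t \<Rightarrow> complex"
    assume K: "0 \<le> K" and \<psi>: "\<And>t. cmod (\<psi> t) \<le> K * norm (F t)"
      "\<And>t u. cmod (\<psi> t - \<psi> u) \<le> K * norm (F t - F u)"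
    have "continuous_on UNIV \<psi>"
      unfolding continuous_on_def
    proof
      fix t :: 't
      have "((\<lambda>u. K * norm (F u - F t)) \<longlongrightarrow> K * norm (F t - F t)) (at t)"
        using F(1) unfolding continuous_on_def by (intro tendsto_intros) auto
      then have "((\<lambda>u. K * norm (F u - F t)) \<longlongrightarrow> 0) (at t)" by simp
      then have "((\<lambda>u. \<psi> u - \<psi> t) \<longlongrightarrow> 0) (at t)"
        by (rule Lim_null_comparison[rotated]) (simp add: \<psi>(2))
      then show "(\<psi> \<longlongrightarrow> \<psi> t) (at t within UNIV)" by (simp add: LIM_zero_iff)
    qed
    note [measurable] = meas[OF this]
    have int: "integrable \<mu> \<psi>"
    proof (rule Bochner_Integration.integrable_bound[where f = "\<lambda>t. K * g t"])
      show "AE t in \<mu>. norm (\<psi> t) \<le> norm (K * g t)"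
        using \<psi>(1) K by (simp add: g_def)
    qed (use g in auto)
    define \<phi> where "\<phi> t = (\<Sum>i\<in>{0..<m}. indicator (E i) t *\<^sub>R \<psi> (s i))" for t
    have ind: "integrable \<mu> (indicator (E i) :: 't \<Rightarrow> real)" for i
      using Efin[of i] by (simp add: integrable_indicator_iff space)
    have \<phi>_int: "integrable \<mu> \<phi>"
      unfolding \<phi>_def by (intro Bochner_Integration.integrable_sum integrable_scaleR_left ind)
    have "(\<integral>t. \<phi> t \<partial>\<mu>) = (\<Sum>i\<in>{0..<m}. w i *\<^sub>R \<psi> (s i))"
      unfolding \<phi>_def
      by (subst Bochner_Integration.integral_sum)
        (auto intro!: integrable_scaleR_left ind sum.cong simp: w_def space integral_scaleR_left[OF ind])
    also have "\<dots> = (\<Sum>i\<in>I. w i *\<^sub>R \<psi> (s i))"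
      by (rule sum.mono_neutral_right) (auto simp: I_def w_def zero_less_measure_iff)
    finally have sum: "(\<integral>t. \<phi> t \<partial>\<mu>) = (\<Sum>i\<in>I. w i *\<^sub>R \<psi> (s i))" .
    define h where "h t = K * (g t * indicator (- U n) t + c * indicator (U n - C) t + \<eta> * indicator C t)" for t
    have h_int: "integrable \<mu> h"
      "(\<integral>t. h t \<partial>\<mu>) = K * ((\<integral>t. g t * indicator (- U n) t \<partial>\<mu>) + c * measure \<mu> (U n - C) + \<eta> * measure \<mu> C)"
    proof -
      have 1: "integrable \<mu> (\<lambda>t. g t * indicator (- U n) t)"
        by (rule Bochner_Integration.integrable_bound[OF g(2)]) (auto simp: indicator_def)
      have 2: "integrable \<mu> (\<lambda>t. c * indicator (U n - C) t)"
        using emeasure_mono[of "U n - C" "U n" \<mu>] Ufin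
        by (auto simp: integrable_indicator_iff space intro: order_le_less_trans)
      have 3: "integrable \<mu> (\<lambda>t. \<eta> * indicator C t)"
        using Cfin by (auto simp: integrable_indicator_iff space)
      show "integrable \<mu> h"
        unfolding h_def by (intro integrable_mult_right Bochner_Integration.integrable_add 1 2 3)
      show "(\<integral>t. h t \<partial>\<mu>) = K * ((\<integral>t. g t * indicator (- U n) t \<partial>\<mu>) + c * measure \<mu> (U n - C) + \<eta> * measure \<mu> C)"
        unfolding h_def integral_mult_right_zero
          Bochner_Integration.integral_add[OF Bochner_Integration.integrable_add[OF 1 2] 3]
          Bochner_Integration.integral_add[OF 1 2]
        by (simp add: space)
    qed
    have bound: "cmod (\<phi> t - \<psi> t) \<le> h t" for t
    proof (cases "t \<in> C")
      case True
      then obtain i where i: "i < m" "t \<in> E i" using Eun by auto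
      have other: "t \<notin> E k" if "k \<noteq> i" for k
        using Edisj[OF i(2), of k] that by blast
      have "\<phi> t = (\<Sum>k\<in>{i}. indicator (E k) t *\<^sub>R \<psi> (s k))"
        unfolding \<phi>_def using i(1) other
        by (intro sum.mono_neutral_right) auto
      then have "cmod (\<phi> t - \<psi> t) \<le> K * norm (F (s i) - F t)"
        using i \<psi>(2)[of "s i" t] by simp
      also have "\<dots> \<le> K * \<eta>"
        using EN[of i] i(2) K by (intro mult_left_mono) (auto simp: N_def norm_minus_commute)
      also have "\<dots> = h t" using True C(2) by (auto simp: h_def)
      finally show ?thesis .
    next
      case False
      then have "\<phi> t = 0" unfolding \<phi>_def using Eun by (auto simp: indicator_def intro!: sum.neutral)
      then have "cmod (\<phi> t - \<psi> t) \<le> K * g t" using \<psi>(1)[of t] by (simp add: g_def)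
      also have "\<dots> \<le> h t"
        using False K Uc(2)[of t] by (auto simp: h_def indicator_def intro!: mult_left_mono)
      finally show ?thesis .
    qed
    have "(\<Sum>i\<in>I. w i *\<^sub>R \<psi> (s i)) - (\<integral>t. \<psi> t \<partial>\<mu>) = (\<integral>t. \<phi> t - \<psi> t \<partial>\<mu>)"
      using \<phi>_int int by (simp add: sum)
    also have "cmod \<dots> \<le> (\<integral>t. cmod (\<phi> t - \<psi> t) \<partial>\<mu>)"
      by (rule integral_norm_bound)
    also have "\<dots> \<le> (\<integral>t. h t \<partial>\<mu>)"
      using \<phi>_int int h_int(1) bound by (intro integral_mono) auto
    also have "\<dots> \<le> K * (\<epsilon> / 3 + \<epsilon> / 3 + \<epsilon> / 3)"
      unfolding h_int(2)
    proof (intro mult_left_mono add_mono K)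
      show "c * measure \<mu> (U n - C) \<le> \<epsilon> / 3"
        using mult_left_mono[OF UC, of c] c by simp
    qed (use n \<eta>C in auto)
    finally show "integrable \<mu> \<psi> \<and> cmod ((\<Sum>i\<in>I. w i *\<^sub>R \<psi> (s i)) - (\<integral>t. \<psi> t \<partial>\<mu>)) \<le> K * \<epsilon>"
      using int by simp
  qed
qed

lemma cstar_algebra_scaleR: "cstar_algebra \<A> \<Longrightarrow> X \<in> \<A> \<Longrightarrow> r *\<^sub>R X \<in> \<A>"
  unfolding cstar_algebra_def by (metis scaleC_op_of_real)

lemma cstar_algebra_add: "cstar_algebra \<A> \<Longrightarrow> X \<in> \<A> \<Longrightarrow> Y \<in> \<A> \<Longrightarrow> X + Y \<in> \<A>"
  by (simp add: cstar_algebra_def)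

lemma cstar_algebra_compose: "cstar_algebra \<A> \<Longrightarrow> X \<in> \<A> \<Longrightarrow> Y \<in> \<A> \<Longrightarrow> X o\<^sub>L Y \<in> \<A>"
  by (simp add: cstar_algebra_def)

lemma cstar_algebra_zero: "cstar_algebra \<A> \<Longrightarrow> 0 \<in> \<A>"
  by (simp add: cstar_algebra_def)

lemma cstar_algebra_sum:
  "cstar_algebra \<A> \<Longrightarrow> (\<And>i. i \<in> I \<Longrightarrow> X i \<in> \<A>) \<Longrightarrow> (\<Sum>i\<in>I. w i *\<^sub>R X i) \<in> \<A>"
  by (induction I rule: infinite_finite_induct)
    (auto intro!: cstar_algebra_zero cstar_algebra_add cstar_algebra_scaleR)

lemma cstar_algebra_cfc:
  assumes "cstar_algebra \<A>" "id_blinfun \<in> \<A>" "X \<in> \<A>" "op_in a b X" "continuous_on {a..b} f"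
  shows "cfc f X \<in> \<A>"
proof (rule cfc_in_closed[OF assms(4,5)])
  show "closed \<A>" using assms(1) by (simp add: cstar_algebra_def)
  show "poly_op p X \<in> \<A>" for p
    by (induction p)
      (auto intro!: cstar_algebra_zero cstar_algebra_add cstar_algebra_scaleR cstar_algebra_compose assms)
qed

lemma dual_diff:
  assumes "cstar_algebra \<A>" "\<phi> \<in> dual \<A>" "X \<in> \<A>" "Y \<in> \<A>"
  shows "\<phi> (X - Y) = \<phi> X - \<phi> Y"
proof -
  have "X - Y \<in> \<A>"
    using cstar_algebra_add[OF assms(1,3) cstar_algebra_scaleR[OF assms(1,4), of "-1"]] by simp
  then have "\<phi> ((X - Y) + Y) = \<phi> (X - Y) + \<phi> Y"
    using assms(2,4) unfolding dual_def by blast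
  then show ?thesis by simp
qed

lemma dual_sum:
  assumes "cstar_algebra \<A>" "\<phi> \<in> dual \<A>" "\<And>i. i \<in> I \<Longrightarrow> X i \<in> \<A>"
  shows "\<phi> (\<Sum>i\<in>I. w i *\<^sub>R X i) = (\<Sum>i\<in>I. w i *\<^sub>R \<phi> (X i))"
proof -
  have scale: "\<phi> (r *\<^sub>R X) = r *\<^sub>R \<phi> X" if "X \<in> \<A>" for r X
    using assms(2) that unfolding dual_def
    by (simp add: scaleC_op_of_real[symmetric] scaleR_conv_of_real)
  have zero: "\<phi> 0 = 0"
    using scale[OF cstar_algebra_zero[OF assms(1)], of 0] by simp
  have add: "\<phi> (X + Y) = \<phi> X + \<phi> Y" if "X \<in> \<A>" "Y \<in> \<A>" for X Y
    using assms(2) that by (simp add: dual_def)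
  show ?thesis using assms(3)
    by (induction I rule: infinite_finite_induct)
      (auto simp: zero add scale cstar_algebra_sum[OF assms(1)] cstar_algebra_scaleR[OF assms(1)])
qed

lemma cinner_blinfun_le:
  fixes X :: "'h::complex_hilbert_space \<Rightarrow>\<^sub>L 'h"
  shows "cmod (cinner (X x) y) \<le> (norm x * norm y) * norm X"
  using order_trans[OF cinner_Cauchy_Schwarz[of "X x" y] mult_right_mono[OF norm_blinfun[of X x]]]
  by (simp add: mult_ac)

lemma cinner_in_dual: "(\<lambda>X. cinner (blinfun_apply X x) y) \<in> dual \<A>"
  unfolding dual_def
  by (auto simp: plus_blinfun.rep_eq cinner_add_left cinner_scaleC_left
      intro!: exI[of _ "norm x * norm y"] cinner_blinfun_le)

lemma norm_blinfun_le_cinner: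
  assumes "0 \<le> e" "\<And>x y. cmod (cinner (blinfun_apply X x) y) \<le> (norm x * norm y) * e"
  shows "norm X \<le> e"
proof (rule norm_blinfun_bound[OF assms(1)])
  fix x
  have "(norm (X x))\<^sup>2 \<le> e * norm x * norm (X x)"
    using assms(2)[of x "X x"] by (simp add: cinner_self norm_power mult_ac)
  then show "norm (X x) \<le> e * norm x"
    using assms(1) by (cases "X x = 0") (auto simp: power2_eq_square)
qed

text \<open>The finite approximations form a Cauchy sequence, since the norm of an operator is determined by the
  functionals \<open>X \<mapsto> \<langle>X x, y\<rangle>\<close>. Their limit lies in the closed algebra and has the right value under
  every functional; it is unique because the same functionals separate operators.\<close>

lemma op_integral_has_bochner_integral:
  fixes F :: "'b::t2_space \<Rightarrow> 'h::complex_hilbert_space \<Rightarrow>\<^sub>L 'h"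
  assumes \<mu>: "radon_measure \<mu>" and \<A>: "cstar_algebra \<A>" and F: "continuous_field \<A> \<mu> F"
  shows "op_integral \<A> \<mu> F \<in> \<A>"
    and "\<phi> \<in> dual \<A> \<Longrightarrow> has_bochner_integral \<mu> (\<lambda>t. \<phi> (F t)) (\<phi> (op_integral \<A> \<mu> F))"
proof -
  have FA: "F t \<in> \<A>" for t using F by (simp add: continuous_field_def)
  have Fc: "continuous_on UNIV F" "integrable \<mu> (\<lambda>t. norm (F t))"
    using F by (auto simp: continuous_field_def)
  define approx where "approx n X \<longleftrightarrow> X \<in> \<A> \<and> (\<forall>\<phi>\<in>dual \<A>. \<forall>K\<ge>0. (\<forall>X\<in>\<A>. cmod (\<phi> X) \<le> K * norm X) \<longrightarrow>
      integrable \<mu> (\<lambda>t. \<phi> (F t)) \<and>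
      cmod (\<phi> X - (\<integral>t. \<phi> (F t) \<partial>\<mu>)) \<le> K * (1 / real (Suc n)))" for n X
  have "\<exists>X. approx n X" for n
  proof -
    have "0 < 1 / real (Suc n)" by simp
    then show ?thesis
    proof (rule radon_finite_approximation[OF \<mu> Fc])
      fix I :: "nat set" and w :: "nat \<Rightarrow> real" and s :: "nat \<Rightarrow> 'b"
      assume finite_approx: "\<And>K \<psi> :: _ \<Rightarrow> complex. \<lbrakk>0 \<le> K; \<And>t. cmod (\<psi> t) \<le> K * norm (F t);
        \<And>t u. cmod (\<psi> t - \<psi> u) \<le> K * norm (F t - F u)\<rbrakk>
      \<Longrightarrow> integrable \<mu> \<psi> \<and>
        cmod ((\<Sum>i\<in>I. w i *\<^sub>R \<psi> (s i)) - (\<integral>t. \<psi> t \<partial>\<mu>)) \<le> K * (1 / real (Suc n))"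
      have "approx n (\<Sum>i\<in>I. w i *\<^sub>R F (s i))"
        unfolding approx_def
      proof (intro conjI[OF cstar_algebra_sum[OF \<A> FA]] ballI allI impI)
        fix \<phi> K assume \<phi>: "\<phi> \<in> dual \<A>" "0 \<le> K" "\<forall>X\<in>\<A>. cmod (\<phi> X) \<le> K * norm X"
        have "F t - F u \<in> \<A>" for t u
          using cstar_algebra_add[OF \<A> FA[of t] cstar_algebra_scaleR[OF \<A> FA[of u], of "-1"]] by simp
        then have "cmod (\<phi> (F t) - \<phi> (F u)) \<le> K * norm (F t - F u)" for t u
          using \<phi>(3) dual_diff[OF \<A> \<phi>(1) FA FA] by metis
        then show "integrable \<mu> (\<lambda>t. \<phi> (F t)) \<and>
            cmod (\<phi> (\<Sum>i\<in>I. w i *\<^sub>R F (s i)) - (\<integral>t. \<phi> (F t) \<partial>\<mu>)) \<le> K * (1 / real (Suc n))"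
          unfolding dual_sum[OF \<A> \<phi>(1) FA] using \<phi> FA by (intro finite_approx) auto
      qed
      then show ?thesis ..
    qed
  qed
  then obtain X where X_approx: "\<And>n. approx n (X n)" by metis
  have XA: "X n \<in> \<A>" for n
    using X_approx unfolding approx_def by blast
  have X: "integrable \<mu> (\<lambda>t. \<phi> (F t))"
      "cmod (\<phi> (X n) - (\<integral>t. \<phi> (F t) \<partial>\<mu>)) \<le> K * (1 / real (Suc n))"
    if "\<phi> \<in> dual \<A>" "0 \<le> K" "\<forall>X\<in>\<A>. cmod (\<phi> X) \<le> K * norm X" for \<phi> K n
    using X_approx[of n] that unfolding approx_def by blast+
  have XX: "norm (X n - X k) \<le> 1 / real (Suc n) + 1 / real (Suc k)" for n k
  proof (rule norm_blinfun_le_cinner)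
    fix x y
    have *: "cmod (cinner (X i x) y - (\<integral>t. cinner (F t x) y \<partial>\<mu>)) \<le> (norm x * norm y) * (1 / real (Suc i))" for i
      by (rule X(2)[OF cinner_in_dual]) (auto intro: cinner_blinfun_le)
    have "cinner ((X n - X k) x) y = (cinner (X n x) y - (\<integral>t. cinner (F t x) y \<partial>\<mu>))
        - (cinner (X k x) y - (\<integral>t. cinner (F t x) y \<partial>\<mu>))"
      by (simp add: minus_blinfun.rep_eq cinner_diff_left)
    also have "cmod \<dots> \<le> (norm x * norm y) * (1 / real (Suc n)) + (norm x * norm y) * (1 / real (Suc k))"
      by (rule order_trans[OF norm_triangle_ineq4 add_mono[OF * *]])
    finally show "cmod (cinner ((X n - X k) x) y) \<le> (norm x * norm y) * (1 / real (Suc n) + 1 / real (Suc k))"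
      by (simp add: distrib_left)
  qed simp
  have null: "(\<lambda>n. 1 / real (Suc n)) \<longlonglongrightarrow> 0"
    using LIMSEQ_inverse_real_of_nat by (simp add: inverse_eq_divide)
  have "Cauchy X"
  proof (rule CauchyI)
    fix e :: real assume "0 < e"
    then obtain N where N: "\<And>n. N \<le> n \<Longrightarrow> 1 / real (Suc n) < e / 2"
      using order_tendstoD(2)[OF null, of "e / 2"] by (auto simp: eventually_sequentially)
    have "norm (X n - X k) < e" if "N \<le> n" "N \<le> k" for n k
      using XX[of n k] N[OF that(1)] N[OF that(2)] by linarith
    then show "\<exists>N. \<forall>n\<ge>N. \<forall>k\<ge>N. norm (X n - X k) < e" by blast
  qed
  then obtain Y where Y: "X \<longlonglongrightarrow> Y"
    using Cauchy_convergent convergent_def by blast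
  have YA: "Y \<in> \<A>"
    using closed_sequentially[of \<A> X Y] XA Y \<A> by (simp add: cstar_algebra_def)
  have int: "has_bochner_integral \<mu> (\<lambda>t. \<phi> (F t)) (\<phi> Y)" if \<phi>: "\<phi> \<in> dual \<A>" for \<phi>
  proof -
    obtain K0 where K0: "\<forall>X\<in>\<A>. cmod (\<phi> X) \<le> K0 * norm X"
      using \<phi> by (auto simp: dual_def)
    define K where "K = max K0 0"
    have K: "0 \<le> K" "\<forall>X\<in>\<A>. cmod (\<phi> X) \<le> K * norm X"
      using K0 by (auto simp: K_def intro: order_trans[OF _ mult_right_mono[of K0 "max K0 0"]])
    have "(\<lambda>n. K * (1 / real (Suc n))) \<longlonglongrightarrow> 0"
      using tendsto_mult_right_zero[OF null] by simp
    then have lim: "(\<lambda>n. \<phi> (X n) - (\<integral>t. \<phi> (F t) \<partial>\<mu>)) \<longlonglongrightarrow> 0"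
      by (rule Lim_null_comparison[rotated]) (use X(2)[OF \<phi> K] in auto)
    have "(\<lambda>n. \<phi> (X n) - \<phi> Y) \<longlonglongrightarrow> 0"
    proof (rule Lim_null_comparison)
      show "\<forall>\<^sub>F n in sequentially. cmod (\<phi> (X n) - \<phi> Y) \<le> K * norm (X n - Y)"
      proof (rule always_eventually, rule allI)
        fix n
        have "X n - Y \<in> \<A>"
          using cstar_algebra_add[OF \<A> XA cstar_algebra_scaleR[OF \<A> YA, of "-1"]] by simp
        then show "cmod (\<phi> (X n) - \<phi> Y) \<le> K * norm (X n - Y)"
          using K dual_diff[OF \<A> \<phi> XA YA] by metis
      qed
      show "(\<lambda>n. K * norm (X n - Y)) \<longlonglongrightarrow> 0"
        using Y by (intro tendsto_mult_right_zero tendsto_norm_zero) (simp add: LIM_zero_iff)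
    qed
    then have "\<phi> Y = (\<integral>t. \<phi> (F t) \<partial>\<mu>)"
      using LIMSEQ_unique[OF LIM_zero_cancel LIM_zero_cancel[OF lim]] by blast
    then show ?thesis
      using X(1)[OF \<phi> K] by (simp add: has_bochner_integral_iff)
  qed
  have "op_integral \<A> \<mu> F = Y"
    unfolding op_integral_def
  proof (rule the_equality)
    show "Y \<in> \<A> \<and> (\<forall>\<phi>\<in>dual \<A>. has_bochner_integral \<mu> (\<lambda>t. \<phi> (F t)) (\<phi> Y))"
      using YA int by blast
    fix Z assume Z: "Z \<in> \<A> \<and> (\<forall>\<phi>\<in>dual \<A>. has_bochner_integral \<mu> (\<lambda>t. \<phi> (F t)) (\<phi> Z))"
    show "Z = Y"
    proof (rule blinfun_eqI, rule cinner_ext)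
      fix x y
      have "has_bochner_integral \<mu> (\<lambda>t. cinner (F t x) y) (cinner (Z x) y)"
        using bspec[OF conjunct2[OF Z] cinner_in_dual] .
      then show "cinner (Z x) y = cinner (Y x) y"
        by (rule has_bochner_integral_eq) (rule int[OF cinner_in_dual])
    qed
  qed
  with YA int show "op_integral \<A> \<mu> F \<in> \<A>"
    "\<phi> \<in> dual \<A> \<Longrightarrow> has_bochner_integral \<mu> (\<lambda>t. \<phi> (F t)) (\<phi> (op_integral \<A> \<mu> F))"
    by auto
qed

lemma op_integral_cinner:
  assumes "radon_measure \<mu>" "cstar_algebra \<A>" "continuous_field \<A> \<mu> F"
  shows "has_bochner_integral \<mu> (\<lambda>t. cinner (F t x) y) (cinner (op_integral \<A> \<mu> F x) y)"
  by (rule op_integral_has_bochner_integral(2)[OF assms cinner_in_dual])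

lemma op_integral_cinner_Re:
  assumes "radon_measure \<mu>" "cstar_algebra \<A>" "continuous_field \<A> \<mu> F"
  shows "has_bochner_integral \<mu> (\<lambda>t. Re (cinner (F t x) y)) (Re (cinner (op_integral \<A> \<mu> F x) y))"
  by (rule has_bochner_integral_bounded_linear[OF bounded_linear_Re op_integral_cinner[OF assms]])

lemma op_integral_self_adjoint:
  assumes "radon_measure \<mu>" "cstar_algebra \<A>" "continuous_field \<A> \<mu> F" "\<And>t. self_adjoint (F t)"
  shows "self_adjoint (op_integral \<A> \<mu> F)"
  unfolding self_adjoint_iff adjoint_pair_def
proof (intro allI)
  fix x y
  have eq: "cinner (F t x) y = cnj (cinner (F t y) x)" for t
    using assms(4)[of t] cinner_commute[of x "F t y"] by (simp add: self_adjoint_def)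
  have "has_bochner_integral \<mu> (\<lambda>t. cnj (cinner (F t y) x)) (cnj (cinner (op_integral \<A> \<mu> F y) x))"
    by (rule has_bochner_integral_bounded_linear[OF bounded_linear_cnj op_integral_cinner[OF assms(1-3)]])
  then have "cinner (op_integral \<A> \<mu> F x) y = cnj (cinner (op_integral \<A> \<mu> F y) x)"
    using has_bochner_integral_eq[OF op_integral_cinner[OF assms(1-3), of x y]] by (simp add: eq)
  also have "\<dots> = cinner x (op_integral \<A> \<mu> F y)"
    by (metis cinner_commute)
  finally show "cinner (op_integral \<A> \<mu> F x) y = cinner x (op_integral \<A> \<mu> F y)" .
qed

text \<open>The points and weights serve three fields at once, since the triple is itself a continuous
  field with integrable norm.\<close>

lemma op_integral_approximation_triple:
  fixes F G H :: "'b::t2_space \<Rightarrow> 'h::complex_hilbert_space \<Rightarrow>\<^sub>L 'h"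
  assumes \<mu>: "radon_measure \<mu>" and \<A>: "cstar_algebra \<A>" and \<epsilon>: "0 < \<epsilon>"
    and F: "continuous_field \<A> \<mu> F" and G: "continuous_field \<A> \<mu> G" and H: "continuous_field \<A> \<mu> H"
  obtains I :: "nat set" and w s where "finite I" "\<And>i. i \<in> I \<Longrightarrow> 0 < w i"
    "norm ((\<Sum>i\<in>I. w i *\<^sub>R F (s i)) - op_integral \<A> \<mu> F) \<le> \<epsilon>"
    "norm ((\<Sum>i\<in>I. w i *\<^sub>R G (s i)) - op_integral \<A> \<mu> G) \<le> \<epsilon>"
    "norm ((\<Sum>i\<in>I. w i *\<^sub>R H (s i)) - op_integral \<A> \<mu> H) \<le> \<epsilon>"
proof -
  define T where "T t = (F t, G t, H t)" for t
  have cont: "continuous_on UNIV T"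
    using F G H unfolding T_def continuous_field_def by (intro continuous_on_Pair) auto
  have sets: "sets \<mu> = sets borel" using \<mu> by (simp add: radon_measure_def)
  have "continuous_on UNIV (\<lambda>t. norm (T t))"
    using cont by (intro continuous_intros)
  then have "(\<lambda>t. norm (T t)) \<in> borel_measurable \<mu>"
    using borel_measurable_continuous_onI measurable_cong_sets[OF sets refl] by blast
  then have "integrable \<mu> (\<lambda>t. norm (T t))"
  proof (rule Bochner_Integration.integrable_bound[rotated])
    show "integrable \<mu> (\<lambda>t. norm (F t) + (norm (G t) + norm (H t)))"
      using F G H unfolding continuous_field_def by (intro Bochner_Integration.integrable_add) auto
    show "AE t in \<mu>. norm (norm (T t)) \<le> norm (norm (F t) + (norm (G t) + norm (H t)))"
      using norm_Pair_le[of "F _" "(G _, H _)"] norm_Pair_le[of "G _" "H _"]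
      unfolding T_def by (intro AE_I2) (smt (verit) norm_ge_zero real_norm_def)
  qed
  then show thesis
  proof (rule radon_finite_approximation[OF \<mu> cont _ \<epsilon>])
    fix I :: "nat set" and w :: "nat \<Rightarrow> real" and s :: "nat \<Rightarrow> 'b"
    assume I: "finite I" "\<And>i. i \<in> I \<Longrightarrow> 0 < w i"
      and approx: "\<And>K \<psi> :: _ \<Rightarrow> complex. \<lbrakk>0 \<le> K; \<And>t. cmod (\<psi> t) \<le> K * norm (T t);
          \<And>t u. cmod (\<psi> t - \<psi> u) \<le> K * norm (T t - T u)\<rbrakk>
        \<Longrightarrow> integrable \<mu> \<psi> \<and> cmod ((\<Sum>i\<in>I. w i *\<^sub>R \<psi> (s i)) - (\<integral>t. \<psi> t \<partial>\<mu>)) \<le> K * \<epsilon>"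
    have *: "norm ((\<Sum>i\<in>I. w i *\<^sub>R E (s i)) - op_integral \<A> \<mu> E) \<le> \<epsilon>"
      if E: "continuous_field \<A> \<mu> E" "\<And>t. norm (E t) \<le> norm (T t)" "\<And>t u. norm (E t - E u) \<le> norm (T t - T u)" for E
    proof (rule norm_blinfun_le_cinner)
      fix x y
      have "cmod (cinner (E t x) y) \<le> (norm x * norm y) * norm (T t)" for t
        by (rule order_trans[OF cinner_blinfun_le mult_left_mono[OF E(2)]]) simp
      moreover have "cmod (cinner (E t x) y - cinner (E u x) y) \<le> (norm x * norm y) * norm (T t - T u)" for t u
        using order_trans[OF cinner_blinfun_le[of "E t - E u" x y] mult_left_mono[OF E(3)[of t u]]]
        by (simp add: minus_blinfun.rep_eq cinner_diff_left)
      ultimately have "cmod ((\<Sum>i\<in>I. w i *\<^sub>R cinner (E (s i) x) y) - (\<integral>t. cinner (E t x) y \<partial>\<mu>))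
          \<le> (norm x * norm y) * \<epsilon>"
        using approx[of "norm x * norm y" "\<lambda>t. cinner (E t x) y"] by simp
      moreover have "(\<integral>t. cinner (E t x) y \<partial>\<mu>) = cinner (op_integral \<A> \<mu> E x) y"
        by (rule has_bochner_integral_integral_eq[OF op_integral_cinner[OF \<mu> \<A> E(1)]])
      ultimately show "cmod (cinner (((\<Sum>i\<in>I. w i *\<^sub>R E (s i)) - op_integral \<A> \<mu> E) x) y) \<le> (norm x * norm y) * \<epsilon>"
        by (simp add: minus_blinfun.rep_eq cinner_diff_left sum_blinfun_apply cinner_sum_left
            scaleR_blinfun.rep_eq cinner_scaleR_left)
    qed (use \<epsilon> in simp)
    have proj: "norm X \<le> norm (X, Y, Z)" "norm Y \<le> norm (X, Y, Z)" "norm Z \<le> norm (X, Y, Z)"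
      for X Y Z :: "'h \<Rightarrow>\<^sub>L 'h"
      using norm_fst_le[of X "(Y, Z)"] norm_snd_le[of "(Y, Z)" X] norm_fst_le[of Y Z]
        norm_snd_le[of Z Y] by linarith+
    show thesis
    proof (rule that[OF I])
      show "norm ((\<Sum>i\<in>I. w i *\<^sub>R F (s i)) - op_integral \<A> \<mu> F) \<le> \<epsilon>"
        by (intro *[OF F]) (simp_all add: T_def proj)
      show "norm ((\<Sum>i\<in>I. w i *\<^sub>R G (s i)) - op_integral \<A> \<mu> G) \<le> \<epsilon>"
        by (intro *[OF G]) (simp_all add: T_def proj)
      show "norm ((\<Sum>i\<in>I. w i *\<^sub>R H (s i)) - op_integral \<A> \<mu> H) \<le> \<epsilon>"
        by (intro *[OF H]) (simp_all add: T_def proj)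
    qed
  qed
qed

section \<open>Continuity of the fields\<close>

lemma op_in_perturb:
  assumes X: "op_in a b X" and Y: "self_adjoint Y" and d: "norm (Y - X) \<le> d"
  shows "op_in (a - d) (b + d) Y"
proof -
  have sa: "self_adjoint (Y - X)"
    using X Y by (simp add: self_adjoint_diff op_in_self_adjoint)
  have D: "op_in (- d) d (Y - X)"
    by (rule op_in_mono[OF self_adjoint_op_in_norm[OF sa]]) (use d in auto)
  have split: "Re (cinner (Y x) x) = Re (cinner (X x) x) + Re (cinner ((Y - X) x) x)" for x
    by (simp add: minus_blinfun.rep_eq cinner_diff_left)
  show ?thesis
    using op_in_lower[OF X] op_in_upper[OF X] op_in_lower[OF D] op_in_upper[OF D] Y
    unfolding op_in_def split left_diff_distrib distrib_right by (smt (verit) mult_minus_left)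
qed

lemma op_in_tendsto:
  assumes lim: "X \<longlonglongrightarrow> Y" and X: "\<And>n. op_in a b (X n)"
  shows "op_in a b Y"
proof -
  have "(\<lambda>n. Re (cinner (X n x) x)) \<longlonglongrightarrow> Re (cinner (Y x) x)" for x
    by (intro tendsto_Re tendsto_cinner bounded_bilinear.tendsto[OF bounded_bilinear_blinfun_apply]
        lim tendsto_const)
  then have "a * (norm x)\<^sup>2 \<le> Re (cinner (Y x) x)" "Re (cinner (Y x) x) \<le> b * (norm x)\<^sup>2" for x
    using op_in_lower[OF X] op_in_upper[OF X] by (blast intro: LIMSEQ_le_const LIMSEQ_le_const2)+
  moreover have "self_adjoint Y"
    using self_adjoint_tendsto[OF lim] op_in_self_adjoint[OF X] by simp
  ultimately show ?thesis by (simp add: op_in_def)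
qed

lemma strictly_positive_op_in_norm:
  assumes "strictly_positive X"
  obtains a where "0 < a" "op_in a (norm X) X"
  using strictly_positive_op_in[OF assms] by blast

lemma continuous_on_op_powr:
  fixes A :: "'t::topological_space \<Rightarrow> 'h::complex_hilbert_space \<Rightarrow>\<^sub>L 'h"
  assumes A: "continuous_on UNIV A" "\<And>s. strictly_positive (A s)"
  shows "continuous_on UNIV (\<lambda>s. op_powr (A s) r)"
  unfolding continuous_on_def
proof
  fix t
  obtain a where a: "0 < a" "op_in a (norm (A t)) (A t)"
    using strictly_positive_op_in_norm[OF A(2)] by blast
  have lim: "(A \<longlongrightarrow> A t) (at t)"
    using A(1) by (simp add: continuous_on_def)
  have "\<forall>\<^sub>F s in at t. dist (A s) (A t) < a / 2"
    by (rule tendstoD[OF lim]) (use a in simp)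
  then have "\<forall>\<^sub>F s in at t. op_in (a / 2) (norm (A t) + a / 2) (A s)"
  proof eventually_elim
    case (elim s)
    have "self_adjoint (A s)"
      using A(2)[of s] by (simp add: strictly_positive_def positive_op_def)
    from op_in_perturb[OF a(2) this, of "a / 2"] elim show ?case
      by (simp add: dist_norm)
  qed
  then show "((\<lambda>s. op_powr (A s) r) \<longlongrightarrow> op_powr (A t) r) (at t within UNIV)"
    unfolding op_powr_def
    by (rule tendsto_cfc[OF lim])
      (use a in \<open>auto intro: op_in_mono[OF a(2)] continuous_on_powr_Icc\<close>)
qed

text \<open>\<open>\<langle>A\<^bsup>-1/2\<^esup> B A\<^bsup>-1/2\<^esup> x, x\<rangle>\<close> is \<open>\<langle>B y, y\<rangle>\<close> at \<open>y = A\<^bsup>-1/2\<^esup> x\<close>, where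
  \<open>\<langle>A y, y\<rangle> = \<parallel>x\<parallel>\<^sup>2\<close>.\<close>

lemma rel_op_in:
  assumes A: "op_in a b A" "0 < a" and "m *\<^sub>R A \<preceq> B" "B \<preceq> M *\<^sub>R A"
  shows "op_in m M (rel_op A B)"
proof -
  define G where "G = op_powr A (-1/2)"
  have G: "adjoint_pair G G"
    using op_powr_self_adjoint[OF A] by (simp add: G_def self_adjoint_iff)
  have B: "self_adjoint B" using assms by (simp add: loewner_le_def)
  have "G o\<^sub>L A = op_powr A (1/2)"
    using op_powr_add[OF A, of "-1/2" 1] op_powr_1[OF A] by (simp add: G_def)
  then have GAG: "G o\<^sub>L A o\<^sub>L G = id_blinfun"
    using op_powr_inverse[OF A, of "1/2"] by (simp add: G_def)
  have "cinner (A (G x)) (G x) = cinner x x" for x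
    using GAG by (metis adjoint_pairD[OF G] blinfun_apply_blinfun_compose blinfun_apply_id_blinfun id_apply)
  then have AG: "Re (cinner (A (G x)) (G x)) = (norm x)\<^sup>2" for x
    by (simp add: Re_cinner_self)
  have low: "m * Re (cinner (A v) v) \<le> Re (cinner (B v) v)" for v
    using assms(3) by (auto simp: loewner_le_def positive_op_def minus_blinfun.rep_eq
        scaleR_blinfun.rep_eq cinner_diff_left cinner_scaleR_left)
  have up: "Re (cinner (B v) v) \<le> M * Re (cinner (A v) v)" for v
    using assms(4) by (auto simp: loewner_le_def positive_op_def minus_blinfun.rep_eq
        scaleR_blinfun.rep_eq cinner_diff_left cinner_scaleR_left)
  have eq: "cinner (rel_op A B x) x = cinner (B (G x)) (G x)" for x
    unfolding rel_op_def G_def[symmetric] by (simp add: adjoint_pairD[OF G])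
  have "self_adjoint (rel_op A B)"
    unfolding rel_op_def G_def[symmetric] by (rule self_adjoint_sandwich[OF G B])
  then show ?thesis
    using low[of "G _"] up[of "G _"] by (simp add: op_in_def eq AG)
qed

text \<open>The common shape of \<open>A \<natural>\<^sub>q B\<close> (for \<open>g(x) = x\<^sup>q\<close>) and of \<open>S\<^sub>q\<^sup>f(A|B)\<close> (for
  \<open>g(x) = x\<^sup>q f(x)\<close>).\<close>

definition sandwich ::
    "(real \<Rightarrow> real) \<Rightarrow> ('h::complex_hilbert_space \<Rightarrow>\<^sub>L 'h) \<Rightarrow> ('h \<Rightarrow>\<^sub>L 'h) \<Rightarrow> ('h \<Rightarrow>\<^sub>L 'h)" where
  "sandwich g A B = op_powr A (1/2) o\<^sub>L cfc g (rel_op A B) o\<^sub>L op_powr A (1/2)"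

lemma natural_mean_eq_sandwich: "natural_mean q A B = sandwich (\<lambda>x. x powr q) A B"
  by (simp add: natural_mean_def sandwich_def op_powr_def)

lemma op_entropy_eq_sandwich:
  assumes "op_in m M (rel_op A B)" "0 < m" "continuous_on {m..M} f"
  shows "op_entropy f q A B = sandwich (\<lambda>x. x powr q * f x) A B"
  using cfc_mult[OF assms(1) continuous_on_powr_Icc[OF assms(2)] assms(3), of q]
  by (simp add: op_entropy_def sandwich_def op_powr_def[of "rel_op A B"] blinfun_compose_assoc)

lemma norm_op_powr_half:
  assumes A: "op_in a b A" "0 < a"
  shows "norm (op_powr A (1/2)) \<le> sqrt (norm A)"
proof (rule norm_blinfun_bound)
  fix x
  let ?G = "op_powr A (1/2)"
  have G: "adjoint_pair ?G ?G"
    using op_powr_self_adjoint[OF A] by (simp add: self_adjoint_iff)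
  have "(norm (?G x))\<^sup>2 = Re (cinner ((?G o\<^sub>L ?G) x) x)"
    by (simp add: Re_cinner_self[symmetric] adjoint_pairD[OF G])
  also have "\<dots> \<le> norm A * (norm x)\<^sup>2"
    unfolding op_powr_half[OF A]
    by (rule op_in_upper[OF self_adjoint_op_in_norm[OF op_in_self_adjoint[OF A(1)]]])
  finally have "(norm (?G x))\<^sup>2 \<le> (sqrt (norm A) * norm x)\<^sup>2"
    by (simp only: power_mult_distrib real_sqrt_pow2[OF norm_ge_zero])
  then show "norm (?G x) \<le> sqrt (norm A) * norm x"
    by (rule power2_le_imp_le) simp
qed simp

lemma sandwich_self_adjoint:
  assumes "op_in a b A" "0 < a" "op_in m M (rel_op A B)" "continuous_on {m..M} g"
  shows "self_adjoint (sandwich g A B)"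
  unfolding sandwich_def
  using op_powr_self_adjoint[OF assms(1,2)] cfc_self_adjoint[OF assms(3,4)]
  by (intro self_adjoint_sandwich) (auto simp: self_adjoint_iff)

text \<open>Each value is a norm limit of polynomials in elements of the algebra; continuity is that of the
  functional calculus; and \<open>\<parallel>A\<^bsup>1/2\<^esup> g(X) A\<^bsup>1/2\<^esup>\<parallel> \<le> \<parallel>A\<parallel> sup \<bar>g\<bar>\<close> over \<open>[m, M]\<close> gives integrability.\<close>

lemma continuous_field_sandwich:
  fixes A B :: "'t::t2_space \<Rightarrow> 'h::complex_hilbert_space \<Rightarrow>\<^sub>L 'h"
  assumes \<mu>: "radon_measure \<mu>" and \<A>: "cstar_algebra \<A>" and id: "id_blinfun \<in> \<A>"
    and A: "continuous_field \<A> \<mu> A" and B: "continuous_field \<A> \<mu> B"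
    and A_pos: "\<And>s. strictly_positive (A s)"
    and X: "\<And>s. op_in m M (rel_op (A s) (B s))" and g: "continuous_on {m..M} g"
  shows "continuous_field \<A> \<mu> (\<lambda>s. sandwich g (A s) (B s))"
  unfolding continuous_field_def
proof (intro conjI allI)
  have powr_A: "op_powr (A s) r \<in> \<A>" for s r
  proof -
    obtain a where a: "0 < a" "op_in a (norm (A s)) (A s)"
      using strictly_positive_op_in_norm[OF A_pos] by blast
    show ?thesis
      unfolding op_powr_def
      by (rule cstar_algebra_cfc[OF \<A> id _ a(2) continuous_on_powr_Icc[OF a(1)]])
        (use A in \<open>simp add: continuous_field_def\<close>)
  qed
  have B_in: "B s \<in> \<A>" for s using B by (simp add: continuous_field_def)
  show "sandwich g (A s) (B s) \<in> \<A>" for s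
    unfolding sandwich_def rel_op_def
    by (intro cstar_algebra_compose[OF \<A>] powr_A
        cstar_algebra_cfc[OF \<A> id _ X[of s, unfolded rel_op_def] g] B_in)
  have powr_cont: "continuous_on UNIV (\<lambda>s. op_powr (A s) r)" for r
    by (rule continuous_on_op_powr) (use A A_pos in \<open>auto simp: continuous_field_def\<close>)
  have comp: "continuous_on UNIV (\<lambda>s. P s o\<^sub>L Q s)" if "continuous_on UNIV P" "continuous_on UNIV Q"
    for P Q :: "'t \<Rightarrow> 'h \<Rightarrow>\<^sub>L 'h"
    by (rule bounded_bilinear.continuous_on[OF bounded_bilinear_blinfun_compose that])
  have "continuous_on UNIV (\<lambda>s. rel_op (A s) (B s))"
    unfolding rel_op_def by (intro comp powr_cont) (use B in \<open>simp add: continuous_field_def\<close>)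
  then have "continuous_on UNIV (\<lambda>s. cfc g (rel_op (A s) (B s)))"
    unfolding continuous_on_def by (intro ballI tendsto_cfc[OF _ _ X g]) (simp_all add: X)
  then show cont: "continuous_on UNIV (\<lambda>s. sandwich g (A s) (B s))"
    unfolding sandwich_def by (intro comp powr_cont)
  obtain K where K: "\<forall>x\<in>{m..M}. \<bar>g x\<bar> \<le> K"
    using compact_imp_bounded[OF compact_continuous_image[OF g compact_Icc]]
    unfolding bounded_iff by auto
  have bound: "norm (sandwich g (A s) (B s)) \<le> max K 0 * norm (A s)" for s
  proof -
    obtain a where a: "0 < a" "op_in a (norm (A s)) (A s)"
      using strictly_positive_op_in_norm[OF A_pos] by blast
    have "norm (sandwich g (A s) (B s))
        \<le> norm (op_powr (A s) (1/2) o\<^sub>L cfc g (rel_op (A s) (B s))) * norm (op_powr (A s) (1/2))"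
      unfolding sandwich_def by (rule norm_blinfun_compose)
    also have "\<dots> \<le> (norm (op_powr (A s) (1/2)) * norm (cfc g (rel_op (A s) (B s)))) * norm (op_powr (A s) (1/2))"
      by (intro mult_right_mono norm_blinfun_compose norm_ge_zero)
    also have "\<dots> \<le> (sqrt (norm (A s)) * max K 0) * sqrt (norm (A s))"
    proof (intro mult_mono norm_op_powr_half[OF a(2,1)])
      show "norm (cfc g (rel_op (A s) (B s))) \<le> max K 0"
        by (rule norm_cfc_le[OF X g]) (use K in \<open>auto simp: le_max_iff_disj\<close>)
    qed auto
    finally show ?thesis by (simp add: mult_ac)
  qed
  have sets: "sets \<mu> = sets borel" using \<mu> by (simp add: radon_measure_def)
  have "continuous_on UNIV (\<lambda>s. norm (sandwich g (A s) (B s)))"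
    using cont by (intro continuous_intros)
  then have "(\<lambda>s. norm (sandwich g (A s) (B s))) \<in> borel_measurable \<mu>"
    using borel_measurable_continuous_onI measurable_cong_sets[OF sets refl] by blast
  then show "integrable \<mu> (\<lambda>s. norm (sandwich g (A s) (B s)))"
  proof (rule Bochner_Integration.integrable_bound[rotated])
    show "integrable \<mu> (\<lambda>s. max K 0 * norm (A s))"
      using A by (simp add: continuous_field_def)
    show "AE s in \<mu>. norm (norm (sandwich g (A s) (B s))) \<le> norm (max K 0 * norm (A s))"
      using bound by (intro AE_I2) (simp add: abs_mult)
  qed
qed


section \<open>The inequality\<close>

lemma powr_le_affine:
  fixes x p :: real
  assumes "0 < x" "0 \<le> p" "p \<le> 1"
  shows "x powr p \<le> 1 - p + p * x"
  using Youngs_inequality_0[of p "1 - p" x 1] assms by simp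

text \<open>The noncommutative weighted arithmetic-geometric mean inequality: evaluate
  \<open>x\<^sup>p \<le> 1 - p + p x\<close> at \<open>A\<^bsup>-1/2\<^esup> B A\<^bsup>-1/2\<^esup>\<close> and multiply by \<open>A\<^bsup>1/2\<^esup>\<close> on both sides.\<close>

lemma natural_mean_le:
  assumes A: "op_in a b A" "0 < a" and X: "op_in m M (rel_op A B)" "0 < m" and p: "0 \<le> p" "p \<le> 1"
  shows "Re (cinner (natural_mean p A B x) x) \<le> (1 - p) * Re (cinner (A x) x) + p * Re (cinner (B x) x)"
proof -
  define G where "G = op_powr A (1/2)"
  define N where "N = op_powr A (-1/2)"
  define X where "X = rel_op A B"
  have X_in: "op_in m M X" using X by (simp add: X_def)
  have G: "adjoint_pair G G"
    using op_powr_self_adjoint[OF A] by (simp add: G_def self_adjoint_iff)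
  have GN: "G (N v) = v" and NG: "N (G v) = v" for v
    using op_powr_inverse[OF A, of "1/2"] by (simp_all add: G_def N_def blinfun_eq_iff)
  have GXG: "G (X (G x)) = B x"
    unfolding X_def rel_op_def N_def[symmetric] by (simp add: GN NG)
  have GG: "G (G x) = A x"
    using op_powr_half[OF A] by (simp add: G_def blinfun_eq_iff)
  let ?h = "poly [:1 - p, p:]"
  have "cfc (\<lambda>x. ?h x - x powr p) X = cfc ?h X - cfc (\<lambda>x. x powr p) X"
    by (rule cfc_diff[OF X_in, symmetric]) (auto intro!: continuous_intros continuous_on_powr_Icc X(2))
  also have "cfc ?h X = (1 - p) *\<^sub>R id_blinfun + p *\<^sub>R X"
    by (subst cfc_poly[OF X_in]) (simp add: blinfun_compose_simps)
  finally have eq: "cfc (\<lambda>x. ?h x - x powr p) X = (1 - p) *\<^sub>R id_blinfun + p *\<^sub>R X - cfc (\<lambda>x. x powr p) X" .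
  have "0 \<le> Re (cinner (cfc (\<lambda>x. ?h x - x powr p) X (G x)) (G x))"
    by (rule cfc_nonneg[OF X_in])
      (use X(2) p powr_le_affine[of _ p] in \<open>auto intro!: continuous_intros simp: mult.commute\<close>)
  also have "\<dots> = (1 - p) * Re (cinner (G x) (G x)) + p * Re (cinner (X (G x)) (G x))
      - Re (cinner (cfc (\<lambda>x. x powr p) X (G x)) (G x))"
    unfolding eq minus_blinfun.rep_eq plus_blinfun.rep_eq scaleR_blinfun.rep_eq
    by (simp add: cinner_diff_left cinner_add_left cinner_scaleR_left del: blinfun_apply_blinfun_compose)
  also have "cinner (G x) (G x) = cinner (A x) x"
    by (simp add: adjoint_pairD[OF adjoint_pair_sym[OF G], symmetric] GG[symmetric])
  also have "cinner (X (G x)) (G x) = cinner (B x) x"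
    by (simp add: GXG[symmetric] adjoint_pairD[OF G])
  also have "cinner (cfc (\<lambda>x. x powr p) X (G x)) (G x) = cinner (natural_mean p A B x) x"
    by (simp add: natural_mean_def op_powr_def[of "rel_op A B"] X_def G_def[symmetric] adjoint_pairD[OF G])
  finally show ?thesis by simp
qed

text \<open>Jensen's inequality with one more summand, whose weight \<open>Q\<close> completes the others to \<open>c I\<close> and whose
  operator is the scalar \<open>t\<^sub>0\<close>; it has the index \<open>None\<close> in the proof. The factor \<open>c\<close> leaves room for
  weights that sum to slightly more than the identity.\<close>

lemma jensen_completed:
  fixes C :: "'i \<Rightarrow> 'h::complex_hilbert_space \<Rightarrow>\<^sub>L 'h"
  assumes f: "operator_concave_on TYPE(nat \<Rightarrow> 'h \<times> complex) J f" and J: "{a..b} \<subseteq> J"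
    and I: "finite I"
    and C: "\<And>i. i \<in> I \<Longrightarrow> adjoint_pair (C i) (C' i)" "\<And>i. i \<in> I \<Longrightarrow> invertible_op (C i)"
    and X: "\<And>i. i \<in> I \<Longrightarrow> op_in a b (X i)"
    and Q: "op_in \<delta> \<beta> Q" "0 < \<delta>" and t\<^sub>0: "t\<^sub>0 \<in> {a..b}" and c: "0 < c"
    and unit: "(\<Sum>i\<in>I. C' i o\<^sub>L C i) + Q = c *\<^sub>R id_blinfun"
  defines "Z \<equiv> (1 / c) *\<^sub>R ((\<Sum>i\<in>I. C' i o\<^sub>L X i o\<^sub>L C i) + t\<^sub>0 *\<^sub>R Q)"
  shows "op_in a b Z"
    and "(\<Sum>i\<in>I. Re (cinner (cfc f (X i) (C i x)) (C i x))) + f t\<^sub>0 * Re (cinner (Q x) x)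
      \<le> c * Re (cinner (cfc f Z x) x)"
proof -
  define E where "E = op_powr Q (1/2)"
  define N where "N = op_powr Q (-1/2)"
  have E: "adjoint_pair E E" and N: "adjoint_pair N N"
    using op_powr_self_adjoint[OF Q] by (auto simp: E_def N_def self_adjoint_iff)
  have EE: "E o\<^sub>L E = Q"
    unfolding E_def by (rule op_powr_half[OF Q])
  have E_inv: "invertible_op E"
    using op_powr_inverse[OF Q, of "1/2"] bounded_operators_if_adjoint_pair[OF N]
    by (auto simp: invertible_op_def E_def N_def)
  define D where "D = case_option E C"
  define D' where "D' = case_option E C'"
  define Y where "Y = case_option (t\<^sub>0 *\<^sub>R id_blinfun) X"
  let ?I = "insert None (Some ` I)"
  have sum: "(\<Sum>i\<in>?I. h i) = h None + (\<Sum>i\<in>I. h (Some i))" for h :: "'i option \<Rightarrow> 'b::comm_monoid_add"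
    using I by (simp add: sum.reindex)
  have t0_in: "op_in a b (t\<^sub>0 *\<^sub>R id_blinfun :: 'h \<Rightarrow>\<^sub>L 'h)"
    by (rule op_in_mono[OF op_in_scaleR_id]) (use t\<^sub>0 in auto)
  have r: "sqrt c * sqrt c = c" "1 / sqrt c * (1 / sqrt c) = 1 / c" "sqrt c \<noteq> 0"
    using c by auto
  let ?K = "sqrt c *\<^sub>R id_blinfun :: 'h \<Rightarrow>\<^sub>L 'h" and ?H = "(1 / sqrt c) *\<^sub>R id_blinfun :: 'h \<Rightarrow>\<^sub>L 'h"
  have "?K o\<^sub>L ?K = (\<Sum>i\<in>?I. D' i o\<^sub>L D i)"
    unfolding sum by (simp add: D_def D'_def EE blinfun_compose_simps r unit[symmetric] abs_of_pos[OF c] add.commute)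
  moreover have "?K o\<^sub>L ?H = id_blinfun" "?H o\<^sub>L ?K = id_blinfun"
    using r by (simp_all add: blinfun_compose_simps)
  moreover have "adjoint_pair (D i) (D' i)" "invertible_op (D i)" "op_in a b (Y i)" if "i \<in> ?I" for i
    using that C X E E_inv t0_in by (auto simp: D_def D'_def Y_def)
  moreover have "?H o\<^sub>L (\<Sum>i\<in>?I. D' i o\<^sub>L Y i o\<^sub>L D i) o\<^sub>L ?H = Z"
    unfolding sum
    by (simp add: D_def D'_def Y_def Z_def blinfun_compose_simps EE r scaleR_add_right
        abs_of_pos[OF c] add.commute)
  moreover have "adjoint_pair ?K ?K" "adjoint_pair ?H ?H"
    by (intro adjoint_pair_scaleR adjoint_pair_id)+
  ultimately have jensen: "op_in a b Z" "(\<Sum>i\<in>?I. Re (cinner (cfc f (Y i) (D i x)) (D i x)))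
      \<le> Re (cinner (cfc f Z (?K x)) (?K x))"
    using jensen_finite[OF f J, of ?I D D' Y ?K ?K ?H ?H] I by auto
  show "op_in a b Z" by (rule jensen(1))
  have "Re (cinner (cfc f (t\<^sub>0 *\<^sub>R id_blinfun) (E x)) (E x)) = f t\<^sub>0 * Re (cinner (Q x) x)"
    using EE adjoint_pairD[OF E, of "E x" x]
    by (simp add: cfc_scaleR_id scaleR_blinfun.rep_eq cinner_scaleR_left blinfun_eq_iff)
  moreover have "Re (cinner (cfc f Z (?K x)) (?K x)) = c * Re (cinner (cfc f Z x) x)"
    using r by (simp add: scaleR_blinfun.rep_eq blinfun.scaleR_right cinner_scaleR_left
        cinner_scaleR_right mult.assoc[symmetric])
  ultimately show "(\<Sum>i\<in>I. Re (cinner (cfc f (X i) (C i x)) (C i x))) + f t\<^sub>0 * Re (cinner (Q x) x)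
      \<le> c * Re (cinner (cfc f Z x) x)"
    using jensen(2) unfolding sum by (simp add: D_def Y_def add.commute)
qed

text \<open>With \<open>C = X\<^bsup>p/2\<^esup> A\<^bsup>1/2\<^esup>\<close> the three kinds of operators in the theorem are \<open>C\<^sup>* C\<close>,
  \<open>C\<^sup>* X C\<close> and \<open>C\<^sup>* f(X) C\<close>.\<close>

lemma sandwich_factorization:
  fixes p :: real
  assumes A: "op_in a b A" "0 < a" and X: "op_in m M (rel_op A B)" "0 < m" and f: "continuous_on {m..M} f"
  defines "C \<equiv> op_powr (rel_op A B) (p / 2) o\<^sub>L op_powr A (1/2)"
    and "C' \<equiv> op_powr A (1/2) o\<^sub>L op_powr (rel_op A B) (p / 2)"
  shows "adjoint_pair C C'" "invertible_op C"
    "C' o\<^sub>L C = natural_mean p A B"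
    "C' o\<^sub>L rel_op A B o\<^sub>L C = natural_mean (p + 1) A B"
    "C' o\<^sub>L cfc f (rel_op A B) o\<^sub>L C = op_entropy f p A B"
proof -
  let ?X = "rel_op A B"
  show "adjoint_pair C C'"
    unfolding C_def C'_def using op_powr_self_adjoint[OF A] op_powr_self_adjoint[OF X]
    by (intro adjoint_pair_compose) (auto simp: self_adjoint_iff)
  have "invertible_op (op_powr Y r)" if "op_in u v Y" "0 < u" for u v r and Y :: "'a \<Rightarrow>\<^sub>L 'a"
    unfolding invertible_op_def
    using op_powr_inverse[OF that] self_adjoint_bounded[OF op_powr_self_adjoint[OF that]] by blast
  then show "invertible_op C"
    unfolding C_def using A X by (blast intro: invertible_op_compose)
  have half: "op_powr ?X (p / 2) o\<^sub>L op_powr ?X (p / 2) = op_powr ?X p"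
    using op_powr_add[OF X, of "p / 2" "p / 2"] by simp
  show "C' o\<^sub>L C = natural_mean p A B"
    unfolding natural_mean_def half[symmetric] by (simp add: C_def C'_def blinfun_compose_assoc)
  have "op_powr ?X (p / 2) o\<^sub>L ?X o\<^sub>L op_powr ?X (p / 2) = op_powr ?X (p + 1)"
    using op_powr_add[OF X, of "p / 2" 1] op_powr_add[OF X, of "p / 2 + 1" "p / 2"]
    by (simp add: op_powr_1[OF X] algebra_simps)
  then show "C' o\<^sub>L ?X o\<^sub>L C = natural_mean (p + 1) A B"
    unfolding natural_mean_def by (metis C_def C'_def blinfun_compose_assoc)
  have "op_powr ?X (p / 2) o\<^sub>L cfc f ?X = cfc f ?X o\<^sub>L op_powr ?X (p / 2)"
    unfolding op_powr_def
      cfc_mult[OF X(1) f continuous_on_powr_Icc[OF X(2)]]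
      cfc_mult[OF X(1) continuous_on_powr_Icc[OF X(2)] f]
    by (simp add: mult.commute)
  then have "op_powr ?X (p / 2) o\<^sub>L cfc f ?X o\<^sub>L op_powr ?X (p / 2) = op_powr ?X p o\<^sub>L cfc f ?X"
    by (metis half blinfun_compose_assoc)
  then show "C' o\<^sub>L cfc f ?X o\<^sub>L C = op_entropy f p A B"
    unfolding op_entropy_def by (metis C_def C'_def blinfun_compose_assoc)
qed

lemma tendsto_if_norm_diff_le_inverse:
  fixes X :: "nat \<Rightarrow> 'a::real_normed_vector"
  assumes "\<And>n. norm (X n - Y) \<le> 1 / real (Suc n)"
  shows "X \<longlonglongrightarrow> Y"
proof (rule LIM_zero_cancel, rule Lim_null_comparison)
  show "\<forall>\<^sub>F n in sequentially. norm (X n - Y) \<le> 1 / real (Suc n)"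
    using assms by simp
  show "(\<lambda>n. 1 / real (Suc n)) \<longlonglongrightarrow> 0"
    using LIMSEQ_inverse_real_of_nat by (simp add: inverse_eq_divide)
qed

theorem theorem2p4:
  fixes \<A> :: "('h::complex_hilbert_space \<Rightarrow>\<^sub>L 'h) set"
    and \<mu> :: "'t::t2_space measure"
    and A B :: "'t \<Rightarrow> ('h \<Rightarrow>\<^sub>L 'h)"
    and f :: "real \<Rightarrow> real"
    and p t\<^sub>0 m M :: real
  assumes "locally_compact_space (euclidean :: 't topology)"
    and "radon_measure \<mu>"
    and "cstar_algebra \<A>"
    and "continuous_field \<A> \<mu> A" and "continuous_field \<A> \<mu> B"
    and "\<And>s. strictly_positive (A s)" and "\<And>s. strictly_positive (B s)"
    and "0 < m" and "m < 1" and "1 < M"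
    and "\<And>s. m *\<^sub>R A s \<preceq> B s" and "\<And>s. B s \<preceq> M *\<^sub>R A s"
    and "op_integral \<A> \<mu> A = id_blinfun" and "op_integral \<A> \<mu> B = id_blinfun"
    and "\<And>x. 0 < x \<Longrightarrow> 0 \<le> f x"
    and "operator_concave_on TYPE(nat \<Rightarrow> 'h \<times> complex) {0<..} f"
    and "0 \<le> p" and "p \<le> 1"
    and "0 < t\<^sub>0"
  shows "relative_op_entropy \<A> \<mu> f p A B \<preceq>
    cfc f (op_integral \<A> \<mu> (\<lambda>s. natural_mean (p + 1) (A s) (B s)) +
           t\<^sub>0 *\<^sub>R (id_blinfun - op_integral \<A> \<mu> (\<lambda>s. natural_mean p (A s) (B s))))
    - f t\<^sub>0 *\<^sub>R (id_blinfun - op_integral \<A> \<mu> (\<lambda>s. natural_mean p (A s) (B s)))"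
proof -
  note \<mu> = assms(2) and \<A> = assms(3) and A = assms(4) and B = assms(5) and A_pos = assms(6)
    and m = assms(8) and intA = assms(13) and intB = assms(14) and conc = assms(16) and p = assms(17,18)
    and t\<^sub>0 = assms(19)
  have id: "id_blinfun \<in> \<A>"
    using op_integral_has_bochner_integral(1)[OF \<mu> \<A> A] intA by simp
  define X where "X s = rel_op (A s) (B s)" for s
  have "\<exists>a. 0 < a \<and> op_in a (norm (A s)) (A s)" for s
    using strictly_positive_op_in_norm[OF A_pos] by metis
  then obtain \<alpha> where \<alpha>: "0 < \<alpha> s" "op_in (\<alpha> s) (norm (A s)) (A s)" for s
    by metis
  have X: "op_in m M (rel_op (A s) (B s))" for s
    by (rule rel_op_in[OF \<alpha>(2,1) assms(11,12)])
  have cont_f: "continuous_on {m..M} f"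
    using conc m by (auto simp: operator_concave_on_def intro: continuous_on_subset)
  let ?L = "\<lambda>s. natural_mean p (A s) (B s)" and ?R = "\<lambda>s. natural_mean (p + 1) (A s) (B s)"
    and ?S = "\<lambda>s. op_entropy f p (A s) (B s)"
  have fields: "continuous_field \<A> \<mu> ?L" "continuous_field \<A> \<mu> ?R" "continuous_field \<A> \<mu> ?S"
    unfolding natural_mean_eq_sandwich op_entropy_eq_sandwich[OF X m cont_f]
    by (intro continuous_field_sandwich[OF \<mu> \<A> id A B A_pos X] continuous_on_powr_Icc[OF m]
        continuous_on_mult cont_f)+
  have sa: "self_adjoint (?L s)" "self_adjoint (?S s)" for s
    unfolding natural_mean_eq_sandwich op_entropy_eq_sandwich[OF X m cont_f]
    by (intro sandwich_self_adjoint[OF \<alpha>(2,1) X] continuous_on_powr_Icc[OF m]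
        continuous_on_mult cont_f)+
  define L where "L = op_integral \<A> \<mu> ?L"
  define R where "R = op_integral \<A> \<mu> ?R"
  define S where "S = op_integral \<A> \<mu> ?S"
  have L_sa: "self_adjoint L" and S_sa: "self_adjoint S"
    unfolding L_def S_def by (intro op_integral_self_adjoint[OF \<mu> \<A>] fields sa)+
  have L_le: "Re (cinner (L x) x) \<le> (norm x)\<^sup>2" for x
  proof -
    have L_int: "has_bochner_integral \<mu> (\<lambda>s. Re (cinner (?L s x) x)) (Re (cinner (L x) x))"
      unfolding L_def by (rule op_integral_cinner_Re[OF \<mu> \<A> fields(1)])
    have "has_bochner_integral \<mu> (\<lambda>s. (1 - p) * Re (cinner (A s x) x) + p * Re (cinner (B s x) x))
        ((1 - p) * Re (cinner (op_integral \<A> \<mu> A x) x) + p * Re (cinner (op_integral \<A> \<mu> B x) x))"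
      by (intro has_bochner_integral_add has_bochner_integral_mult_right op_integral_cinner_Re[OF \<mu> \<A>] A B)
    then have AB_int: "has_bochner_integral \<mu>
        (\<lambda>s. (1 - p) * Re (cinner (A s x) x) + p * Re (cinner (B s x) x)) ((norm x)\<^sup>2)"
      by (simp add: intA intB Re_cinner_self algebra_simps)
    show ?thesis
      using integral_mono[OF integrable.intros[OF L_int] integrable.intros[OF AB_int]
        natural_mean_le[OF \<alpha>(2,1) X m p]]
      by (simp add: has_bochner_integral_integral_eq[OF L_int] has_bochner_integral_integral_eq[OF AB_int])
  qed
  define Q where "Q = id_blinfun - L"
  have Q_sa: "self_adjoint Q"
    unfolding Q_def by (intro self_adjoint_diff self_adjoint_id L_sa)
  have Q_in: "op_in 0 (norm Q) Q"
    using op_in_upper[OF self_adjoint_op_in_norm[OF Q_sa]] L_le Q_sa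
    by (simp add: op_in_def Q_def minus_blinfun.rep_eq cinner_diff_left Re_cinner_self)
  define a where "a = min m t\<^sub>0"
  define b where "b = max M t\<^sub>0"
  have ab: "{a..b} \<subseteq> {0<..}" "t\<^sub>0 \<in> {a..b}"
    using m t\<^sub>0 by (auto simp: a_def b_def)
  have X_ab: "op_in a b (X s)" for s
    unfolding X_def by (rule op_in_mono[OF X]) (auto simp: a_def b_def)
  have cont_ab: "continuous_on {a..b} f"
    using conc ab by (auto simp: operator_concave_on_def intro: continuous_on_subset)
  define c where "c n = 1 + 2 / real (Suc n)" for n
  have c: "0 < c n" for n by (simp add: c_def add_pos_nonneg)
  define Z where "Z Ln Rn n = (1 / c n) *\<^sub>R (Rn + t\<^sub>0 *\<^sub>R (c n *\<^sub>R id_blinfun - Ln))"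
    for Ln Rn :: "'h \<Rightarrow>\<^sub>L 'h" and n
  have "\<exists>Ln Rn Sn. norm (Ln - L) \<le> 1 / real (Suc n) \<and> norm (Rn - R) \<le> 1 / real (Suc n) \<and>
      norm (Sn - S) \<le> 1 / real (Suc n) \<and> op_in a b (Z Ln Rn n) \<and>
      (\<forall>x. Re (cinner (Sn x) x) + f t\<^sub>0 * Re (cinner ((c n *\<^sub>R id_blinfun - Ln) x) x)
        \<le> c n * Re (cinner (cfc f (Z Ln Rn n) x) x))" for n
  proof -
    have \<epsilon>: "0 < 1 / real (Suc n)" by simp
    from \<epsilon> show ?thesis
    proof (rule op_integral_approximation_triple[OF \<mu> \<A> _ fields])
      fix I :: "nat set" and w :: "nat \<Rightarrow> real" and s :: "nat \<Rightarrow> 't"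
      assume I: "finite I" "\<And>i. i \<in> I \<Longrightarrow> 0 < w i"
        and approx_integral: "norm ((\<Sum>i\<in>I. w i *\<^sub>R ?L (s i)) - op_integral \<A> \<mu> ?L) \<le> 1 / real (Suc n)"
          "norm ((\<Sum>i\<in>I. w i *\<^sub>R ?R (s i)) - op_integral \<A> \<mu> ?R) \<le> 1 / real (Suc n)"
          "norm ((\<Sum>i\<in>I. w i *\<^sub>R ?S (s i)) - op_integral \<A> \<mu> ?S) \<le> 1 / real (Suc n)"
      note approx = approx_integral[folded L_def R_def S_def]
      define Ln where "Ln = (\<Sum>i\<in>I. w i *\<^sub>R ?L (s i))"
      define Rn where "Rn = (\<Sum>i\<in>I. w i *\<^sub>R ?R (s i))"
      define Sn where "Sn = (\<Sum>i\<in>I. w i *\<^sub>R ?S (s i))"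
      define C where "C i = sqrt (w i) *\<^sub>R (op_powr (X (s i)) (p / 2) o\<^sub>L op_powr (A (s i)) (1/2))" for i
      define C' where "C' i = sqrt (w i) *\<^sub>R (op_powr (A (s i)) (1/2) o\<^sub>L op_powr (X (s i)) (p / 2))" for i
      note fact = sandwich_factorization[OF \<alpha>(2,1) X m cont_f, where p = p, folded X_def]
      have C: "adjoint_pair (C i) (C' i)" for i
        unfolding C_def C'_def by (intro adjoint_pair_scaleR fact)
      have C_inv: "invertible_op (C i)" if "i \<in> I" for i
        using invertible_op_compose[OF invertible_op_scaleR_id[of "sqrt (w i)"] fact(2)[of "s i"]] I(2)[OF that]
        by (simp add: C_def blinfun_compose_simps)
      have CC: "C' i o\<^sub>L C i = w i *\<^sub>R ?L (s i)" "C' i o\<^sub>L X (s i) o\<^sub>L C i = w i *\<^sub>R ?R (s i)"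
        "C' i o\<^sub>L cfc f (X (s i)) o\<^sub>L C i = w i *\<^sub>R ?S (s i)" if "i \<in> I" for i
        using fact(3,4,5)[of "s i"] I(2)[OF that]
        by (simp_all add: C_def C'_def blinfun_compose_simps)
      define Qn where "Qn = c n *\<^sub>R id_blinfun - Ln"
      have "self_adjoint Qn"
        unfolding Qn_def Ln_def self_adjoint_iff
        by (intro adjoint_pair_diff adjoint_pair_scaleR adjoint_pair_id adjoint_pair_sum
            self_adjoint_adjoint_pair sa)
      \<comment> \<open>The scalar \<open>c n\<close> exceeds \<open>1\<close> by twice the error, so \<open>Qn\<close> is at least the error and invertible.\<close>
      moreover have "op_in (2 / real (Suc n)) (norm Q + 2 / real (Suc n)) (Q + (2 / real (Suc n)) *\<^sub>R id_blinfun)"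
        using Q_in by (simp add: op_in_def self_adjoint_add self_adjoint_scaleR self_adjoint_id
            plus_blinfun.rep_eq scaleR_blinfun.rep_eq cinner_add_left cinner_scaleR_left Re_cinner_self
            algebra_simps)
      moreover have "Qn - (Q + (2 / real (Suc n)) *\<^sub>R id_blinfun) = L - Ln"
        by (simp add: Qn_def Q_def c_def algebra_simps)
      ultimately have "op_in (2 / real (Suc n) - 1 / real (Suc n)) (norm Q + 2 / real (Suc n) + 1 / real (Suc n)) Qn"
        using approx(1) by (intro op_in_perturb) (auto simp: Ln_def norm_minus_commute)
      moreover have "2 / real (Suc n) - 1 / real (Suc n) = 1 / real (Suc n)"
        by (simp add: diff_divide_distrib[symmetric])
      ultimately have Qn: "op_in (1 / real (Suc n)) (norm Q + 2 / real (Suc n) + 1 / real (Suc n)) Qn"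
        by simp
      have unit: "(\<Sum>i\<in>I. C' i o\<^sub>L C i) + Qn = c n *\<^sub>R id_blinfun"
        by (simp add: CC Qn_def Ln_def cong: sum.cong)
      have Zn: "(1 / c n) *\<^sub>R ((\<Sum>i\<in>I. C' i o\<^sub>L X (s i) o\<^sub>L C i) + t\<^sub>0 *\<^sub>R Qn) = Z Ln Rn n"
        by (simp add: CC Z_def Rn_def Qn_def cong: sum.cong)
      note jensen = jensen_completed[where C = C and C' = C' and X = "\<lambda>i. X (s i)", OF conc ab(1) I(1) C C_inv X_ab
          Qn \<epsilon> ab(2) c unit, unfolded Zn]
      have "(\<Sum>i\<in>I. Re (cinner (cfc f (X (s i)) (C i x)) (C i x))) = Re (cinner (Sn x) x)" for x
        unfolding Sn_def sum_blinfun_apply cinner_sum_left Re_sum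
      proof (intro sum.cong refl)
        fix i assume "i \<in> I"
        show "Re (cinner (cfc f (X (s i)) (C i x)) (C i x)) = Re (cinner ((w i *\<^sub>R ?S (s i)) x) x)"
          unfolding CC(3)[OF \<open>i \<in> I\<close>, symmetric]
          by (simp add: adjoint_pairD[OF adjoint_pair_sym[OF C]])
      qed
      then show ?thesis
        using approx jensen unfolding Qn_def Ln_def[symmetric] Rn_def[symmetric] Sn_def[symmetric]
        by (intro exI[of _ Ln] exI[of _ Rn] exI[of _ Sn]) simp
    qed
  qed
  then obtain Ln Rn Sn where
    L_lim: "\<And>n. norm (Ln n - L) \<le> 1 / real (Suc n)" and R_lim: "\<And>n. norm (Rn n - R) \<le> 1 / real (Suc n)" and
    S_lim: "\<And>n. norm (Sn n - S) \<le> 1 / real (Suc n)" and Z_in: "\<And>n. op_in a b (Z (Ln n) (Rn n) n)" and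
    ineq: "\<And>n x. Re (cinner (Sn n x) x) + f t\<^sub>0 * Re (cinner ((c n *\<^sub>R id_blinfun - Ln n) x) x)
        \<le> c n * Re (cinner (cfc f (Z (Ln n) (Rn n) n) x) x)"
    by metis
  have c_lim: "c \<longlonglongrightarrow> 1"
    using tendsto_add[OF tendsto_const tendsto_mult[OF tendsto_const LIMSEQ_inverse_real_of_nat], of 1 2]
    by (simp add: c_def[abs_def] divide_inverse)
  have lims: "Ln \<longlonglongrightarrow> L" "Rn \<longlonglongrightarrow> R" "Sn \<longlonglongrightarrow> S"
    by (intro tendsto_if_norm_diff_le_inverse L_lim R_lim S_lim)+
  have Q_lim: "(\<lambda>n. c n *\<^sub>R id_blinfun - Ln n) \<longlonglongrightarrow> Q"
    using tendsto_diff[OF tendsto_scaleR[OF c_lim tendsto_const] lims(1), of id_blinfun] by (simp add: Q_def)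
  have "(\<lambda>n. (1 / c n) *\<^sub>R (Rn n + t\<^sub>0 *\<^sub>R (c n *\<^sub>R id_blinfun - Ln n))) \<longlonglongrightarrow> (1 / 1) *\<^sub>R (R + t\<^sub>0 *\<^sub>R Q)"
    by (intro tendsto_scaleR tendsto_divide tendsto_add tendsto_const c_lim lims Q_lim) simp
  then have Z_lim: "(\<lambda>n. Z (Ln n) (Rn n) n) \<longlonglongrightarrow> R + t\<^sub>0 *\<^sub>R Q"
    by (simp add: Z_def)
  have Z: "op_in a b (R + t\<^sub>0 *\<^sub>R Q)"
    by (rule op_in_tendsto[OF Z_lim Z_in])
  have fZ_lim: "(\<lambda>n. cfc f (Z (Ln n) (Rn n) n)) \<longlonglongrightarrow> cfc f (R + t\<^sub>0 *\<^sub>R Q)"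
    by (rule tendsto_cfc[OF Z_lim _ Z cont_ab]) (simp add: Z_in)
  have form_lim: "(\<lambda>n. Re (cinner (Y n x) x)) \<longlonglongrightarrow> Re (cinner (Y' x) x)" if "Y \<longlonglongrightarrow> Y'"
    for Y and Y' :: "'h \<Rightarrow>\<^sub>L 'h" and x
    by (intro tendsto_Re tendsto_cinner bounded_bilinear.tendsto[OF bounded_bilinear_blinfun_apply]
        that tendsto_const)
  have le: "Re (cinner (S x) x) + f t\<^sub>0 * Re (cinner (Q x) x) \<le> 1 * Re (cinner (cfc f (R + t\<^sub>0 *\<^sub>R Q) x) x)" for x
    by (rule LIMSEQ_le[OF tendsto_add[OF form_lim[OF lims(3)] tendsto_mult_left[OF form_lim[OF Q_lim]]]
          tendsto_mult[OF c_lim form_lim[OF fZ_lim]]]) (use ineq in blast)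
  have rhs_sa: "self_adjoint (cfc f (R + t\<^sub>0 *\<^sub>R Q) - f t\<^sub>0 *\<^sub>R Q)"
    by (intro self_adjoint_diff self_adjoint_scaleR cfc_self_adjoint[OF Z cont_ab] Q_sa)
  have "S \<preceq> cfc f (R + t\<^sub>0 *\<^sub>R Q) - f t\<^sub>0 *\<^sub>R Q"
    unfolding loewner_le_def positive_op_def
  proof (intro conjI allI S_sa rhs_sa self_adjoint_diff)
    fix x
    show "0 \<le> Re (cinner ((cfc f (R + t\<^sub>0 *\<^sub>R Q) - f t\<^sub>0 *\<^sub>R Q - S) x) x)"
      using le[of x] by (simp add: minus_blinfun.rep_eq scaleR_blinfun.rep_eq cinner_diff_left cinner_scaleR_left)
  qed
  then show ?thesis
    by (simp add: relative_op_entropy_def S_def R_def Q_def L_def)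
qed

end
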